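(* Finite dimensional $\ell_2$-simplicial complexes are uniformly cofibrant.
   Context: $\ell_2$-simplicial complexes. The $\ell_2$-simplex is the topological simplex $\{(t_0,\ldots,t_n)\in[0,1]^{n+1}\mid t_0+\cdots+t_n=1\}$ with the metric inherited from the Euclidean norm on $\mathbb{R}^{n+1}$. An $\ell_2$-simplicial complex is a simplicial complex $X$ equipped with the extended metric in which the distance between $x,y$ is the infimum of the sums $\sum_{i=1}^n\lambda_i$ over all finite sequences $x=x_0,x_1,\ldots,x_n=y$ in $X$ such that, for each $1\le i\le n$, $x_{i-1},x_i$ lie in a common simplex, naturally identified with an $\ell_2$-simplex by a linear homeomorphism, in which they are at distance at most $\lambda_i$ (and $\infty$ if there is no such sequence). It is regarded as a $\mathscr{U}$-object (defined below) through the forgetful functor $\mathscr{M}\to\mathscr{U}$. Spaces and uniform spaces. $\mathscr{T}$ is the category of Tychonoff spaces which are colimits of compact, locally connected, second-countable spaces, and continuous maps; it is Cartesian closed. Metrics are allowed to take the value $\infty$. $\mathscr{U}$ is the category of separated uniform spaces which are uniform colimits (colimits of uniform spaces and uniform maps) of connected, locally connected metric spaces, and uniform maps; it is Cartesian closed and coreflective in separated uniform spaces. Write $Y^X$ for exponentials in $\mathscr{U}$; $\mathscr{U}$ is $\mathscr{T}$-enriched with $\mathscr{U}(X,Y)$ given the uniform topology of $Y^X$. A uniform map $f$ is a uniform Hurewicz fibration if for every $\mathscr{U}$-object $Z$ the continuous map $\mathscr{U}(Z,f)$ has the right lifting property against the inclusion $\{0\}\hookrightarrow[0,1]$. $\mathscr{M}$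 is the category of extended metric spaces and $1$-Lipschitz maps; the forgetful functor $\mathscr{M}\to\mathscr{U}$ sends $X$ to the coreflection in $\mathscr{U}$ of its underlying uniform space. Cubical sets and realizations. Let $[n]=\{0<\cdots<n\}$. $\square$ is the submonoidal category of the Cartesian monoidal category of small categories generated by $[0],[1]$, the two functors $[0]\to[1]$, the functor $[1]\to[0]$ and the join $\vee:[1]^2\to[1]$; its objects are the posets $[1]^n$. Cubical sets are functors $\square^{op}\to\mathbf{Set}$, forming the category $c\mathbf{Set}$; $\square[1]^n$ is the representable on $[1]^n$. Geometric realization $|-|_\sphericalangle:c\mathbf{Set}\to\mathscr{M}$ is the cocontinuous functor sending $\square[1]^n$ to $[0,1]^n$ with the max metric and sending $\square[\phi]$, for $\phi:[1]^m\to[1]^n$ in $\square$, to the map $[0,1]^m\to[0,1]^n$ extending $\phi$ that is linear on the convex hull of each chain of the poset $[1]^m$. Uniform realization $|-|_\infty:c\mathbf{Set}\to\mathscr{U}$ is $|-|_\sphericalangle$ followed by $\mathscr{M}\to\mathscr{U}$. Topological realization $|-|:c\mathbf{Set}\to\mathscr{T}$ is the analogous cocontinuous functor to spaces ($|\square[1]^n|=[0,1]^n$), taking values in CW complexes. A map $f:X\to Y$ of spaces is a classical weak equivalence if $\pi_0\mathscr{T}(|C|,f)$ (path-components of mapping spaces) is bijective for all cubical sets $C$. A uniform map $f:X\to Y$ is a uniform weak equivalence if $\mathscr{U}(|C|_\infty,f)$ is a classical weak equivalence of spaces for all cubical sets $C$. A $\mathscr{U}$-object $X$ is uniformly cofibrant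 if every uniform map $X\to Y$ lifts along every uniform map to $Y$ that is at once a uniform weak equivalence and a uniform Hurewicz fibration. *)

theory Defs
  imports "HOL-Analysis.Analysis"
begin

section \<open>Uniform spaces on a carrier set\<close>

text \<open>A uniform space is a set of points together with its filter of entourages.\<close>

type_synonym 'a uspace = "'a set \<times> ('a \<times> 'a) filter"

abbreviation upts :: "'a uspace \<Rightarrow> 'a set"
  where "upts X \<equiv> fst X"

abbreviation ents :: "'a uspace \<Rightarrow> ('a \<times> 'a) filter"
  where "ents X \<equiv> snd X"

definition uniform_space :: "'a uspace \<Rightarrow> bool" where
  "uniform_space X \<longleftrightarrow>
     ents X \<le> principal (upts X \<times> upts X) \<and>
     (\<forall>E. eventually E (ents X) \<longrightarrow>
        (\<forall>x\<in>upts X. E (x, x)) \<and>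
        eventually (\<lambda>(x, y). E (y, x)) (ents X) \<and>
        (\<exists>D. eventually D (ents X) \<and> (\<forall>x y z. D (x, y) \<longrightarrow> D (y, z) \<longrightarrow> E (x, z))))"

definition separated :: "'a uspace \<Rightarrow> bool" where
  "separated X \<longleftrightarrow>
     (\<forall>x\<in>upts X. \<forall>y\<in>upts X. (\<forall>E. eventually E (ents X) \<longrightarrow> E (x, y)) \<longrightarrow> x = y)"

definition uniform_map :: "'a uspace \<Rightarrow> 'b uspace \<Rightarrow> ('a \<Rightarrow> 'b) \<Rightarrow> bool" where
  "uniform_map X Y f \<longleftrightarrow>
     f \<in> upts X \<rightarrow> upts Y \<and> filterlim (map_prod f f) (ents Y) (ents X)"

definition utopology :: "'a uspace \<Rightarrow> 'a topology" where
  "utopology X = topology (\<lambda>U. U \<subseteq> upts X \<and>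
     (\<forall>x\<in>U. eventually (\<lambda>(x', y). x' = x \<longrightarrow> y \<in> U) (ents X)))"

definition prod_uspace :: "'a uspace \<Rightarrow> 'b uspace \<Rightarrow> ('a \<times> 'b) uspace" where
  "prod_uspace X Y =
     (upts X \<times> upts Y,
      inf (filtercomap (\<lambda>(p, q). (fst p, fst q)) (ents X))
          (filtercomap (\<lambda>(p, q). (snd p, snd q)) (ents Y)))"

text \<open>The finest uniformity on a set making a family of maps into it uniform
  (in the order on filters, finer uniformities are smaller).\<close>

definition final_uspace :: "'a set \<Rightarrow> ('z uspace \<times> ('z \<Rightarrow> 'a)) set \<Rightarrow> 'a uspace" where
  "final_uspace S \<G> =
     (S, Inf {F. uniform_space (S, F) \<and> (\<forall>(Z, g)\<in>\<G>. uniform_map Z (S, F) g)})"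


section \<open>Extended metric spaces\<close>

definition emetric_on :: "'a set \<Rightarrow> ('a \<Rightarrow> 'a \<Rightarrow> ennreal) \<Rightarrow> bool" where
  "emetric_on M d \<longleftrightarrow>
     (\<forall>x\<in>M. \<forall>y\<in>M. (d x y = 0 \<longleftrightarrow> x = y) \<and> d x y = d y x \<and>
        (\<forall>z\<in>M. d x z \<le> d x y + d y z))"

definition metric_uspace :: "'a set \<Rightarrow> ('a \<Rightarrow> 'a \<Rightarrow> ennreal) \<Rightarrow> 'a uspace" where
  "metric_uspace M d =
     (M, INF e\<in>{0<..}. principal {(x, y). x \<in> M \<and> y \<in> M \<and> d x y < ennreal e})"

text \<open>Infimum of the costs of all finite chains from \<open>x\<close> to \<open>y\<close> in \<open>S\<close>, where \<open>\<delta>\<close> is the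
  cost of a single step (\<open>\<infinity>\<close> for a forbidden step).\<close>

definition chain_dist :: "'a set \<Rightarrow> ('a \<Rightarrow> 'a \<Rightarrow> ennreal) \<Rightarrow> 'a \<Rightarrow> 'a \<Rightarrow> ennreal" where
  "chain_dist S \<delta> x y =
     (INF xs\<in>{xs. xs \<noteq> [] \<and> set xs \<subseteq> S \<and> hd xs = x \<and> last xs = y}.
        \<Sum>i<length xs - 1. \<delta> (xs ! i) (xs ! Suc i))"


section \<open>The category \<open>\<U>\<close>\<close>

text \<open>
  Colimits of uniform spaces, as a universal property. A diagram is given by vertices \<open>J\<close>,
  spaces \<open>D j\<close> and a set \<open>A\<close> of arrows; it need not be closed under composition, since a
  diagram has the same cocones as the functor it generates on the free category.
  Test spaces \<open>T\<close> range over the type \<^typ>\<open>'a option\<close> because a cocone can always be tested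
  on two-point spaces and on spaces with the same points as \<open>X\<close>.
\<close>

definition uniform_diagram ::
    "'j set \<Rightarrow> ('j \<Rightarrow> 'p uspace) \<Rightarrow> ('j \<times> 'j \<times> ('p \<Rightarrow> 'p)) set \<Rightarrow> bool" where
  "uniform_diagram J D A \<longleftrightarrow>
     (\<forall>j\<in>J. uniform_space (D j)) \<and>
     (\<forall>(i, j, h)\<in>A. i \<in> J \<and> j \<in> J \<and> uniform_map (D i) (D j) h)"

definition uniform_cocone ::
    "'j set \<Rightarrow> ('j \<Rightarrow> 'p uspace) \<Rightarrow> ('j \<times> 'j \<times> ('p \<Rightarrow> 'p)) set
      \<Rightarrow> 'a uspace \<Rightarrow> ('j \<Rightarrow> 'p \<Rightarrow> 'a) \<Rightarrow> bool" where
  "uniform_cocone J D A X q \<longleftrightarrow>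
     uniform_space X \<and> (\<forall>j\<in>J. uniform_map (D j) X (q j)) \<and>
     (\<forall>(i, j, h)\<in>A. \<forall>x\<in>upts (D i). q j (h x) = q i x)"

definition uniform_colimit ::
    "'j set \<Rightarrow> ('j \<Rightarrow> 'p uspace) \<Rightarrow> ('j \<times> 'j \<times> ('p \<Rightarrow> 'p)) set
      \<Rightarrow> 'a uspace \<Rightarrow> ('j \<Rightarrow> 'p \<Rightarrow> 'a) \<Rightarrow> bool" where
  "uniform_colimit J D A X q \<longleftrightarrow>
     uniform_diagram J D A \<and> uniform_cocone J D A X q \<and>
     (\<forall>(T :: 'a option uspace) r. uniform_cocone J D A T r \<longrightarrow>
        (\<exists>!g. g \<in> extensional (upts X) \<and> uniform_map X T g \<and>
              (\<forall>j\<in>J. \<forall>x\<in>upts (D j). g (q j x) = r j x)))"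

definition connected_lc_metric :: "'a set \<Rightarrow> ('a \<Rightarrow> 'a \<Rightarrow> ennreal) \<Rightarrow> bool" where
  "connected_lc_metric M d \<longleftrightarrow>
     emetric_on M d \<and> connected_space (utopology (metric_uspace M d)) \<and>
     locally_connected_space (utopology (metric_uspace M d))"

text \<open>
  HOL cannot quantify over all sets of all types inside a formula. Everything below is
  therefore relative to a type \<^typ>\<open>'u\<close> playing the role of a universe: the class of
  all (metric, uniform, cubical) sets over which a definition quantifies is the class of those
  whose elements have type \<^typ>\<open>'u\<close>. Predicates may nevertheless be applied to spaces on other
  types, such as spaces of maps. Over a type that does not contain a copy of the real numbers
  there are no connected metric spaces with more than one point, so only larger types are of
  interest.

  The vertices of the diagram are indexed by triples consisting of a metric space and a map to
  the colimit. This index type suffices: two vertices with the same space and the same leg can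
  be merged without changing the colimit.
\<close>

definition U_object :: "'u itself \<Rightarrow> 'a uspace \<Rightarrow> bool" where
  "U_object _ X \<longleftrightarrow>
     uniform_space X \<and> separated X \<and>
     (\<exists>(J :: ('u set \<times> ('u \<Rightarrow> 'u \<Rightarrow> ennreal) \<times> ('u \<Rightarrow> 'a)) set)
        (D :: _ \<Rightarrow> 'u uspace) A q.
        (\<forall>j\<in>J. \<exists>M d. connected_lc_metric M d \<and> D j = metric_uspace M d) \<and>
        uniform_colimit J D A X q)"

definition coreflection :: "'u itself \<Rightarrow> 'a uspace \<Rightarrow> 'a uspace" where
  "coreflection \<UU> X =
     final_uspace (upts X) {(Z :: 'u uspace, g). U_object \<UU> Z \<and> uniform_map Z X g}"

definition U_prod :: "'u itself \<Rightarrow> 'a uspace \<Rightarrow> 'b uspace \<Rightarrow> ('a \<times> 'b) uspace" where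
  "U_prod \<UU> X Y = coreflection \<UU> (prod_uspace X Y)"

definition U_hom :: "'a uspace \<Rightarrow> 'b uspace \<Rightarrow> ('a \<Rightarrow> 'b) set" where
  "U_hom X Y = {f \<in> extensional (upts X). uniform_map X Y f}"

text \<open>
  The exponential \<open>Y\<^sup>X\<close>: the set of uniform maps with the finest uniformity for which the
  transposes of all uniform maps from \<open>Z \<times> X\<close> (product in \<open>\<U>\<close>) to \<open>Y\<close> are uniform. The defining
  universal property determines it; see \<open>U_exp_unique\<close> below.
\<close>

definition U_exp :: "'u itself \<Rightarrow> 'a uspace \<Rightarrow> 'b uspace \<Rightarrow> ('a \<Rightarrow> 'b) uspace" where
  "U_exp \<UU> X Y =
     final_uspace (U_hom X Y)
       {(Z :: 'u uspace, \<lambda>z. \<lambda>x\<in>upts X. h (z, x)) | Z h.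
          U_object \<UU> Z \<and> uniform_map (U_prod \<UU> Z X) Y h}"

text \<open>The space \<open>\<U>(X, Y)\<close>, and the action of \<open>\<U>(X, -)\<close> on maps.\<close>

definition U_space :: "'u itself \<Rightarrow> 'a uspace \<Rightarrow> 'b uspace \<Rightarrow> ('a \<Rightarrow> 'b) topology" where
  "U_space \<UU> X Y = utopology (U_exp \<UU> X Y)"

definition postcomp :: "'a set \<Rightarrow> ('b \<Rightarrow> 'c) \<Rightarrow> ('a \<Rightarrow> 'b) \<Rightarrow> 'a \<Rightarrow> 'c" where
  "postcomp S f g = (\<lambda>x\<in>S. f (g x))"

definition uniform_hurewicz_fibration ::
    "'u itself \<Rightarrow> 'a uspace \<Rightarrow> 'b uspace \<Rightarrow> ('a \<Rightarrow> 'b) \<Rightarrow> bool" where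
  "uniform_hurewicz_fibration \<UU> X Y f \<longleftrightarrow>
     uniform_map X Y f \<and>
     (\<forall>Z :: 'u uspace. U_object \<UU> Z \<longrightarrow>
        (\<forall>\<gamma> e. pathin (U_space \<UU> Z Y) \<gamma> \<and> e \<in> topspace (U_space \<UU> Z X) \<and>
               postcomp (upts Z) f e = \<gamma> 0 \<longrightarrow>
           (\<exists>\<eta>. pathin (U_space \<UU> Z X) \<eta> \<and> \<eta> 0 = e \<and>
                (\<forall>t\<in>{0..1}. postcomp (upts Z) f (\<eta> t) = \<gamma> t))))"


section \<open>Cubical sets\<close>

text \<open>The elements of the poset \<open>[1]\<^sup>n\<close> are boolean lists of length \<open>n\<close>, so that the monoidal
  product of \<open>\<box>\<close> is concatenation.\<close>

definition cube_verts :: "nat \<Rightarrow> bool list set" where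
  "cube_verts n = {v. length v = n}"

inductive cube_mor :: "nat \<Rightarrow> nat \<Rightarrow> (bool list \<Rightarrow> bool list) \<Rightarrow> bool" where
  ident: "cube_mor n n (\<lambda>v\<in>cube_verts n. v)"
| face: "cube_mor 0 1 (\<lambda>v\<in>cube_verts 0. [b])"
| degeneracy: "cube_mor 1 0 (\<lambda>v\<in>cube_verts 1. [])"
| join: "cube_mor 2 1 (\<lambda>v\<in>cube_verts 2. [v ! 0 \<or> v ! 1])"
| comp: "cube_mor l m \<phi> \<Longrightarrow> cube_mor m n \<psi> \<Longrightarrow> cube_mor l n (compose (cube_verts l) \<psi> \<phi>)"
| tensor: "cube_mor m n \<phi> \<Longrightarrow> cube_mor m' n' \<psi> \<Longrightarrow>
    cube_mor (m + m') (n + n') (\<lambda>v\<in>cube_verts (m + m'). \<phi> (take m v) @ \<psi> (drop m v))"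

record 'c cubical =
  cells :: "nat \<Rightarrow> 'c set"
  act :: "nat \<Rightarrow> nat \<Rightarrow> (bool list \<Rightarrow> bool list) \<Rightarrow> 'c \<Rightarrow> 'c"

definition cubical_set :: "'c cubical \<Rightarrow> bool" where
  "cubical_set C \<longleftrightarrow>
     (\<forall>m n \<phi>. cube_mor m n \<phi> \<longrightarrow> act C m n \<phi> \<in> cells C n \<rightarrow> cells C m) \<and>
     (\<forall>n. \<forall>c\<in>cells C n. act C n n (\<lambda>v\<in>cube_verts n. v) c = c) \<and>
     (\<forall>l m n \<phi> \<psi>. cube_mor l m \<phi> \<longrightarrow> cube_mor m n \<psi> \<longrightarrow>
        (\<forall>c\<in>cells C n.
           act C l n (compose (cube_verts l) \<psi> \<phi>) c = act C l m \<phi> (act C m n \<psi> c)))"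

text \<open>The cube \<open>[0,1]\<^sup>n\<close> consists of real lists of length \<open>n\<close>.\<close>

definition cube_pts :: "nat \<Rightarrow> real list set" where
  "cube_pts n = {t. length t = n \<and> set t \<subseteq> {0..1}}"

definition max_dist :: "real list \<Rightarrow> real list \<Rightarrow> ennreal" where
  "max_dist s t = ennreal (Max (insert 0 ((\<lambda>i. \<bar>s ! i - t ! i\<bar>) ` {..<length s})))"

definition vertex_chain :: "nat \<Rightarrow> bool list set \<Rightarrow> bool" where
  "vertex_chain n S \<longleftrightarrow>
     S \<subseteq> cube_verts n \<and> (\<forall>v\<in>S. \<forall>w\<in>S. list_all2 (\<le>) v w \<or> list_all2 (\<le>) w v)"

text \<open>The point \<open>\<Sum>v\<in>S. a v \<cdot> \<phi> v\<close> of \<open>[0,1]\<^sup>n\<close>.\<close>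

definition vertex_comb ::
    "nat \<Rightarrow> bool list set \<Rightarrow> (bool list \<Rightarrow> real) \<Rightarrow> (bool list \<Rightarrow> bool list) \<Rightarrow> real list" where
  "vertex_comb n S a \<phi> = map (\<lambda>i. \<Sum>v\<in>S. a v * of_bool (\<phi> v ! i)) [0..<n]"

text \<open>The extension of \<open>\<phi> : [1]\<^sup>m \<rightarrow> [1]\<^sup>n\<close> to \<open>[0,1]\<^sup>m \<rightarrow> [0,1]\<^sup>n\<close> that is linear on the convex hull
  of each chain.\<close>

definition linear_ext :: "nat \<Rightarrow> nat \<Rightarrow> (bool list \<Rightarrow> bool list) \<Rightarrow> real list \<Rightarrow> real list" where
  "linear_ext m n \<phi> t =
     (THE u. \<exists>S a. vertex_chain m S \<and> (\<forall>v\<in>S. 0 \<le> a v) \<and> sum a S = 1 \<and>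
               t = vertex_comb m S a (\<lambda>v. v) \<and> u = vertex_comb n S a \<phi>)"

text \<open>Realizations are quotients of the disjoint union of the cubes \<open>{c} \<times> [0,1]\<^sup>n\<close> for the cells
  \<open>c\<close>, by the equivalence relation generated by \<open>(\<phi>\<^sup>* c, t) \<sim> (c, |\<phi>| t)\<close>.\<close>

definition cell_pts :: "'c cubical \<Rightarrow> (nat \<times> 'c \<times> real list) set" where
  "cell_pts C = {(n, c, t). c \<in> cells C n \<and> t \<in> cube_pts n}"

definition glue :: "'c cubical \<Rightarrow> ((nat \<times> 'c \<times> real list) \<times> (nat \<times> 'c \<times> real list)) set" where
  "glue C = {((m, act C m n \<phi> c, t), (n, c, linear_ext m n \<phi> t)) | m n \<phi> c t.
               cube_mor m n \<phi> \<and> c \<in> cells C n \<and> t \<in> cube_pts m}"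

definition glue_equiv ::
    "'c cubical \<Rightarrow> ((nat \<times> 'c \<times> real list) \<times> (nat \<times> 'c \<times> real list)) set" where
  "glue_equiv C = {(p, q). p \<in> cell_pts C \<and> q \<in> cell_pts C \<and> (p, q) \<in> (glue C \<union> (glue C)\<inverse>)\<^sup>*}"

definition top_realization :: "'c cubical \<Rightarrow> (nat \<times> 'c \<times> real list) set topology" where
  "top_realization C = topology (\<lambda>U. U \<subseteq> cell_pts C // glue_equiv C \<and>
     (\<forall>n. \<forall>c\<in>cells C n.
        openin (utopology (metric_uspace (cube_pts n) max_dist))
          {t \<in> cube_pts n. glue_equiv C `` {(n, c, t)} \<in> U}))"

text \<open>
  Colimits of extended metric spaces and 1-Lipschitz maps: the quotient of the disjoint union by
  the gluing pseudometric, whose chains move within a cube or jump for free between identified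
  points; points at pseudodistance \<open>0\<close> are identified.
\<close>

definition glue_step :: "'c cubical \<Rightarrow> (nat \<times> 'c \<times> real list) \<Rightarrow> (nat \<times> 'c \<times> real list) \<Rightarrow> ennreal" where
  "glue_step C p q =
     (if (p, q) \<in> glue_equiv C then 0
      else case (p, q) of ((m, c, s), (n, c', t)) \<Rightarrow>
        if m = n \<and> c = c' then max_dist s t else \<infinity>)"

definition glue_dist :: "'c cubical \<Rightarrow> (nat \<times> 'c \<times> real list) \<Rightarrow> (nat \<times> 'c \<times> real list) \<Rightarrow> ennreal" where
  "glue_dist C = chain_dist (cell_pts C) (glue_step C)"

definition metric_realization_pts :: "'c cubical \<Rightarrow> (nat \<times> 'c \<times> real list) set set" where
  "metric_realization_pts C =
     cell_pts C // {(p, q). p \<in> cell_pts C \<and> q \<in> cell_pts C \<and> glue_dist C p q = 0}"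

definition metric_realization_dist ::
    "'c cubical \<Rightarrow> (nat \<times> 'c \<times> real list) set \<Rightarrow> (nat \<times> 'c \<times> real list) set \<Rightarrow> ennreal" where
  "metric_realization_dist C P Q = (INF p\<in>P. INF q\<in>Q. glue_dist C p q)"

definition uniform_realization ::
    "'u itself \<Rightarrow> 'c cubical \<Rightarrow> (nat \<times> 'c \<times> real list) set uspace" where
  "uniform_realization \<UU> C =
     coreflection \<UU> (metric_uspace (metric_realization_pts C) (metric_realization_dist C))"


section \<open>Weak equivalences and cofibrant objects\<close>

text \<open>
  The mapping space \<open>\<T>(X, Y)\<close>: the set of continuous maps with the finest topology for which the
  transposes of all continuous maps from \<open>K \<times> X\<close> to \<open>Y\<close> are continuous, where \<open>K\<close> is a compact
  Hausdorff, locally connected, second-countable space. Such \<open>K\<close> generate \<open>\<T>\<close> under colimits and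
  their products in \<open>\<T>\<close> are the usual ones, so that this is the exponential of \<open>\<T>\<close> whenever
  \<open>Y\<close> is an object of \<open>\<T>\<close>, and otherwise that of its coreflection. As \<open>K\<close> has at most
  continuum many points, it may be taken to have real numbers as points.
\<close>

definition mapping_set :: "'a topology \<Rightarrow> 'b topology \<Rightarrow> ('a \<Rightarrow> 'b) set" where
  "mapping_set X Y = {f \<in> extensional (topspace X). continuous_map X Y f}"

definition mapping_space :: "'a topology \<Rightarrow> 'b topology \<Rightarrow> ('a \<Rightarrow> 'b) topology" where
  "mapping_space X Y = topology (\<lambda>U. U \<subseteq> mapping_set X Y \<and>
     (\<forall>(K :: real topology) h.
        compact_space K \<and> Hausdorff_space K \<and> locally_connected_space K \<and> second_countable K \<and>
        continuous_map (prod_topology K X) Y h \<longrightarrow>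
        openin K {k \<in> topspace K. (\<lambda>x\<in>topspace X. h (k, x)) \<in> U}))"

text \<open>The map \<open>\<pi>\<^sub>0 F\<close> induced by a continuous map \<open>F : X \<rightarrow> Y\<close>.\<close>

definition pi0_map :: "'b topology \<Rightarrow> ('a \<Rightarrow> 'b) \<Rightarrow> 'a set \<Rightarrow> 'b set" where
  "pi0_map Y F P = path_component_of_set Y (F (SOME x. x \<in> P))"

definition classical_weak_equivalence ::
    "'u itself \<Rightarrow> 'a topology \<Rightarrow> 'b topology \<Rightarrow> ('a \<Rightarrow> 'b) \<Rightarrow> bool" where
  "classical_weak_equivalence _ X Y f \<longleftrightarrow>
     continuous_map X Y f \<and>
     (\<forall>C :: 'u cubical. cubical_set C \<longrightarrow>
        bij_betw
          (pi0_map (mapping_space (top_realization C) Y)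
             (postcomp (topspace (top_realization C)) f))
          (path_components_of (mapping_space (top_realization C) X))
          (path_components_of (mapping_space (top_realization C) Y)))"

definition uniform_weak_equivalence ::
    "'u itself \<Rightarrow> 'a uspace \<Rightarrow> 'b uspace \<Rightarrow> ('a \<Rightarrow> 'b) \<Rightarrow> bool" where
  "uniform_weak_equivalence \<UU> X Y f \<longleftrightarrow>
     uniform_map X Y f \<and>
     (\<forall>C :: 'u cubical. cubical_set C \<longrightarrow>
        classical_weak_equivalence \<UU>
          (U_space \<UU> (uniform_realization \<UU> C) X)
          (U_space \<UU> (uniform_realization \<UU> C) Y)
          (postcomp (upts (uniform_realization \<UU> C)) f))"

definition uniformly_cofibrant :: "'u itself \<Rightarrow> 'a uspace \<Rightarrow> bool" where
  "uniformly_cofibrant \<UU> X \<longleftrightarrow>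
     U_object \<UU> X \<and>
     (\<forall>(E :: 'u uspace) (Y :: 'u uspace) p g.
        U_object \<UU> E \<and> U_object \<UU> Y \<and>
        uniform_weak_equivalence \<UU> E Y p \<and> uniform_hurewicz_fibration \<UU> E Y p \<and>
        uniform_map X Y g \<longrightarrow>
        (\<exists>l. uniform_map X E l \<and> (\<forall>x\<in>upts X. p (l x) = g x)))"


section \<open>\<open>\<ell>\<^sub>2\<close>-simplicial complexes\<close>

text \<open>An abstract simplicial complex is given by its set of simplices; its vertices are the
  elements of \<open>\<Union>K\<close>. Points of the realization are given by barycentric coordinates.\<close>

definition abstract_complex :: "'v set set \<Rightarrow> bool" where
  "abstract_complex K \<longleftrightarrow>
     (\<forall>\<sigma>\<in>K. finite \<sigma> \<and> \<sigma> \<noteq> {} \<and> (\<forall>\<tau>. \<tau> \<subseteq> \<sigma> \<and> \<tau> \<noteq> {} \<longrightarrow> \<tau> \<in> K))"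

definition finite_dimensional :: "'v set set \<Rightarrow> bool" where
  "finite_dimensional K \<longleftrightarrow> (\<exists>n. \<forall>\<sigma>\<in>K. card \<sigma> \<le> n + 1)"

definition carrier_of :: "('v \<Rightarrow> real) \<Rightarrow> 'v set" where
  "carrier_of t = {v. t v \<noteq> 0}"

definition complex_pts :: "'v set set \<Rightarrow> ('v \<Rightarrow> real) set" where
  "complex_pts K = {t. (\<forall>v. 0 \<le> t v) \<and> carrier_of t \<in> K \<and> sum t (carrier_of t) = 1}"

definition l2_step :: "'v set set \<Rightarrow> ('v \<Rightarrow> real) \<Rightarrow> ('v \<Rightarrow> real) \<Rightarrow> ennreal" where
  "l2_step K x y =
     (if \<exists>\<sigma>\<in>K. carrier_of x \<subseteq> \<sigma> \<and> carrier_of y \<subseteq> \<sigma>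
      then ennreal (L2_set (\<lambda>v. x v - y v) (carrier_of x \<union> carrier_of y)) else \<infinity>)"

definition l2_dist :: "'v set set \<Rightarrow> ('v \<Rightarrow> real) \<Rightarrow> ('v \<Rightarrow> real) \<Rightarrow> ennreal" where
  "l2_dist K = chain_dist (complex_pts K) (l2_step K)"

definition l2_complex :: "'u itself \<Rightarrow> 'v set set \<Rightarrow> ('v \<Rightarrow> real) uspace" where
  "l2_complex \<UU> K = coreflection \<UU> (metric_uspace (complex_pts K) (l2_dist K))"

section \<open>Universal properties of the constructions in \<open>\<U>\<close>\<close>

text \<open>
  \<open>coreflection\<close> is the coreflection into \<open>\<U>\<close> (\<open>U_object_coreflection\<close>, \<open>coreflection_le\<close>,
  \<open>uniform_map_into_coreflection\<close>, \<open>coreflection_unique\<close>), and any object with the universal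
  property of the exponential is \<open>U_exp\<close> (\<open>U_exp_unique\<close>).
\<close>

lemma ents_le: "uniform_space X \<Longrightarrow> ents X \<le> principal (upts X \<times> upts X)"
  by (simp add: uniform_space_def)

lemma ev_pts: "uniform_space X \<Longrightarrow> eventually (\<lambda>p. p \<in> upts X \<times> upts X) (ents X)"
  using ents_le by (simp add: le_principal)

lemma us_refl: "uniform_space (S, F) \<Longrightarrow> eventually E F \<Longrightarrow> x \<in> S \<Longrightarrow> E (x, x)"
  unfolding uniform_space_def fst_conv snd_conv by blast

lemma us_sym: "uniform_space (S, F) \<Longrightarrow> eventually E F \<Longrightarrow> eventually (\<lambda>(x, y). E (y, x)) F"
  unfolding uniform_space_def fst_conv snd_conv by blast

lemma us_trans: "uniform_space (S, F) \<Longrightarrow> eventually E F \<Longrightarrow>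
    \<exists>D. eventually D F \<and> (\<forall>x y z. D (x, y) \<longrightarrow> D (y, z) \<longrightarrow> E (x, z))"
  unfolding uniform_space_def fst_conv snd_conv by blast

lemma filterlim_Inf': "filterlim f (Inf \<B>) F \<longleftrightarrow> (\<forall>G\<in>\<B>. filterlim f G F)"
  by (auto simp: filterlim_def le_Inf_iff)

lemma uniform_space_surj: "uniform_space X \<Longrightarrow> uniform_space (upts X, ents X)"
  by simp

lemma uniform_map_cong:
  assumes "uniform_space X" "\<And>x. x \<in> upts X \<Longrightarrow> f x = g x"
  shows "uniform_map X Y f \<longleftrightarrow> uniform_map X Y g"
proof -
  have "eventually (\<lambda>p. map_prod f f p = map_prod g g p) (ents X)"
    using ev_pts[OF assms(1)] by eventually_elim (auto simp: assms(2))
  then have "filterlim (map_prod f f) (ents Y) (ents X) \<longleftrightarrow> filterlim (map_prod g g) (ents Y) (ents X)"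
    by (intro filterlim_cong) auto
  then show ?thesis using assms(2) by (auto simp: uniform_map_def Pi_iff)
qed

lemma uniform_map_comp:
  "uniform_map X Y f \<Longrightarrow> uniform_map Y Z g \<Longrightarrow> uniform_map X Z (\<lambda>x. g (f x))"
proof -
  assume a: "uniform_map X Y f" "uniform_map Y Z g"
  have "filterlim (\<lambda>p. map_prod g g (map_prod f f p)) (ents Z) (ents X)"
    by (rule filterlim_compose[of _ _ "ents Y"]) (use a in \<open>simp_all add: uniform_map_def\<close>)
  moreover have "(\<lambda>p. map_prod g g (map_prod f f p)) = map_prod (\<lambda>x. g (f x)) (\<lambda>x. g (f x))"
    by (auto simp: fun_eq_iff)
  ultimately show ?thesis using a by (auto simp: uniform_map_def Pi_iff)
qed

lemma uniform_space_pullback: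
  assumes "uniform_space (Y :: 'b uspace)" "f \<in> S \<rightarrow> upts Y"
  shows "uniform_space (S, inf (principal (S \<times> S)) (filtercomap (map_prod f f) (ents Y)))"
    (is "uniform_space (S, ?F)")
proof -
  have ev: "eventually E ?F \<longleftrightarrow>
      (\<exists>D. eventually D (ents Y) \<and> (\<forall>x\<in>S. \<forall>y\<in>S. D (f x, f y) \<longrightarrow> E (x, y)))" for E
    unfolding inf.commute[of "principal _"]
    by (simp add: eventually_inf_principal eventually_filtercomap) (metis (no_types, lifting))
  show ?thesis
    unfolding uniform_space_def fst_conv snd_conv
  proof (intro conjI allI impI)
    show "?F \<le> principal (S \<times> S)" by simp
  next
    fix E assume "eventually E ?F"
    then obtain D where D: "eventually D (ents Y)" "\<forall>x\<in>S. \<forall>y\<in>S. D (f x, f y) \<longrightarrow> E (x, y)"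
      using ev by blast
    have "D (f x, f x)" if "x \<in> S" for x
      using us_refl[OF uniform_space_surj[OF assms(1)] D(1) funcset_mem[OF assms(2) that]] .
    then show "\<forall>x\<in>S. E (x, x)" using D(2) by blast
    have "eventually (\<lambda>(x, y). D (y, x)) (ents Y)" using D(1) assms(1) by (simp add: uniform_space_def)
    then show "eventually (\<lambda>(x, y). E (y, x)) ?F" unfolding ev using D(2)
      by (intro exI[of _ "\<lambda>(x, y). D (y, x)"]) simp
    obtain D' where D': "eventually D' (ents Y)" "\<forall>x y z. D' (x, y) \<longrightarrow> D' (y, z) \<longrightarrow> D (x, z)"
      using D(1) assms(1) unfolding uniform_space_def by blast
    define D'' where "D'' = (\<lambda>p. p \<in> S \<times> S \<and> D' (map_prod f f p))"
    have "eventually D'' ?F"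
      unfolding ev using D'(1) by (intro exI[of _ D']) (simp add: D''_def)
    moreover have "E (x, z)" if "D'' (x, y)" "D'' (y, z)" for x y z
      using that D(2) D'(2) by (simp add: D''_def) blast
    ultimately show "\<exists>D. eventually D ?F \<and> (\<forall>x y z. D (x, y) \<longrightarrow> D (y, z) \<longrightarrow> E (x, z))"
      by (intro exI[of _ D'']) simp
  qed
qed

lemma uniform_space_Inf:
  fixes S :: "'a set"
  assumes "\<F> \<noteq> {}" "\<And>F. F \<in> \<F> \<Longrightarrow> uniform_space (S, F)"
  shows "uniform_space (S, Inf \<F>)"
proof -
  have refl: "principal (Id_on S) \<le> F" if "uniform_space (S, F)" for F
    unfolding le_filter_def eventually_principal using us_refl[OF that] by blast
  have refl': "principal (Id_on S) \<le> Inf \<F>" using refl assms(2) by (simp add: le_Inf_iff)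
  define sw where "sw = (\<lambda>(x, y). (y, x) :: 'a \<times> 'a)"
  have sw: "filterlim sw F F" if "uniform_space (S, F)" for F
    using us_sym[OF that] unfolding filterlim_iff sw_def case_prod_unfold by simp
  have sw': "filterlim sw (Inf \<F>) (Inf \<F>)"
    unfolding filterlim_Inf'
    by (metis sw assms(2) filterlim_mono Inf_lower order_refl)
  define a b c :: "'a \<times> 'a \<times> 'a \<Rightarrow> 'a \<times> 'a" where "a = (\<lambda>(x, y, z). (x, y))"
    and "b = (\<lambda>(x, y, z). (y, z))" and "c = (\<lambda>(x, y, z). (x, z))"
  define G where "G = (\<lambda>F. inf (filtercomap a F) (filtercomap b F))"
  have evG: "eventually P (G F) \<longleftrightarrow> (\<exists>D. eventually D F \<and> (\<forall>x y z. D (x, y) \<longrightarrow> D (y, z) \<longrightarrow> P (x, y, z)))"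
    for P F
  proof
    assume "eventually P (G F)"
    then obtain Q R where "eventually Q F" "eventually R F" "\<forall>x y z. Q (x, y) \<longrightarrow> R (y, z) \<longrightarrow> P (x, y, z)"
      unfolding G_def eventually_inf eventually_filtercomap a_def b_def by fastforce
    then show "\<exists>D. eventually D F \<and> (\<forall>x y z. D (x, y) \<longrightarrow> D (y, z) \<longrightarrow> P (x, y, z))"
      by (intro exI[of _ "\<lambda>p. Q p \<and> R p"]) (auto intro: eventually_conj)
  next
    assume "\<exists>D. eventually D F \<and> (\<forall>x y z. D (x, y) \<longrightarrow> D (y, z) \<longrightarrow> P (x, y, z))"
    then obtain D where "eventually D F" "\<forall>x y z. D (x, y) \<longrightarrow> D (y, z) \<longrightarrow> P (x, y, z)" by blast
    then show "eventually P (G F)"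
      unfolding G_def eventually_inf eventually_filtercomap a_def b_def
      by (intro exI[of _ "\<lambda>(x, y, z). D (x, y)"] exI[of _ "\<lambda>(x, y, z). D (y, z)"]) auto
  qed
  have tr: "filterlim c F (G F)" if "uniform_space (S, F)" for F
    using us_trans[OF that] unfolding filterlim_iff evG c_def by simp
  have "filterlim c (Inf \<F>) (G (Inf \<F>))"
    unfolding filterlim_Inf'
  proof
    fix F assume F: "F \<in> \<F>"
    have "G (Inf \<F>) \<le> G F"
      unfolding G_def by (intro inf_mono filtercomap_mono Inf_lower F)
    then show "filterlim c F (G (Inf \<F>))"
      using tr[OF assms(2)[OF F]] by (meson filterlim_mono order_refl)
  qed
  then have tr': "\<exists>D. eventually D (Inf \<F>) \<and> (\<forall>x y z. D (x, y) \<longrightarrow> D (y, z) \<longrightarrow> E (x, z))"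
    if "eventually E (Inf \<F>)" for E
    using that unfolding filterlim_iff evG c_def by simp
  obtain F where F: "F \<in> \<F>" using assms(1) by blast
  have "Inf \<F> \<le> principal (S \<times> S)"
    using ents_le[OF assms(2)[OF F]] Inf_lower[OF F] by (simp del: le_principal) 
  then show ?thesis
    using refl' sw' tr'
    unfolding uniform_space_def fst_conv snd_conv filterlim_iff le_filter_def[of "principal (Id_on S)"] eventually_principal sw_def
    by (auto simp: case_prod_unfold)
qed

lemma uniform_space_indiscrete: "uniform_space (S, principal (S \<times> S))"
  unfolding uniform_space_def eventually_principal fst_conv snd_conv
  by (auto intro!: exI[of _ "\<lambda>p. p \<in> S \<times> S"])

lemma final_candidate:
  assumes "\<And>Z g. (Z, g) \<in> \<G> \<Longrightarrow> uniform_space Z \<and> g \<in> upts Z \<rightarrow> S"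
  shows "uniform_space (S, principal (S \<times> S)) \<and> (\<forall>(Z, g)\<in>\<G>. uniform_map Z (S, principal (S \<times> S)) g)"
proof (intro conjI uniform_space_indiscrete ballI, clarify)
  fix Z g assume "(Z, g) \<in> \<G>"
  then have "uniform_space Z" and g: "g \<in> upts Z \<rightarrow> S" using assms by auto
  have "eventually (\<lambda>p. map_prod g g p \<in> S \<times> S) (ents Z)"
    using ev_pts[OF \<open>uniform_space Z\<close>] by eventually_elim (use g in \<open>auto simp: Pi_iff\<close>)
  then show "uniform_map Z (S, principal (S \<times> S)) g"
    using g by (simp add: uniform_map_def filterlim_principal)
qed

lemma upts_final [simp]: "upts (final_uspace S \<G>) = S"
  by (simp add: final_uspace_def)

lemma uniform_space_final:
  assumes "\<And>Z g. (Z, g) \<in> \<G> \<Longrightarrow> uniform_space Z \<and> g \<in> upts Z \<rightarrow> S"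
  shows "uniform_space (final_uspace S \<G>)"
  unfolding final_uspace_def
proof (rule uniform_space_Inf)
  show "{F. uniform_space (S, F) \<and> (\<forall>(Z, g)\<in>\<G>. uniform_map Z (S, F) g)} \<noteq> {}"
    using final_candidate[of \<G> S, OF assms] by blast
qed simp

lemma uniform_map_into_final:
  assumes "\<And>Z g. (Z, g) \<in> \<G> \<Longrightarrow> uniform_space Z \<and> g \<in> upts Z \<rightarrow> S" "(Z, g) \<in> \<G>"
  shows "uniform_map Z (final_uspace S \<G>) g"
  using assms(2) assms(1)[OF assms(2)]
  by (auto simp: uniform_map_def final_uspace_def filterlim_Inf')

lemma uniform_map_from_final:
  assumes "uniform_space Y" "f \<in> S \<rightarrow> upts Y"
    and "\<And>Z g. (Z, g) \<in> \<G> \<Longrightarrow> uniform_space Z \<and> g \<in> upts Z \<rightarrow> S \<and> uniform_map Z Y (\<lambda>z. f (g z))"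
  shows "uniform_map (final_uspace S \<G>) Y f"
proof -
  let ?F = "inf (principal (S \<times> S)) (filtercomap (map_prod f f) (ents Y))"
  have "uniform_map Z (S, ?F) g" if "(Z, g) \<in> \<G>" for Z g
  proof -
    have Z: "uniform_space Z" "g \<in> upts Z \<rightarrow> S" "uniform_map Z Y (\<lambda>z. f (g z))"
      using assms(3)[OF that] by auto
    have "uniform_map Z (S, principal (S \<times> S)) g" 
      using final_candidate[of "{(Z, g)}" S] Z by auto
    moreover have "map_prod f f \<circ> map_prod g g = map_prod (\<lambda>z. f (g z)) (\<lambda>z. f (g z))"
      by auto
    then have "filterlim (map_prod g g) (filtercomap (map_prod f f) (ents Y)) (ents Z)"
      using Z(3) by (simp add: uniform_map_def filterlim_filtercomap_iff)
    ultimately show ?thesis using Z(2) by (simp add: uniform_map_def filterlim_inf)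
  qed
  then have "?F \<in> {F. uniform_space (S, F) \<and> (\<forall>(Z, g)\<in>\<G>. uniform_map Z (S, F) g)}"
    using uniform_space_pullback[OF assms(1,2)] by auto
  then have "ents (final_uspace S \<G>) \<le> ?F" unfolding final_uspace_def snd_conv by (rule Inf_lower)
  then have "ents (final_uspace S \<G>) \<le> filtercomap (map_prod f f) (ents Y)" by simp
  then show ?thesis using assms(2)
    by (simp add: uniform_map_def filterlim_iff_le_filtercomap)
qed


lemma uniform_map_UNIV: "uniform_map Z (UNIV, principal (UNIV \<times> UNIV)) r"
  by (simp add: uniform_map_def)

lemma uniform_colimit_detect:
  fixes X Y :: "'a uspace" and D :: "'j \<Rightarrow> 'p uspace"
  assumes col: "uniform_colimit J D A X q"
    and Y: "uniform_space Y" "upts Y = upts X"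
    and leg: "\<And>j. j \<in> J \<Longrightarrow> uniform_map (D j) Y (q j)"
  shows "uniform_map X Y (\<lambda>x. x)"
proof -
  define T :: "'a option uspace" where
    "T = (Some ` upts X, inf (principal (Some ` upts X \<times> Some ` upts X))
                           (filtercomap (map_prod the the) (ents Y)))"
  have T: "uniform_space T"
    unfolding T_def
  proof (rule uniform_space_pullback[OF Y(1)])
    show "the \<in> Some ` upts X \<rightarrow> upts Y" unfolding Y(2) by auto
  qed
  have into_T: "uniform_map Z T (\<lambda>z. Some (r z))" if "uniform_space Z" "uniform_map Z Y r" for Z :: "'p uspace" and r
  proof -
    have r: "r \<in> upts Z \<rightarrow> upts X" using that Y by (simp add: uniform_map_def)
    have "eventually (\<lambda>p. map_prod (\<lambda>z. Some (r z)) (\<lambda>z. Some (r z)) p \<in> Some ` upts X \<times> Some ` upts X) (ents Z)"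
      using ev_pts[OF that(1)] by eventually_elim (use r in \<open>auto simp: Pi_iff\<close>)
    moreover have "map_prod the the \<circ> map_prod (\<lambda>z. Some (r z)) (\<lambda>z. Some (r z)) = map_prod r r"
      by auto
    ultimately show ?thesis
      using that(2) r by (auto simp: T_def uniform_map_def filterlim_inf filterlim_principal filterlim_filtercomap_iff)
  qed
  have out_T: "uniform_map T Y the"
    unfolding uniform_map_def
  proof
    show "the \<in> upts T \<rightarrow> upts Y" unfolding T_def Y(2) by auto
    show "filterlim (map_prod the the) (ents Y) (ents T)"
      unfolding T_def snd_conv filterlim_iff_le_filtercomap by (rule inf_le2)
  qed
  have dia: "uniform_space (D j)" if "j \<in> J" for j
    using col that unfolding uniform_colimit_def uniform_diagram_def by blast
  have cX: "uniform_cocone J D A X q" using col unfolding uniform_colimit_def by blast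
  have X: "uniform_space X" using cX unfolding uniform_cocone_def by blast
  have coc: "\<forall>(i, j, h)\<in>A. \<forall>x\<in>upts (D i). q j (h x) = q i x"
    using cX unfolding uniform_cocone_def by blast
  have qX: "uniform_map (D j) X (q j)" if "j \<in> J" for j
    using cX that unfolding uniform_cocone_def by blast
  have univ: "\<exists>!g. g \<in> extensional (upts X) \<and> uniform_map X T g \<and> (\<forall>j\<in>J. \<forall>x\<in>upts (D j). g (q j x) = r j x)"
    if "uniform_cocone J D A T r" for T :: "'a option uspace" and r
    using col that unfolding uniform_colimit_def by blast
  have "uniform_cocone J D A T (\<lambda>j x. Some (q j x))"
    unfolding uniform_cocone_def
  proof (intro conjI T ballI)
    show "uniform_map (D j) T (\<lambda>x. Some (q j x))" if "j \<in> J" for j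
      by (rule into_T[OF dia[OF that] leg[OF that]])
    show "case a of (i, j, h) \<Rightarrow> \<forall>x\<in>upts (D i). Some (q j (h x)) = Some (q i x)" if "a \<in> A" for a
      using bspec[OF coc that] by (auto split: prod.splits)
  qed
  from univ[OF this]
  obtain g where g: "uniform_map X T g" "\<And>j x. j \<in> J \<Longrightarrow> x \<in> upts (D j) \<Longrightarrow> g (q j x) = Some (q j x)"
    by blast
  have surj: "\<exists>j\<in>J. \<exists>x\<in>upts (D j). y = q j x" if y: "y \<in> upts X" for y
  proof (rule ccontr)
    assume n: "\<not> ?thesis"
    define I :: "'a option uspace" where "I = (UNIV, principal (UNIV \<times> UNIV))"
    have I: "uniform_space I" unfolding I_def by (rule uniform_space_indiscrete)
    have any: "uniform_map (D j) I r" for j r unfolding I_def by (rule uniform_map_UNIV)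
    have any': "uniform_map X I r" for r unfolding I_def by (rule uniform_map_UNIV)
    have "uniform_cocone J D A I (\<lambda>j x. None)"
      unfolding uniform_cocone_def using I any by (simp split: prod.splits)
    from univ[OF this] have ex1: "\<exists>!g. g \<in> extensional (upts X) \<and> uniform_map X I g \<and> (\<forall>j\<in>J. \<forall>x\<in>upts (D j). g (q j x) = None)" .
    define g1 g2 :: "'a \<Rightarrow> 'a option" where "g1 = (\<lambda>x\<in>upts X. None)" 
      and "g2 = (\<lambda>x\<in>upts X. if x = y then Some y else None)"
    have m: "q j x \<in> upts X" if "j \<in> J" "x \<in> upts (D j)" for j x
      using qX[OF that(1)] that(2) by (auto simp: uniform_map_def)
    have "g1 = g2"
    proof -
      have "g1 \<in> extensional (upts X) \<and> uniform_map X I g1 \<and> (\<forall>j\<in>J. \<forall>x\<in>upts (D j). g1 (q j x) = None)"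
        using m any' by (simp add: g1_def)
      moreover have "q j x \<noteq> y" if "j \<in> J" "x \<in> upts (D j)" for j x using n that by blast
      then have "g2 \<in> extensional (upts X) \<and> uniform_map X I g2 \<and> (\<forall>j\<in>J. \<forall>x\<in>upts (D j). g2 (q j x) = None)"
        using m any' by (simp add: g2_def)
      ultimately show ?thesis using ex1 by blast
    qed
    then have "g1 y = g2 y" by simp
    then show False using y by (simp add: g1_def g2_def)
  qed
  have eq: "the (g y) = y" if "y \<in> upts X" for y
    using surj[OF that] g(2) by force
  have "uniform_map X Y (\<lambda>x. the (g x))" by (rule uniform_map_comp[OF g(1) out_T])
  then show ?thesis using uniform_map_cong[OF X, of "\<lambda>x. the (g x)" "\<lambda>x. x" Y] eq by blast
qed

lemma metric_uspace_uniform: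
  assumes "emetric_on M d" shows "uniform_space (metric_uspace M d)"
proof -
  have ev: "eventually E (ents (metric_uspace M d)) \<longleftrightarrow>
      (\<exists>e>0. \<forall>x\<in>M. \<forall>y\<in>M. d x y < ennreal e \<longrightarrow> E (x, y))" for E
    unfolding metric_uspace_def snd_conv
  proof (subst eventually_INF_base)
    fix a b :: real assume "a \<in> {0<..}" "b \<in> {0<..}"
    then show "\<exists>x\<in>{0<..}. principal {(xa, y). xa \<in> M \<and> y \<in> M \<and> d xa y < ennreal x}
        \<le> inf (principal {(x, y). x \<in> M \<and> y \<in> M \<and> d x y < ennreal a})
              (principal {(x, y). x \<in> M \<and> y \<in> M \<and> d x y < ennreal b})"
      by (intro bexI[of _ "min a b"]) (auto simp: ennreal_less_iff min_def split: if_splits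
           intro: order.strict_trans2 ennreal_leI)
  qed (auto simp: eventually_principal)
  show ?thesis
    unfolding uniform_space_def
  proof (intro conjI allI impI)
    show "ents (metric_uspace M d) \<le> principal (upts (metric_uspace M d) \<times> upts (metric_uspace M d))"
      unfolding le_principal ev by (auto simp: metric_uspace_def intro: exI[of _ 1])
  next
    fix E assume "eventually E (ents (metric_uspace M d))"
    then obtain e where e: "e > 0" "\<And>x y. x \<in> M \<Longrightarrow> y \<in> M \<Longrightarrow> d x y < ennreal e \<Longrightarrow> E (x, y)"
      unfolding ev by blast
    have d0: "d x x = 0" if "x \<in> M" for x using assms that by (simp add: emetric_on_def)
    show "\<forall>x\<in>upts (metric_uspace M d). E (x, x)"
      using e d0 by (auto simp: metric_uspace_def)
    show "eventually (\<lambda>(x, y). E (y, x)) (ents (metric_uspace M d))"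
      unfolding ev using e assms by (auto simp: emetric_on_def intro!: exI[of _ e])
    define D where "D = (\<lambda>(x, y). x \<in> M \<and> y \<in> M \<and> d x y < ennreal (e / 2))"
    have "eventually D (ents (metric_uspace M d))"
      unfolding ev D_def using e(1) by (intro exI[of _ "e / 2"]) auto
    moreover have "E (x, z)" if "D (x, y)" "D (y, z)" for x y z
    proof -
      have "d x z \<le> d x y + d y z" using that assms by (auto simp: D_def emetric_on_def)
      also have "\<dots> < ennreal (e / 2) + ennreal (e / 2)"
        using that by (auto simp: D_def intro: add_strict_mono)
      also have "\<dots> = ennreal e" using e(1) by (simp flip: ennreal_plus)
      finally show ?thesis using that e(2) by (auto simp: D_def)
    qed
    ultimately show "\<exists>D. eventually D (ents (metric_uspace M d)) \<and> (\<forall>x y z. D (x, y) \<longrightarrow> D (y, z) \<longrightarrow> E (x, z))"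
      by (intro exI[of _ D]) simp
  qed
qed


lemma U_object_uniform: "U_object \<UU> X \<Longrightarrow> uniform_space X"
  by (simp add: U_object_def)

lemma metric_uspace_separated:
  assumes "emetric_on M d" shows "separated (metric_uspace M d)"
  unfolding separated_def
proof (intro ballI impI)
  fix x y assume xy: "x \<in> upts (metric_uspace M d)" "y \<in> upts (metric_uspace M d)"
    and E: "\<forall>E. eventually E (ents (metric_uspace M d)) \<longrightarrow> E (x, y)"
  have M: "x \<in> M" "y \<in> M" using xy by (simp_all add: metric_uspace_def)
  have "d x y < ennreal e" if "e > 0" for e
  proof -
    have "ents (metric_uspace M d) \<le> principal {(x, y). x \<in> M \<and> y \<in> M \<and> d x y < ennreal e}"
      unfolding metric_uspace_def snd_conv by (rule INF_lower) (use that in simp)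
    then show ?thesis using E unfolding le_principal by fastforce
  qed
  then have "d x y \<le> 0 + ennreal e" if "e > 0" for e
    using that by (simp add: less_imp_le)
  then have "d x y \<le> 0" by (rule ennreal_le_epsilon)
  then show "x = y" using assms M by (simp add: emetric_on_def)
qed

lemma uniform_map_id: "uniform_map X X (\<lambda>x. x)"
proof -
  have "map_prod (\<lambda>x. x) (\<lambda>x. x) = (\<lambda>p :: 'a \<times> 'a. p)" by (auto simp: fun_eq_iff)
  then show ?thesis by (simp add: uniform_map_def filterlim_ident)
qed

lemma U_object_metric:
  fixes M :: "'u set"
  assumes "connected_lc_metric M d"
  shows "U_object TYPE('u) (metric_uspace M d)"
proof -
  let ?X = "metric_uspace M d"
  have em: "emetric_on M d" using assms by (simp add: connected_lc_metric_def)
  let ?j = "(M, d, \<lambda>x :: 'u. x)"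
  have "uniform_colimit {?j} (\<lambda>_. ?X) {} ?X (\<lambda>_ x. x)"
    unfolding uniform_colimit_def
  proof (intro conjI allI impI)
    show "uniform_diagram {?j} (\<lambda>_. ?X) {}"
      by (simp add: uniform_diagram_def metric_uspace_uniform[OF em])
    show "uniform_cocone {?j} (\<lambda>_. ?X) {} ?X (\<lambda>_ x. x)"
      by (simp add: uniform_cocone_def metric_uspace_uniform[OF em] uniform_map_id)
  next
    fix T :: "'u option uspace" and r
    assume "uniform_cocone {?j} (\<lambda>_. ?X) {} T r"
    then have r: "uniform_map ?X T (r ?j)" by (simp add: uniform_cocone_def)
    have "uniform_map ?X T (restrict (r ?j) (upts ?X))"
      using uniform_map_cong[OF metric_uspace_uniform[OF em], of "r ?j" "restrict (r ?j) (upts ?X)" T] r by simp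
    then show "\<exists>!g. g \<in> extensional (upts ?X) \<and> uniform_map ?X T g \<and> (\<forall>j\<in>{?j}. \<forall>x\<in>upts ?X. g x = r j x)"
      by (intro ex1I[of _ "restrict (r ?j) (upts ?X)"]) (auto intro: extensionalityI)
  qed
  moreover have "\<forall>j\<in>{?j}. \<exists>M' d'. connected_lc_metric M' d' \<and> ?X = metric_uspace M' d'"
    using assms by blast
  ultimately show ?thesis
    unfolding U_object_def
    by (intro conjI metric_uspace_uniform[OF em] metric_uspace_separated[OF em] exI) assumption+
qed

lemma U_object_detect:
  fixes W :: "'a uspace"
  assumes W: "U_object TYPE('u) W" and Y: "uniform_space Y" "upts Y = upts W"
    and probe: "\<And>(Z :: 'u uspace) g. U_object TYPE('u) Z \<Longrightarrow> uniform_map Z W g \<Longrightarrow> uniform_map Z Y g"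
  shows "uniform_map W Y (\<lambda>x. x)"
proof -
  obtain J :: "('u set \<times> ('u \<Rightarrow> 'u \<Rightarrow> ennreal) \<times> ('u \<Rightarrow> 'a)) set"
    and D :: "_ \<Rightarrow> 'u uspace" and A q where
    D: "\<forall>j\<in>J. \<exists>M d. connected_lc_metric M d \<and> D j = metric_uspace M d"
    and col: "uniform_colimit J D A W q"
    using W unfolding U_object_def by blast
  show ?thesis
  proof (rule uniform_colimit_detect[OF col Y])
    fix j assume j: "j \<in> J"
    have "U_object TYPE('u) (D j)" using bspec[OF D j] U_object_metric by force
    moreover have "uniform_map (D j) W (q j)"
      using col j unfolding uniform_colimit_def uniform_cocone_def by blast
    ultimately show "uniform_map (D j) Y (q j)" by (rule probe)
  qed
qed

lemma uniform_map_id_iff: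
  assumes "uniform_space (S, F)"
  shows "uniform_map (S, F) (S, G) (\<lambda>x. x) \<longleftrightarrow> F \<le> G"
proof -
  have "map_prod (\<lambda>x. x) (\<lambda>x. x) = (\<lambda>p :: 'a \<times> 'a. p)" by (auto simp: fun_eq_iff)
  then show ?thesis by (simp add: uniform_map_def filterlim_def)
qed

lemma final_unique:
  fixes W :: "'a uspace" and \<G> :: "('u uspace \<times> ('u \<Rightarrow> 'a)) set"
  assumes W: "U_object TYPE('u) W" "upts W = S"
    and into: "\<And>Z g. (Z, g) \<in> \<G> \<Longrightarrow> uniform_map Z W g"
    and all: "\<And>(Z :: 'u uspace) g. U_object TYPE('u) Z \<Longrightarrow> uniform_map Z W g \<Longrightarrow>
                \<exists>g'. (Z, g') \<in> \<G> \<and> (\<forall>z\<in>upts Z. g' z = g z)"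
  shows "W = final_uspace S \<G>"
proof -
  obtain F where WF: "W = (S, F)" using W(2) by (cases W) auto
  have uW: "uniform_space (S, F)" using U_object_uniform[OF W(1)] WF by simp
  let ?\<F> = "{F. uniform_space (S, F) \<and> (\<forall>(Z, g)\<in>\<G>. uniform_map Z (S, F) g)}"
  have "F \<in> ?\<F>" using uW into WF by blast
  moreover have "F \<le> F'" if "F' \<in> ?\<F>" for F'
  proof -
    have F': "uniform_space (S, F')" "\<And>Z g. (Z, g) \<in> \<G> \<Longrightarrow> uniform_map Z (S, F') g"
      using that by blast+
    have "uniform_map W (S, F') (\<lambda>x. x)"
    proof (rule U_object_detect[OF W(1) F'(1)])
      fix Z :: "'u uspace" and g assume Z: "U_object TYPE('u) Z" "uniform_map Z W g"
      obtain g' where g': "(Z, g') \<in> \<G>" "\<forall>z\<in>upts Z. g' z = g z" using all[OF Z] by blast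
      show "uniform_map Z (S, F') g"
        using uniform_map_cong[OF U_object_uniform[OF Z(1)], of g' g "(S, F')"] g' F'(2) by blast
    qed (simp add: W(2))
    then show ?thesis using uniform_map_id_iff[OF uW] WF by simp
  qed
  ultimately have "F = Inf ?\<F>" by (intro antisym Inf_greatest Inf_lower) auto
  then show ?thesis by (simp add: WF final_uspace_def)
qed

theorem coreflection_unique:
  fixes W X :: "'a uspace"
  assumes "U_object TYPE('u) W" "upts W = upts X" "uniform_map W X (\<lambda>x. x)"
    and "\<And>(Z :: 'u uspace) g. U_object TYPE('u) Z \<Longrightarrow> uniform_map Z X g \<Longrightarrow> uniform_map Z W g"
  shows "W = coreflection TYPE('u) X"
  unfolding coreflection_def
proof (rule final_unique[OF assms(1,2)])
  fix Z :: "'u uspace" and g assume "U_object TYPE('u) Z" "uniform_map Z W g"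
  then show "\<exists>g'. (Z, g') \<in> {(Z, g). U_object TYPE('u) Z \<and> uniform_map Z X g} \<and> (\<forall>z\<in>upts Z. g' z = g z)"
    using uniform_map_comp[OF _ assms(3), of Z g] by blast
qed (use assms(4) in blast)

lemma coreflection_map:
  fixes f :: "'a \<Rightarrow> 'b"
  assumes "uniform_map X Y f"
  shows "uniform_map (coreflection TYPE('u) X) (coreflection TYPE('u) Y) f"
proof -
  let ?GX = "{(Z :: 'u uspace, g). U_object TYPE('u) Z \<and> uniform_map Z X g}"
  let ?GY = "{(Z :: 'u uspace, g). U_object TYPE('u) Z \<and> uniform_map Z Y g}"
  have ok: "uniform_space Z \<and> g \<in> upts Z \<rightarrow> upts Y" if "(Z, g) \<in> ?GY" for Z g
    using that U_object_uniform[of "TYPE('u)" Z] by (simp add: uniform_map_def)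
  show ?thesis unfolding coreflection_def
  proof (rule uniform_map_from_final)
    show "uniform_space (final_uspace (upts Y) ?GY)" by (rule uniform_space_final[OF ok])
    show "f \<in> upts X \<rightarrow> upts (final_uspace (upts Y) ?GY)"
      using assms by (simp add: uniform_map_def)
    fix Z g assume Zg: "(Z, g) \<in> ?GX"
    then have "uniform_map Z Y (\<lambda>z. f (g z))" using uniform_map_comp[OF _ assms, of Z g] by blast
    then have "uniform_map Z (final_uspace (upts Y) ?GY) (\<lambda>z. f (g z))"
      using Zg by (intro uniform_map_into_final[OF ok]) auto
    then show "uniform_space Z \<and> g \<in> upts Z \<rightarrow> upts X \<and> uniform_map Z (final_uspace (upts Y) ?GY) (\<lambda>z. f (g z))"
      using Zg U_object_uniform[of "TYPE('u)" Z] by (simp add: uniform_map_def)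
  qed
qed

lemma prod_uspace_map:
  assumes "uniform_map Z W g"
  shows "uniform_map (prod_uspace Z X) (prod_uspace W X) (\<lambda>(z, x). (g z, x))"
  unfolding uniform_map_def
proof
  show "(\<lambda>(z, x). (g z, x)) \<in> upts (prod_uspace Z X) \<rightarrow> upts (prod_uspace W X)"
    using assms by (auto simp: uniform_map_def prod_uspace_def)
  let ?m = "map_prod (\<lambda>(z, x). (g z, x)) (\<lambda>(z, x). (g z, x))"
  have e: "(\<lambda>(p, q). (fst p, fst q)) \<circ> ?m = map_prod g g \<circ> (\<lambda>(p, q). (fst p, fst q))"
    "(\<lambda>(p, q). (snd p, snd q)) \<circ> ?m = (\<lambda>(p, q). (snd p, snd q))"
    by (auto simp: fun_eq_iff)
  have 1: "filterlim (map_prod g g \<circ> (\<lambda>(p :: 'a \<times> 'c, q). (fst p, fst q))) (ents W) (ents (prod_uspace Z X))"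
    unfolding comp_def
    by (rule filterlim_compose[of _ _ "ents Z"])
       (use assms in \<open>auto simp: uniform_map_def prod_uspace_def filterlim_iff_le_filtercomap\<close>)
  have 2: "filterlim (\<lambda>(p :: 'a \<times> 'c, q). (snd p, snd q)) (ents X) (ents (prod_uspace Z X))"
    by (auto simp: prod_uspace_def filterlim_iff_le_filtercomap)
  show "filterlim ?m (ents (prod_uspace W X)) (ents (prod_uspace Z X))"
    unfolding prod_uspace_def[of W] snd_conv filterlim_inf filterlim_filtercomap_iff e
    using 1 2 by blast
qed

theorem U_exp_unique:
  fixes W :: "('a \<Rightarrow> 'b) uspace"
  assumes W: "U_object TYPE('u) W" "upts W = U_hom X Y"
    and eval: "uniform_map (U_prod TYPE('u) W X) Y (\<lambda>(f, x). f x)"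
    and curry: "\<And>(Z :: 'u uspace) h. U_object TYPE('u) Z \<Longrightarrow>
        uniform_map (U_prod TYPE('u) Z X) Y h \<Longrightarrow> uniform_map Z W (\<lambda>z. \<lambda>x\<in>upts X. h (z, x))"
  shows "W = U_exp TYPE('u) X Y"
  unfolding U_exp_def
proof (rule final_unique[OF W])
  fix Z :: "'u uspace" and g assume Z: "U_object TYPE('u) Z" "uniform_map Z W g"
  have "uniform_map (U_prod TYPE('u) Z X) (U_prod TYPE('u) W X) (\<lambda>(z, x). (g z, x))"
    unfolding U_prod_def by (intro coreflection_map prod_uspace_map Z)
  then have h: "uniform_map (U_prod TYPE('u) Z X) Y (\<lambda>p. (\<lambda>(f, x). f x) ((\<lambda>(z, x). (g z, x)) p))"
    using eval by (rule uniform_map_comp)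
  let ?h = "\<lambda>p. (\<lambda>(f, x). f x) ((\<lambda>(z, x). (g z, x)) p)"
  have "g z \<in> extensional (upts X)" if "z \<in> upts Z" for z
    using that Z(2) W(2) by (auto simp: uniform_map_def U_hom_def Pi_iff)
  then have eq: "\<forall>z\<in>upts Z. (\<lambda>x\<in>upts X. ?h (z, x)) = g z"
    by (auto simp: fun_eq_iff extensional_def restrict_def)
  show "\<exists>g'. (Z, g') \<in> {(Z, \<lambda>z. \<lambda>x\<in>upts X. h (z, x)) | Z h.
          U_object TYPE('u) Z \<and> uniform_map (U_prod TYPE('u) Z X) Y h} \<and> (\<forall>z\<in>upts Z. g' z = g z)"
  proof (intro exI conjI)
    show "(Z, \<lambda>z. \<lambda>x\<in>upts X. ?h (z, x)) \<in> {(Z, \<lambda>z. \<lambda>x\<in>upts X. h (z, x)) | Z h.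
          U_object TYPE('u) Z \<and> uniform_map (U_prod TYPE('u) Z X) Y h}"
      unfolding mem_Collect_eq by (rule exI[of _ Z], rule exI[of _ ?h]) (use Z h in simp)
  qed (rule eq)
qed (use curry in blast)


lemma istopology_utopology:
  "istopology (\<lambda>U. U \<subseteq> upts X \<and> (\<forall>x\<in>U. eventually (\<lambda>(x', y). x' = x \<longrightarrow> y \<in> U) (ents X)))"
  unfolding istopology_def
proof (intro conjI allI impI ballI; (elim conjE)?)
  fix S T x assume S: "S \<subseteq> upts X" "\<forall>x\<in>S. eventually (\<lambda>(x', y). x' = x \<longrightarrow> y \<in> S) (ents X)"
    and T: "T \<subseteq> upts X" "\<forall>x\<in>T. eventually (\<lambda>(x', y). x' = x \<longrightarrow> y \<in> T) (ents X)"
  show "S \<inter> T \<subseteq> upts X" using S by blast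
  assume "x \<in> S \<inter> T"
  then have "eventually (\<lambda>(x', y). x' = x \<longrightarrow> y \<in> S) (ents X)"
    "eventually (\<lambda>(x', y). x' = x \<longrightarrow> y \<in> T) (ents X)" using S T by blast+
  then show "eventually (\<lambda>(x', y). x' = x \<longrightarrow> y \<in> S \<inter> T) (ents X)"
    by eventually_elim auto
next
  fix \<K> x assume K: "\<forall>S\<in>\<K>. S \<subseteq> upts X \<and> (\<forall>x\<in>S. eventually (\<lambda>(x', y). x' = x \<longrightarrow> y \<in> S) (ents X))"
  show "\<Union>\<K> \<subseteq> upts X" using K by blast
  assume "x \<in> \<Union>\<K>"
  then obtain S where S: "S \<in> \<K>" "x \<in> S" by blast
  then have "eventually (\<lambda>(x', y). x' = x \<longrightarrow> y \<in> S) (ents X)" using K by blast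
  then show "eventually (\<lambda>(x', y). x' = x \<longrightarrow> y \<in> \<Union>\<K>) (ents X)"
    by eventually_elim (use S in auto)
qed

lemma openin_utopology:
  "openin (utopology X) U \<longleftrightarrow>
     U \<subseteq> upts X \<and> (\<forall>x\<in>U. eventually (\<lambda>(x', y). x' = x \<longrightarrow> y \<in> U) (ents X))"
  unfolding utopology_def topology_inverse'[OF istopology_utopology] ..

lemma istopology_top_realization:
  "istopology (\<lambda>U. U \<subseteq> cell_pts C // glue_equiv C \<and>
     (\<forall>n. \<forall>c\<in>cells C n.
        openin (utopology (metric_uspace (cube_pts n) max_dist))
          {t \<in> cube_pts n. glue_equiv C `` {(n, c, t)} \<in> U}))"
  unfolding istopology_def
proof (intro conjI allI impI ballI; (elim conjE)?)
  let ?T = "\<lambda>n. utopology (metric_uspace (cube_pts n) max_dist)"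
  let ?p = "\<lambda>n c U. {t \<in> cube_pts n. glue_equiv C `` {(n, c, t)} \<in> U}"
  fix S T n c assume a: "S \<subseteq> cell_pts C // glue_equiv C" "\<forall>n. \<forall>c\<in>cells C n. openin (?T n) (?p n c S)"
    "T \<subseteq> cell_pts C // glue_equiv C" "\<forall>n. \<forall>c\<in>cells C n. openin (?T n) (?p n c T)"
  show "S \<inter> T \<subseteq> cell_pts C // glue_equiv C" using a by blast
  assume "c \<in> cells C n"
  then have "openin (?T n) (?p n c S \<inter> ?p n c T)" using a by (intro openin_Int) blast+
  moreover have "?p n c S \<inter> ?p n c T = ?p n c (S \<inter> T)" by blast
  ultimately show "openin (?T n) (?p n c (S \<inter> T))" by simp
next
  let ?T = "\<lambda>n. utopology (metric_uspace (cube_pts n) max_dist)"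
  let ?p = "\<lambda>n c U. {t \<in> cube_pts n. glue_equiv C `` {(n, c, t)} \<in> U}"
  fix \<K> n c assume a: "\<forall>S\<in>\<K>. S \<subseteq> cell_pts C // glue_equiv C \<and> (\<forall>n. \<forall>c\<in>cells C n. openin (?T n) (?p n c S))"
  show "\<Union>\<K> \<subseteq> cell_pts C // glue_equiv C" using a by blast
  assume "c \<in> cells C n"
  then have "openin (?T n) (\<Union>S\<in>\<K>. ?p n c S)" using a by (intro openin_Union) blast
  moreover have "(\<Union>S\<in>\<K>. ?p n c S) = ?p n c (\<Union>\<K>)" by blast
  ultimately show "openin (?T n) (?p n c (\<Union>\<K>))" by simp
qed

lemma istopology_mapping_space:
  "istopology (\<lambda>U. U \<subseteq> mapping_set X Y \<and>
     (\<forall>(K :: real topology) h.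
        compact_space K \<and> Hausdorff_space K \<and> locally_connected_space K \<and> second_countable K \<and>
        continuous_map (prod_topology K X) Y h \<longrightarrow>
        openin K {k \<in> topspace K. (\<lambda>x\<in>topspace X. h (k, x)) \<in> U}))"
proof -
  let ?p = "\<lambda>(K :: real topology) h U. {k \<in> topspace K. (\<lambda>x\<in>topspace X. h (k, x)) \<in> U}"
  have 1: "?p K h (S \<inter> T) = ?p K h S \<inter> ?p K h T" for K h S T by blast
  have 2: "?p K h (\<Union>\<K>) = (\<Union>S\<in>\<K>. ?p K h S)" for K h \<K> by blast
  show ?thesis
    unfolding istopology_def 1 2 by (intro conjI allI impI openin_Int openin_Union) blast+
qed

lemma connected_lc_metric_singleton: "connected_lc_metric {a} (\<lambda>_ _. 0)"
proof -
  let ?T = "utopology (metric_uspace {a} (\<lambda>_ _. 0))"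
  have sub: "topspace ?T \<subseteq> {a}"
    unfolding topspace_def by (auto simp: openin_utopology metric_uspace_def)
  have "connectedin ?T U" if "U \<subseteq> topspace ?T" for U
  proof -
    have "U = {} \<or> (U = {a} \<and> a \<in> topspace ?T)" using that sub by auto
    then show ?thesis by auto
  qed
  moreover from this have "locally_connected_space ?T"
    unfolding locally_connected_space_def neighbourhood_base_of
    by (meson openin_subset order_refl)
  ultimately show ?thesis
    by (auto simp: connected_lc_metric_def emetric_on_def simp flip: connectedin_topspace)
qed

lemma coreflection_le: 
  assumes "uniform_space X"
  shows "uniform_map (coreflection TYPE('u) X) X (\<lambda>x. x)"
  unfolding coreflection_def
proof (rule uniform_map_from_final[OF assms])
  fix Z :: "'u uspace" and g
  assume "(Z, g) \<in> {(Z, g). U_object TYPE('u) Z \<and> uniform_map Z X g}"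
  then show "uniform_space Z \<and> g \<in> upts Z \<rightarrow> upts X \<and> uniform_map Z X g"
    using U_object_uniform[of "TYPE('u)" Z] by (simp add: uniform_map_def)
qed simp

lemma uniform_map_into_coreflection:
  fixes Z :: "'u uspace"
  assumes "U_object TYPE('u) Z" "uniform_map Z X g"
  shows "uniform_map Z (coreflection TYPE('u) X) g"
  unfolding coreflection_def
proof (rule uniform_map_into_final)
  fix Z :: "'u uspace" and g
  assume "(Z, g) \<in> {(Z, g). U_object TYPE('u) Z \<and> uniform_map Z X g}"
  then show "uniform_space Z \<and> g \<in> upts Z \<rightarrow> upts X"
    using U_object_uniform[of "TYPE('u)" Z] by (simp add: uniform_map_def)
qed (use assms in simp)

lemma uniform_space_coreflection: "uniform_space (coreflection TYPE('u) X)"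
  unfolding coreflection_def
proof (rule uniform_space_final)
  fix Z :: "'u uspace" and g
  assume "(Z, g) \<in> {(Z, g). U_object TYPE('u) Z \<and> uniform_map Z X g}"
  then show "uniform_space Z \<and> g \<in> upts Z \<rightarrow> upts X"
    using U_object_uniform[of "TYPE('u)" Z] by (simp add: uniform_map_def)
qed

text \<open>A map out of a \<open>\<U>\<close>-object is uniform if it is so on all metric probes.\<close>

lemma U_object_uniform_mapI:
  fixes Z :: "'z uspace"
  assumes Z: "U_object TYPE('u) Z" and T: "uniform_space T" "f \<in> upts Z \<rightarrow> upts T"
    and probe: "\<And>(M :: 'u set) d p. connected_lc_metric M d \<Longrightarrow> uniform_map (metric_uspace M d) Z p \<Longrightarrow>
      uniform_map (metric_uspace M d) T (\<lambda>x. f (p x))"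
  shows "uniform_map Z T f"
proof -
  obtain J :: "('u set \<times> ('u \<Rightarrow> 'u \<Rightarrow> ennreal) \<times> ('u \<Rightarrow> 'z)) set"
    and D :: "_ \<Rightarrow> 'u uspace" and A q where
    D: "\<forall>j\<in>J. \<exists>M d. connected_lc_metric M d \<and> D j = metric_uspace M d"
    and col: "uniform_colimit J D A Z q"
    using Z unfolding U_object_def by blast
  let ?P = "(upts Z, inf (principal (upts Z \<times> upts Z)) (filtercomap (map_prod f f) (ents T)))"
  have "uniform_map Z ?P (\<lambda>x. x)"
  proof (rule uniform_colimit_detect[OF col uniform_space_pullback[OF T]])
    fix j assume j: "j \<in> J"
    obtain M d where Md: "connected_lc_metric M d" "D j = metric_uspace M d" using D j by blast
    have q: "uniform_map (D j) Z (q j)"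
      using col j unfolding uniform_colimit_def uniform_cocone_def by blast
    have uD: "uniform_space (D j)"
      using col j unfolding uniform_colimit_def uniform_diagram_def by blast
    have qp: "q j \<in> upts (D j) \<rightarrow> upts Z" using q by (simp add: uniform_map_def)
    have "uniform_map (D j) T (\<lambda>x. f (q j x))" using probe[OF Md(1)] q Md(2) by simp
    moreover have "map_prod f f \<circ> map_prod (q j) (q j) = map_prod (\<lambda>x. f (q j x)) (\<lambda>x. f (q j x))"
      by auto
    moreover have "eventually (\<lambda>p. map_prod (q j) (q j) p \<in> upts Z \<times> upts Z) (ents (D j))"
      using ev_pts[OF uD] by eventually_elim (use qp in \<open>auto simp: Pi_iff\<close>)
    ultimately show "uniform_map (D j) ?P (q j)"
      using qp by (simp add: uniform_map_def filterlim_inf filterlim_principal filterlim_filtercomap_iff)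
  qed simp
  moreover have "uniform_map ?P T f"
    using T(2) by (simp add: uniform_map_def filterlim_iff_le_filtercomap)
  ultimately show ?thesis by (rule uniform_map_comp)
qed

lemma uniform_map_const:
  fixes Z :: "'z uspace"
  assumes "uniform_space Y" "y \<in> upts Y"
  shows "uniform_map Z Y (\<lambda>_. y)"
proof -
  have "P (y, y)" if "eventually P (ents Y)" for P
    using us_refl[OF uniform_space_surj[OF assms(1)] that assms(2)] .
  then have "filterlim (\<lambda>_. (y, y)) (ents Y) (ents Z)"
    unfolding filterlim_iff by (intro allI impI always_eventually) blast
  moreover have "map_prod (\<lambda>_. y) (\<lambda>_. y) = (\<lambda>_ :: 'z \<times> 'z. (y, y))" by (auto simp: fun_eq_iff)
  ultimately show ?thesis using assms(2) by (simp add: uniform_map_def)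
qed

theorem U_object_coreflection:
  fixes X :: "'a uspace"
  assumes X: "uniform_space X" "separated X"
  shows "U_object TYPE('u) (coreflection TYPE('u) X)"
proof -
  define K where "K = coreflection TYPE('u) X"
  have uK: "uniform_space K" unfolding K_def by (rule uniform_space_coreflection)
  have pK: "upts K = upts X" by (simp add: K_def coreflection_def)
  have KX: "uniform_map K X (\<lambda>x. x)" unfolding K_def by (rule coreflection_le[OF X(1)])
  have le: "ents K \<le> ents X"
  proof -
    have "map_prod (\<lambda>x. x) (\<lambda>x. x) = (\<lambda>p :: 'a \<times> 'a. p)" by (auto simp: fun_eq_iff)
    then show ?thesis using KX by (simp add: uniform_map_def filterlim_def)
  qed
  have sep: "separated K"
    unfolding separated_def pK
  proof (intro ballI impI)
    fix x y assume xy: "x \<in> upts X" "y \<in> upts X" and E: "\<forall>E. eventually E (ents K) \<longrightarrow> E (x, y)"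
    have "\<forall>E. eventually E (ents X) \<longrightarrow> E (x, y)" using E filter_leD[OF le] by blast
    then show "x = y" using X(2) xy unfolding separated_def by blast
  qed
  define J :: "('u set \<times> ('u \<Rightarrow> 'u \<Rightarrow> ennreal) \<times> ('u \<Rightarrow> 'a)) set" where
    "J = {(M, d, p). connected_lc_metric M d \<and> uniform_map (metric_uspace M d) X p}"
  define D where "D = (\<lambda>(M, d, p). metric_uspace M d) \<circ> (\<lambda>j. j :: 'u set \<times> ('u \<Rightarrow> 'u \<Rightarrow> ennreal) \<times> ('u \<Rightarrow> 'a))"
  define q where "q = (\<lambda>(M, d, p). p) \<circ> (\<lambda>j. j :: 'u set \<times> ('u \<Rightarrow> 'u \<Rightarrow> ennreal) \<times> ('u \<Rightarrow> 'a))"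
  define A where "A = {(i, j, h). i \<in> J \<and> j \<in> J \<and> uniform_map (D i) (D j) h \<and>
      (\<forall>x\<in>upts (D i). q j (h x) = q i x)}"
  have J: "\<exists>M d. connected_lc_metric M d \<and> D j = metric_uspace M d" "uniform_map (D j) X (q j)" if "j \<in> J" for j
    using that by (auto simp: J_def D_def q_def)
  have DU: "U_object TYPE('u) (D j)" if "j \<in> J" for j
    using J(1)[OF that] U_object_metric by metis
  have qK: "uniform_map (D j) K (q j)" if "j \<in> J" for j
    unfolding K_def by (rule uniform_map_into_coreflection[OF DU[OF that] J(2)[OF that]])
  define pt where "pt = (\<lambda>y :: 'a. ({undefined :: 'u}, (\<lambda>_ _. 0) :: 'u \<Rightarrow> 'u \<Rightarrow> ennreal, \<lambda>_ :: 'u. y))"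
  have ptD: "D (pt y) = metric_uspace {undefined} (\<lambda>_ _. 0)" "q (pt y) x = y"
    "upts (D (pt y)) = {undefined}" for y x
    by (simp_all add: D_def q_def pt_def metric_uspace_def)
  have ptJ: "pt y \<in> J" if "y \<in> upts X" for y
    unfolding J_def pt_def using connected_lc_metric_singleton[of "undefined :: 'u"]
      uniform_map_const[OF X(1) that, of "metric_uspace {undefined :: 'u} (\<lambda>_ _. 0)"] by simp
  have uD: "uniform_space (D j)" if "j \<in> J" for j
    by (rule U_object_uniform[OF DU[OF that]])
  have "uniform_colimit J D A K q"
    unfolding uniform_colimit_def
  proof (intro conjI allI impI)
    show "uniform_diagram J D A"
      using uD by (auto simp: uniform_diagram_def A_def)
    show "uniform_cocone J D A K q"
      using uK qK by (auto simp: uniform_cocone_def A_def)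
  next
    fix T :: "'a option uspace" and r
    assume T: "uniform_cocone J D A T r"
    have uT: "uniform_space T" using T unfolding uniform_cocone_def by blast
    have r: "uniform_map (D j) T (r j)" if "j \<in> J" for j
      using T that unfolding uniform_cocone_def by blast
    have rA: "r j (h x) = r i x" if "(i, j, h) \<in> A" "x \<in> upts (D i)" for i j h x
      using T that unfolding uniform_cocone_def by blast
    define g where "g = (\<lambda>y\<in>upts K. r (pt y) undefined)"
    have g: "g (q j x) = r j x" if j: "j \<in> J" and x: "x \<in> upts (D j)" for j x
    proof -
      have qx: "q j x \<in> upts X" using J(2)[OF j] x by (auto simp: uniform_map_def)
      have "(pt (q j x), j, \<lambda>_. x) \<in> A"
        unfolding A_def using ptJ[OF qx] j uniform_map_const[OF uD[OF j] x, of "D (pt (q j x))"]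
        by (simp add: ptD)
      from rA[OF this, of undefined] show ?thesis using qx pK ptD by (simp add: g_def)
    qed
    have gT: "g y \<in> upts T" if "y \<in> upts X" for y
      using r[OF ptJ[OF that]] that pK ptD by (auto simp: g_def uniform_map_def)
    have "uniform_map K T g"
      unfolding K_def coreflection_def
    proof (rule uniform_map_from_final[OF uT])
      show "g \<in> upts X \<rightarrow> upts T" using gT by blast
      fix Z :: "'u uspace" and p
      assume "(Z, p) \<in> {(Z, g). U_object TYPE('u) Z \<and> uniform_map Z X g}"
      then have Z: "U_object TYPE('u) Z" "uniform_map Z X p" by auto
      have p: "p \<in> upts Z \<rightarrow> upts X" using Z(2) by (simp add: uniform_map_def)
      have "uniform_map Z T (\<lambda>z. g (p z))"
      proof (rule U_object_uniform_mapI[OF Z(1) uT])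
        show "(\<lambda>z. g (p z)) \<in> upts Z \<rightarrow> upts T" using p gT by blast
        fix M :: "'u set" and d m
        assume M: "connected_lc_metric M d" "uniform_map (metric_uspace M d) Z m"
        let ?j = "(M, d, \<lambda>x. p (m x))"
        have j: "?j \<in> J" unfolding J_def using M(1) uniform_map_comp[OF M(2) Z(2)] by simp
        have Dj: "D ?j = metric_uspace M d" "q ?j = (\<lambda>x. p (m x))" by (simp_all add: D_def q_def)
        have "r ?j x = g (p (m x))" if "x \<in> upts (D ?j)" for x
          using g[OF j that] Dj by simp
        then show "uniform_map (metric_uspace M d) T (\<lambda>x. g (p (m x)))"
          using r[OF j] uniform_map_cong[OF uD[OF j], of "r ?j" "\<lambda>x. g (p (m x))" T] Dj(1) by simp
      qed
      then show "uniform_space Z \<and> p \<in> upts Z \<rightarrow> upts X \<and> uniform_map Z T (\<lambda>z. g (p z))"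
        using p U_object_uniform[OF Z(1)] by simp
    qed
    moreover have "g \<in> extensional (upts K)" by (simp add: g_def)
    moreover have "g' = g" if "g' \<in> extensional (upts K)" "\<forall>j\<in>J. \<forall>x\<in>upts (D j). g' (q j x) = r j x" for g'
    proof (rule extensionalityI[OF that(1)])
      show "g \<in> extensional (upts K)" by (simp add: g_def)
      fix y assume "y \<in> upts K"
      then have y: "pt y \<in> J" using ptJ pK by simp
      have u: "undefined \<in> upts (D (pt y))" unfolding ptD(3) by simp
      show "g' y = g y" using bspec[OF bspec[OF that(2) y] u] g[OF y u] by (simp add: ptD(2))
    qed
    ultimately show "\<exists>!g. g \<in> extensional (upts K) \<and> uniform_map K T g \<and> (\<forall>j\<in>J. \<forall>x\<in>upts (D j). g (q j x) = r j x)"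
      by (intro ex1I[of _ g] conjI ballI g) simp_all
  qed
  moreover have "\<forall>j\<in>J. \<exists>M d. connected_lc_metric M d \<and> D j = metric_uspace M d"
    using J(1) by blast
  ultimately show ?thesis
    unfolding U_object_def K_def[symmetric]
    by (intro conjI uK sep exI) assumption+
qed

end

theory Submission
  imports Defs
begin

text \<open>
  Realizations of cubical sets lift against a fibration \<open>p\<close> that is a weak equivalence: \<open>p\<close> induces
  a bijection on path components of \<open>\<U>(|C|\<^sub>\<infinity>, -)\<close>, so a map \<open>g\<close> into the base is joined by a path
  to some \<open>p \<circ> e\<close>, and lifting the path starting at \<open>e\<close> turns \<open>e\<close> into a lift of \<open>g\<close>. Lifting
  passes to retracts, and a finite dimensional complex \<open>K\<close> is a uniform retract of the realization
  of the cubical nerve of its face poset. The section is the cubical subdivision of \<open>K\<close>: rescaled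
  to have maximal coordinate \<open>1\<close>, a point lies in the cube of the interval between the set of its
  coordinates equal to \<open>1\<close> and its support. The dimension bounds the Lipschitz constants of the
  rescaling and of its inverse.
\<close>

section \<open>Chain distances and uniform maps of metric spaces\<close>

text \<open>Points of cubes are handled through their superlevel sets: \<open>thr \<theta>\<close>
  sends a point of a cube to a vertex, linear extensions of monotone maps commute with it, and the
  levels in (0, 1] determine the point. Identities between piecewise linear maps thus become
  identities between monotone maps of posets. The nerve has cells of every dimension, degenerate
  ones included, so the retraction needs a Lipschitz constant that ignores the dimension of the
  cube. Superlevel sets give one; the dimension of K enters only when the maximum norm is compared
  with the l1 and l2 norms on a simplex. Two obstacles shape the section. The category
  \<open>\<box>\<close> has no symmetries, so the cells used must take the order of their axes from
  one linear order of the vertices. And two points of a simplex may have no coordinate at which both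
  are 1 after rescaling, so a chain between their images passes through a third point. The codings
  are forced by the universe: cells and test spaces have elements of type \<open>'u\<close>, so the
  cubes of the nerve and the points of its realization are coded in \<open>'u\<close>, which is
  infinite because it contains the reals.\<close>

lemma chain_dist_le_step: "x \<in> S \<Longrightarrow> y \<in> S \<Longrightarrow> chain_dist S \<delta> x y \<le> \<delta> x y"
  unfolding chain_dist_def by (rule INF_lower2[of "[x, y]"]) auto

lemma chain_dist_refl: "x \<in> S \<Longrightarrow> chain_dist S \<delta> x x = 0"
proof -
  assume x: "x \<in> S"
  have "chain_dist S \<delta> x x \<le> 0"
    unfolding chain_dist_def by (rule INF_lower2[of "[x]"]) (use x in auto)
  then show ?thesis by simp
qed

lemma chain_dist_commute:
  assumes "\<And>x y. x \<in> S \<Longrightarrow> y \<in> S \<Longrightarrow> \<delta> x y = \<delta> y x"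
  shows "chain_dist S \<delta> x y = chain_dist S \<delta> y x"
proof -
  have "chain_dist S \<delta> y x \<le> chain_dist S \<delta> x y" for x y
    unfolding chain_dist_def[of S \<delta> x y]
  proof (rule INF_greatest)
    fix xs assume "xs \<in> {xs. xs \<noteq> [] \<and> set xs \<subseteq> S \<and> hd xs = x \<and> last xs = y}"
    then have xs: "xs \<noteq> []" "set xs \<subseteq> S" "hd xs = x" "last xs = y" by auto
    let ?n = "length xs - 1"
    have "(\<Sum>i<?n. \<delta> (rev xs ! i) (rev xs ! Suc i)) = (\<Sum>i<?n. \<delta> (xs ! i) (xs ! Suc i))"
    proof (rule sum.reindex_bij_witness[where i = "\<lambda>i. ?n - Suc i" and j = "\<lambda>i. ?n - Suc i"])
      fix i assume "i \<in> {..<?n}"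
      then have "rev xs ! i = xs ! Suc (?n - Suc i)" "rev xs ! Suc i = xs ! (?n - Suc i)"
        "xs ! Suc (?n - Suc i) \<in> S" "xs ! (?n - Suc i) \<in> S"
        using xs(2) by (auto simp: rev_nth subset_iff intro!: arg_cong[of _ _ "(!) xs"])
      then show "\<delta> (xs ! (?n - Suc i)) (xs ! Suc (?n - Suc i)) = \<delta> (rev xs ! i) (rev xs ! Suc i)"
        using assms by simp
    qed auto
    then show "chain_dist S \<delta> y x \<le> (\<Sum>i<?n. \<delta> (xs ! i) (xs ! Suc i))"
      unfolding chain_dist_def
      by (intro INF_lower2[of "rev xs"]) (use xs in \<open>auto simp: hd_rev last_rev\<close>)
  qed
  then show ?thesis by (intro antisym)
qed

text \<open>Near-optimal members exist on both sides when the infima are finite; an infinite one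
  makes the right-hand side infinite.\<close>

lemma le_INF_add_INF:
  fixes f :: "'a \<Rightarrow> ennreal"
  assumes "\<And>a b. a \<in> A \<Longrightarrow> b \<in> B \<Longrightarrow> c \<le> f a + g b"
  shows "c \<le> (INF a\<in>A. f a) + (INF b\<in>B. g b)"
proof (cases "(INF a\<in>A. f a) = top \<or> (INF b\<in>B. g b) = top")
  case False
  show ?thesis
  proof (rule ennreal_le_epsilon)
    fix e :: real assume e: "0 < e"
    have lt: "x < x + ennreal (e / 2)" if "x \<noteq> top" for x
      using that e by (simp add: ennreal_add_left_cancel_less less_top zero_less_iff_neq_zero)
    obtain a where a: "a \<in> A" "f a < (INF a\<in>A. f a) + ennreal (e / 2)"
      using lt False by (metis INF_less_iff)
    obtain b where b: "b \<in> B" "g b < (INF b\<in>B. g b) + ennreal (e / 2)"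
      using lt False by (metis INF_less_iff)
    have "c \<le> f a + g b" by (rule assms[OF a(1) b(1)])
    also have "\<dots> \<le> ((INF a\<in>A. f a) + ennreal (e / 2)) + ((INF b\<in>B. g b) + ennreal (e / 2))"
      using a b by (intro add_mono) auto
    also have "\<dots> = (INF a\<in>A. f a) + (INF b\<in>B. g b) + (ennreal (e / 2) + ennreal (e / 2))"
      by (simp add: ac_simps)
    also have "ennreal (e / 2) + ennreal (e / 2) = ennreal e" using e by (simp flip: ennreal_plus)
    finally show "c \<le> (INF a\<in>A. f a) + (INF b\<in>B. g b) + ennreal e" .
  qed
qed auto

text \<open>Concatenating two chains, with the common point y kept once, adds their costs.\<close>

lemma chain_dist_triangle: "chain_dist S \<delta> x z \<le> chain_dist S \<delta> x y + chain_dist S \<delta> y z"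
  unfolding chain_dist_def[of S \<delta> x y] chain_dist_def[of S \<delta> y z]
proof (rule le_INF_add_INF)
  let ?L = "\<lambda>x y. {xs. xs \<noteq> [] \<and> set xs \<subseteq> S \<and> hd xs = x \<and> last xs = y}"
  let ?c = "\<lambda>xs. \<Sum>i<length xs - 1. \<delta> (xs ! i) (xs ! Suc i)"
  fix xs ys assume xs: "xs \<in> ?L x y" and ys: "ys \<in> ?L y z"
  have "xs \<noteq> []" "last xs = y" using xs by auto
  then have "xs = butlast xs @ [y]" by (metis append_butlast_last_id)
  then obtain as where xse: "xs = as @ [y]" by blast
  obtain bs where yse: "ys = y # bs" using ys by (cases ys) auto
  let ?zs = "as @ y # bs"
  let ?m = "length as" let ?n = "length bs"
  have split: "(\<Sum>i<k + n. f i) = (\<Sum>i<k. f i) + (\<Sum>i<n. f (k + i))" for f :: "nat \<Rightarrow> ennreal" and k n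
    by (induction n) (simp_all add: add.assoc)
  have "?c ?zs = (\<Sum>i<?m. \<delta> (?zs ! i) (?zs ! Suc i)) + (\<Sum>i<?n. \<delta> (?zs ! (?m + i)) (?zs ! Suc (?m + i)))"
    using split by simp
  also have "(\<Sum>i<?m. \<delta> (?zs ! i) (?zs ! Suc i)) = ?c xs"
    unfolding xse by (auto intro!: sum.cong simp: nth_append nth_Cons')
  also have "(\<Sum>i<?n. \<delta> (?zs ! (?m + i)) (?zs ! Suc (?m + i))) = ?c ys"
    unfolding yse by (auto intro!: sum.cong simp: nth_append)
  finally have "?c ?zs = ?c xs + ?c ys" .
  moreover have "?zs \<in> ?L x z" using xs ys unfolding xse yse by (cases as) auto
  then have "chain_dist S \<delta> x z \<le> ?c ?zs" unfolding chain_dist_def by (rule INF_lower)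
  ultimately show "chain_dist S \<delta> x z \<le> ?c xs + ?c ys" by (simp only:)
qed

text \<open>The chain distance is the largest pseudometric below its step cost, so a Lipschitz
  estimate is a matter of single steps. For x or y outside S there is no chain, and the right-hand
  side is infinite.\<close>

lemma chain_dist_greatest:
  assumes refl: "\<And>x. x \<in> S \<Longrightarrow> \<rho> x x = 0"
    and tri: "\<And>x y z. x \<in> S \<Longrightarrow> y \<in> S \<Longrightarrow> z \<in> S \<Longrightarrow> \<rho> x z \<le> \<rho> x y + \<rho> y z"
    and step: "\<And>x y. x \<in> S \<Longrightarrow> y \<in> S \<Longrightarrow> \<rho> x y \<le> L * \<delta> x y"
    and L: "L \<noteq> 0" "L \<noteq> top"
  shows "\<rho> x y \<le> L * chain_dist S \<delta> x y"
proof -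
  have chain: "\<rho> (hd xs) (last xs) \<le> L * (\<Sum>i<length xs - 1. \<delta> (xs ! i) (xs ! Suc i))"
    if "xs \<noteq> []" "set xs \<subseteq> S" for xs
    using that
  proof (induction xs rule: induct_list012)
    case (3 a b xs)
    have "\<rho> a (last (b # xs)) \<le> \<rho> a b + \<rho> b (last (b # xs))"
      using 3 by (intro tri) auto
    also have "\<dots> \<le> L * \<delta> a b + L * (\<Sum>i<length xs. \<delta> ((b # xs) ! i) ((b # xs) ! Suc i))"
      using 3 step by (intro add_mono) auto
    also have "\<dots> = L * (\<Sum>i<Suc (length xs). \<delta> ((a # b # xs) ! i) ((a # b # xs) ! Suc i))"
      by (simp only: sum.lessThan_Suc_shift distrib_left) simp
    finally show ?case by simp
  qed (use refl in auto)
  \<comment> \<open>Dividing by L first lets the bound be checked chain by chain under the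
    infimum.\<close>
  have "\<rho> x y / L \<le> chain_dist S \<delta> x y"
    unfolding chain_dist_def
  proof (rule INF_greatest)
    fix xs assume "xs \<in> {xs. xs \<noteq> [] \<and> set xs \<subseteq> S \<and> hd xs = x \<and> last xs = y}"
    then have "\<rho> x y \<le> L * (\<Sum>i<length xs - 1. \<delta> (xs ! i) (xs ! Suc i))"
      using chain[of xs] by auto
    then show "\<rho> x y / L \<le> (\<Sum>i<length xs - 1. \<delta> (xs ! i) (xs ! Suc i))"
      using L by (simp add: divide_le_posI_ennreal zero_less_iff_neq_zero mult.commute)
  qed
  then have "L * (\<rho> x y / L) \<le> L * chain_dist S \<delta> x y" by (rule mult_left_mono) simp
  moreover have "L * (\<rho> x y / L) = \<rho> x y"
    using L by (metis ennreal_times_divide mult.commute mult_divide_eq_ennreal)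
  ultimately show ?thesis by (simp only:)
qed

lemma eventually_metric_uspace:
  "eventually E (ents (metric_uspace M d)) \<longleftrightarrow>
     (\<exists>e>0. \<forall>x\<in>M. \<forall>y\<in>M. d x y < ennreal e \<longrightarrow> E (x, y))"
proof -
  let ?F = "\<lambda>e. principal {(x, y). x \<in> M \<and> y \<in> M \<and> d x y < ennreal e}"
  have "\<exists>c\<in>{0<..}. ?F c \<le> inf (?F a) (?F b)" if "a \<in> {0<..}" "b \<in> {0<..}" for a b :: real
    using that ennreal_leI[of "min a b"] 
    by (intro bexI[of _ "min a b"]) (auto intro: order.strict_trans2)
  then have "eventually E (INF e\<in>{0<..}. ?F e) \<longleftrightarrow> (\<exists>e\<in>{0<..}. eventually E (?F e))"
    using gt_ex[of "0 :: real"] by (intro eventually_INF_base) (fast, blast)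
  moreover have "eventually E (?F e) \<longleftrightarrow> (\<forall>x\<in>M. \<forall>y\<in>M. d x y < ennreal e \<longrightarrow> E (x, y))" for e
    by (auto simp: eventually_principal)
  ultimately show ?thesis
    by (simp only: metric_uspace_def snd_conv Bex_def greaterThan_iff)
qed

lemma upts_metric_uspace [simp]: "upts (metric_uspace M d) = M"
  by (simp add: metric_uspace_def)

lemma uniform_map_metricI:
  assumes f: "f \<in> M \<rightarrow> M'" and L: "0 < L"
    and lip: "\<And>x y. x \<in> M \<Longrightarrow> y \<in> M \<Longrightarrow> d' (f x) (f y) \<le> ennreal L * d x y"
  shows "uniform_map (metric_uspace M d) (metric_uspace M' d') f"
  unfolding uniform_map_def filterlim_iff
proof (intro conjI allI impI)
  show "f \<in> upts (metric_uspace M d) \<rightarrow> upts (metric_uspace M' d')" using f by simp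
  fix P assume "eventually P (ents (metric_uspace M' d'))"
  then obtain e where e: "e > 0" "\<forall>x\<in>M'. \<forall>y\<in>M'. d' x y < ennreal e \<longrightarrow> P (x, y)"
    unfolding eventually_metric_uspace by blast
  have "d' (f x) (f y) < ennreal e" if "x \<in> M" "y \<in> M" "d x y < ennreal (e / L)" for x y
  proof -
    have "d' (f x) (f y) \<le> ennreal L * d x y" using lip that by blast
    also have "\<dots> < ennreal L * ennreal (e / L)"
      using that L by (intro ennreal_mult_strict_left_mono) auto
    also have "\<dots> = ennreal e" using L e by (simp flip: ennreal_mult)
    finally show ?thesis .
  qed
  then show "eventually (\<lambda>x. P (map_prod f f x)) (ents (metric_uspace M d))"
    unfolding eventually_metric_uspace using e f L
    by (intro exI[of _ "e / L"]) (auto simp: Pi_iff)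
qed


section \<open>Mapping spaces and lifting\<close>

lemma topspace_utopology:
  assumes "uniform_space X" shows "topspace (utopology X) = upts X"
proof
  have "eventually (\<lambda>(x', y). x' = x \<longrightarrow> y \<in> upts X) (ents X)" for x
    using ev_pts[OF assms] by eventually_elim auto
  then have "openin (utopology X) (upts X)" by (simp add: openin_utopology)
  then show "upts X \<subseteq> topspace (utopology X)" by (rule openin_subset)
  show "topspace (utopology X) \<subseteq> upts X"
    using openin_topspace[of "utopology X"] unfolding openin_utopology by blast
qed

lemma uniform_map_continuous:
  assumes X: "uniform_space X" and Y: "uniform_space Y" and f: "uniform_map X Y f"
  shows "continuous_map (utopology X) (utopology Y) f"
  unfolding continuous_map_def topspace_utopology[OF X] topspace_utopology[OF Y]
proof (intro conjI allI impI)
  show fP: "f \<in> upts X \<rightarrow> upts Y" using f by (simp add: uniform_map_def)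
  fix U assume U: "openin (utopology Y) U"
  show "openin (utopology X) {x \<in> upts X. f x \<in> U}"
    unfolding openin_utopology
  proof (intro conjI ballI)
    fix x assume x: "x \<in> {x \<in> upts X. f x \<in> U}"
    then have "eventually (\<lambda>(x', y). x' = f x \<longrightarrow> y \<in> U) (ents Y)"
      using U unfolding openin_utopology by blast
    then have "eventually (\<lambda>p. case map_prod f f p of (x', y) \<Rightarrow> x' = f x \<longrightarrow> y \<in> U) (ents X)"
      using f unfolding uniform_map_def filterlim_iff by blast
    then show "eventually (\<lambda>(x', y). x' = x \<longrightarrow> y \<in> {x \<in> upts X. f x \<in> U}) (ents X)"
      using ev_pts[OF X] by eventually_elim auto
  qed auto
qed

text \<open>The coreflection is defined by probes with points of type \<open>'u\<close>. A source W
  on any other type is reduced to its own metric probes, which do live on \<open>'u\<close>.\<close>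

lemma U_object_map_into_coreflection:
  fixes W :: "'a uspace" and X :: "'b uspace"
  assumes W: "U_object TYPE('u) W" and g: "uniform_map W X g"
  shows "uniform_map W (coreflection TYPE('u) X) g"
proof (rule U_object_uniform_mapI[OF W uniform_space_coreflection])
  show "g \<in> upts W \<rightarrow> upts (coreflection TYPE('u) X)"
    using g by (simp add: uniform_map_def coreflection_def)
  fix M :: "'u set" and d p
  assume M: "connected_lc_metric M d" "uniform_map (metric_uspace M d) W p"
  show "uniform_map (metric_uspace M d) (coreflection TYPE('u) X) (\<lambda>x. g (p x))"
    by (rule uniform_map_into_coreflection[OF U_object_metric[OF M(1)] uniform_map_comp[OF M(2) g]])
qed

section \<open>Exponentials in \<open>\<U>\<close>\<close>

lemma uniform_map_Pair:
  assumes "uniform_space X" "uniform_space Z" "z \<in> upts Z"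
  shows "uniform_map X (prod_uspace Z X) (Pair z)"
proof -
  have 1: "(\<lambda>(p, q). (fst p, fst q)) \<circ> map_prod (Pair z) (Pair z) = map_prod (\<lambda>_. z) (\<lambda>_. z)"
    and 2: "(\<lambda>(p, q). (snd p, snd q)) \<circ> map_prod (Pair z) (Pair z) = map_prod (\<lambda>x. x) (\<lambda>x. x)"
    by (auto simp: fun_eq_iff)
  have "uniform_map X Z (\<lambda>_. z)" "uniform_map X X (\<lambda>x. x)"
    using uniform_map_const[OF assms(2,3)] uniform_map_id by blast+
  then show ?thesis
    using assms(3)
    by (simp add: uniform_map_def prod_uspace_def filterlim_inf filterlim_filtercomap_iff 1 2)
qed

lemma prod_uspace_map_snd:
  assumes "uniform_map X W g"
  shows "uniform_map (prod_uspace Z X) (prod_uspace Z W) (\<lambda>(z, x). (z, g x))"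
proof -
  let ?m = "map_prod (\<lambda>(z, x). (z, g x)) (\<lambda>(z, x). (z, g x))"
  have e: "(\<lambda>(p, q). (fst p, fst q)) \<circ> ?m = (\<lambda>(p, q). (fst p, fst q))"
    "(\<lambda>(p, q). (snd p, snd q)) \<circ> ?m = (\<lambda>p. map_prod g g ((\<lambda>(p, q). (snd p, snd q)) p))"
    by (auto simp: fun_eq_iff)
  have "filterlim (\<lambda>p. map_prod g g ((\<lambda>(p :: 'c \<times> 'a, q). (snd p, snd q)) p)) (ents W) (ents (prod_uspace Z X))"
    by (rule filterlim_compose[of _ _ "ents X"])
       (use assms in \<open>auto simp: uniform_map_def prod_uspace_def filterlim_iff_le_filtercomap\<close>)
  moreover have "filterlim (\<lambda>(p :: 'c \<times> 'a, q). (fst p, fst q)) (ents Z) (ents (prod_uspace Z X))"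
    by (auto simp: prod_uspace_def filterlim_iff_le_filtercomap)
  ultimately have "filterlim ?m (ents (prod_uspace Z W)) (ents (prod_uspace Z X))"
    unfolding prod_uspace_def[of Z W] snd_conv filterlim_inf filterlim_filtercomap_iff e by blast
  then show ?thesis using assms by (auto simp: uniform_map_def prod_uspace_def)
qed

text \<open>The side condition for the final uniformity of \<open>U_exp\<close>: each slice of h is
  uniform because X, being a \<open>\<U>\<close>-object, maps along x |-> (z, x) into the
  coreflected product and not only into the plain one.\<close>

lemma U_exp_probe:
  fixes X :: "'a uspace" and Y :: "'b uspace" and Z :: "'u uspace"
  assumes X: "U_object TYPE('u) X"
    and Zk: "(Z, k) \<in> {(Z :: 'u uspace, \<lambda>z. \<lambda>x\<in>upts X. h (z, x)) | Z h.
          U_object TYPE('u) Z \<and> uniform_map (U_prod TYPE('u) Z X) Y h}"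
  shows "uniform_space Z \<and> k \<in> upts Z \<rightarrow> U_hom X Y"
proof -
  obtain h where k: "k = (\<lambda>z. \<lambda>x\<in>upts X. h (z, x))" and Z: "U_object TYPE('u) Z"
    and h: "uniform_map (U_prod TYPE('u) Z X) Y h" using Zk by auto
  note uX = U_object_uniform[OF X] and uZ = U_object_uniform[OF Z]
  have "uniform_map X Y (\<lambda>x\<in>upts X. h (z, x))" if "z \<in> upts Z" for z
  proof -
    have "uniform_map X (U_prod TYPE('u) Z X) (Pair z)"
      unfolding U_prod_def
      by (rule U_object_map_into_coreflection[OF X uniform_map_Pair[OF uX uZ that]])
    from uniform_map_comp[OF this h] show ?thesis
      using uniform_map_cong[OF uX, of "\<lambda>x. h (z, x)" "\<lambda>x\<in>upts X. h (z, x)"] by simp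
  qed
  then show ?thesis using uZ by (auto simp: k U_hom_def)
qed

lemma uniform_space_U_exp:
  "U_object TYPE('u) X \<Longrightarrow> uniform_space (U_exp TYPE('u) X Y)"
  unfolding U_exp_def by (rule uniform_space_final) (rule U_exp_probe)

lemma topspace_U_space:
  "U_object TYPE('u) X \<Longrightarrow> topspace (U_space TYPE('u) X Y) = U_hom X Y"
  using topspace_utopology[OF uniform_space_U_exp] by (simp add: U_space_def U_exp_def)

lemma U_hom_precomp:
  assumes "uniform_space A" "uniform_map A B f" "k \<in> U_hom B Y"
  shows "(\<lambda>x\<in>upts A. k (f x)) \<in> U_hom A Y"
  using uniform_map_comp[OF assms(2), of Y k] assms(3)
    uniform_map_cong[OF assms(1), of "\<lambda>x. k (f x)" "\<lambda>x\<in>upts A. k (f x)" Y]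
  by (simp add: U_hom_def)

text \<open>By the final uniformity it suffices to test on transposes of maps h out of Z x B;
  precomposing such a transpose with f gives the transpose of h o (Z x f).\<close>

lemma U_space_precomp:
  fixes A :: "'a uspace" and B :: "'b uspace"
  assumes A: "U_object TYPE('u) A" and B: "U_object TYPE('u) B" and f: "uniform_map A B f"
  shows "continuous_map (U_space TYPE('u) B Y) (U_space TYPE('u) A Y) (\<lambda>k. \<lambda>x\<in>upts A. k (f x))"
  unfolding U_space_def
proof (rule uniform_map_continuous[OF uniform_space_U_exp[OF B] uniform_space_U_exp[OF A]])
  have uA: "uniform_space A" by (rule U_object_uniform[OF A])
  have fP: "f \<in> upts A \<rightarrow> upts B" using f by (simp add: uniform_map_def)
  show "uniform_map (U_exp TYPE('u) B Y) (U_exp TYPE('u) A Y) (\<lambda>k. \<lambda>x\<in>upts A. k (f x))"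
    unfolding U_exp_def[of _ B]
  proof (rule uniform_map_from_final[OF uniform_space_U_exp[OF A]])
    show "(\<lambda>k. \<lambda>x\<in>upts A. k (f x)) \<in> U_hom B Y \<rightarrow> upts (U_exp TYPE('u) A Y)"
      using U_hom_precomp[OF uA f, of _ Y] unfolding U_exp_def upts_final by blast
    fix Z :: "'u uspace" and k
    assume Zk: "(Z, k) \<in> {(Z :: 'u uspace, \<lambda>z. \<lambda>x\<in>upts B. h (z, x)) | Z h.
          U_object TYPE('u) Z \<and> uniform_map (U_prod TYPE('u) Z B) Y h}"
    then obtain h where k: "k = (\<lambda>z. \<lambda>x\<in>upts B. h (z, x))" and Z: "U_object TYPE('u) Z"
      and h: "uniform_map (U_prod TYPE('u) Z B) Y h" by auto
    have "uniform_map (U_prod TYPE('u) Z A) (U_prod TYPE('u) Z B) (\<lambda>(z, x). (z, f x))"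
      unfolding U_prod_def by (rule coreflection_map[OF prod_uspace_map_snd[OF f]])
    then have h': "uniform_map (U_prod TYPE('u) Z A) Y (\<lambda>p. h ((\<lambda>(z, x). (z, f x)) p))"
      using h by (rule uniform_map_comp)
    let ?h = "\<lambda>p. h ((\<lambda>(z, x). (z, f x)) p)"
    have mem: "(Z, \<lambda>z. \<lambda>x\<in>upts A. ?h (z, x)) \<in> {(Z :: 'u uspace, \<lambda>z. \<lambda>x\<in>upts A. h (z, x)) | Z h.
          U_object TYPE('u) Z \<and> uniform_map (U_prod TYPE('u) Z A) Y h}"
      unfolding mem_Collect_eq by (rule exI[of _ Z], rule exI[of _ ?h]) (use Z h' in simp)
    have "uniform_map Z (U_exp TYPE('u) A Y) (\<lambda>z. \<lambda>x\<in>upts A. ?h (z, x))"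
      unfolding U_exp_def by (rule uniform_map_into_final[OF U_exp_probe[OF A] mem])
    also have "(\<lambda>z. \<lambda>x\<in>upts A. ?h (z, x)) = (\<lambda>z. \<lambda>x\<in>upts A. k z (f x))"
      using fP by (auto simp: k fun_eq_iff)
    finally show "uniform_space Z \<and> k \<in> upts Z \<rightarrow> U_hom B Y \<and>
        uniform_map Z (U_exp TYPE('u) A Y) (\<lambda>z. \<lambda>x\<in>upts A. k z (f x))"
      using U_exp_probe[OF B Zk] by blast
  qed
qed

section \<open>Mapping spaces and classical weak equivalences\<close>

lemma openin_mapping_space:
  "openin (mapping_space X Y) U \<longleftrightarrow> U \<subseteq> mapping_set X Y \<and>
     (\<forall>(K :: real topology) h.
        compact_space K \<and> Hausdorff_space K \<and> locally_connected_space K \<and> second_countable K \<and>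
        continuous_map (prod_topology K X) Y h \<longrightarrow>
        openin K {k \<in> topspace K. (\<lambda>x\<in>topspace X. h (k, x)) \<in> U})"
  unfolding mapping_space_def topology_inverse'[OF istopology_mapping_space] ..

lemma continuous_map_slice:
  assumes "continuous_map (prod_topology K X) Y h" "k \<in> topspace K"
  shows "continuous_map X Y (\<lambda>x\<in>topspace X. h (k, x))"
proof -
  have "continuous_map X (prod_topology K X) (\<lambda>x. (k, x))"
    using assms(2) by (intro continuous_map_pairedI) auto
  from continuous_map_compose[OF this assms(1)] show ?thesis
    by (rule continuous_map_eq) simp
qed

lemma topspace_mapping_space: "topspace (mapping_space X Y) = mapping_set X Y"
proof
  show "topspace (mapping_space X Y) \<subseteq> mapping_set X Y"
    using openin_topspace[of "mapping_space X Y"] unfolding openin_mapping_space by blast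
  have "(\<lambda>x\<in>topspace X. h (k, x)) \<in> mapping_set X Y"
    if "continuous_map (prod_topology K X) Y h" "k \<in> topspace K" for K :: "real topology" and h k
    using continuous_map_slice[OF that] by (simp add: mapping_set_def)
  then have "{k \<in> topspace K. (\<lambda>x\<in>topspace X. h (k, x)) \<in> mapping_set X Y} = topspace K"
    if "continuous_map (prod_topology K X) Y h" for K :: "real topology" and h
    using that by blast
  then have "openin (mapping_space X Y) (mapping_set X Y)"
    unfolding openin_mapping_space by simp
  then show "mapping_set X Y \<subseteq> topspace (mapping_space X Y)" by (rule openin_subset)
qed

text \<open>The topology is final for transposes of maps h : K x X -> Y, and evaluation at x
  composed with such a transpose is the continuous map k |-> h (k, x).\<close>

lemma continuous_map_eval:
  assumes x: "x \<in> topspace X"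
  shows "continuous_map (mapping_space X Y) Y (\<lambda>f. f x)"
  unfolding continuous_map_def topspace_mapping_space
proof (intro conjI allI impI)
  show "(\<lambda>f. f x) \<in> mapping_set X Y \<rightarrow> topspace Y"
    using x by (auto simp: mapping_set_def continuous_map_def)
  fix U assume U: "openin Y U"
  show "openin (mapping_space X Y) {f \<in> mapping_set X Y. f x \<in> U}"
    unfolding openin_mapping_space
  proof (intro conjI allI impI)
    fix K :: "real topology" and h
    assume K: "compact_space K \<and> Hausdorff_space K \<and> locally_connected_space K \<and> second_countable K \<and>
      continuous_map (prod_topology K X) Y h"
    have "continuous_map K (prod_topology K X) (\<lambda>k. (k, x))"
      using x by (intro continuous_map_pairedI) auto
    then have "continuous_map K Y (h \<circ> (\<lambda>k. (k, x)))" using K continuous_map_compose by blast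
    then have "openin K {k \<in> topspace K. (h \<circ> (\<lambda>k. (k, x))) k \<in> U}"
      using U openin_continuous_map_preimage by blast
    moreover have "(\<lambda>x\<in>topspace X. h (k, x)) \<in> mapping_set X Y" if "k \<in> topspace K" for k
      using continuous_map_slice[of K X Y h, OF _ that] K by (simp add: mapping_set_def)
    then have "{k \<in> topspace K. (\<lambda>x\<in>topspace X. h (k, x)) \<in> {f \<in> mapping_set X Y. f x \<in> U}} =
        {k \<in> topspace K. (h \<circ> (\<lambda>k. (k, x))) k \<in> U}"
      using x by auto
    ultimately show "openin K {k \<in> topspace K. (\<lambda>x\<in>topspace X. h (k, x)) \<in> {f \<in> mapping_set X Y. f x \<in> U}}"
      by simp
  qed auto
qed

lemma ents_metric_uspace_le: "ents (metric_uspace M d) \<le> principal (M \<times> M)"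
proof -
  have "ents (metric_uspace M d) \<le> principal {(x, y). x \<in> M \<and> y \<in> M \<and> d x y < ennreal 1}"
    unfolding metric_uspace_def snd_conv by (rule INF_lower) simp
  also have "\<dots> \<le> principal (M \<times> M)" by auto
  finally show ?thesis .
qed

lemma topspace_top_realization: "topspace (top_realization C) = cell_pts C // glue_equiv C"
proof
  let ?T = "\<lambda>n. utopology (metric_uspace (cube_pts n) max_dist)"
  let ?p = "\<lambda>n c U. {t \<in> cube_pts n. glue_equiv C `` {(n, c, t)} \<in> U}"
  note op = topology_inverse'[OF istopology_top_realization[of C], folded top_realization_def]
  show "topspace (top_realization C) \<subseteq> cell_pts C // glue_equiv C"
    using openin_topspace[of "top_realization C"] unfolding op by blast
  have "eventually (\<lambda>(x', y). x' = x \<longrightarrow> y \<in> cube_pts n) (ents (metric_uspace (cube_pts n) max_dist))" for x n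
    by (rule filter_leD[OF ents_metric_uspace_le]) (auto simp: eventually_principal)
  then have "openin (?T n) (cube_pts n)" for n
    unfolding openin_utopology by (simp add: metric_uspace_def)
  moreover have "?p n c (cell_pts C // glue_equiv C) = cube_pts n" if "c \<in> cells C n" for n c
    using that by (auto simp: cell_pts_def intro!: quotientI)
  ultimately have "openin (top_realization C) (cell_pts C // glue_equiv C)" unfolding op by simp
  then show "cell_pts C // glue_equiv C \<subseteq> topspace (top_realization C)" by (rule openin_subset)
qed

text \<open>The test object is the terminal cubical set. The bijection on path components joins the
  constant map at y to f o e for some e, and evaluation at a point q of the realization turns this
  path of maps into a path in B between f (e q) and y.\<close>

lemma classical_weak_equivalence_path:
  assumes f: "classical_weak_equivalence TYPE('u) A B f" and y: "y \<in> topspace B"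
  shows "\<exists>a\<in>topspace A. path_component_of B (f a) y"
proof -
  define C :: "'u cubical" where "C = \<lparr>cells = \<lambda>_. {undefined}, act = \<lambda>_ _ _ _. undefined\<rparr>"
  let ?T = "top_realization C"
  have C: "cubical_set C" by (simp add: cubical_set_def C_def)
  have "(0, undefined, []) \<in> cell_pts C" by (simp add: cell_pts_def C_def cube_pts_def)
  then obtain q where q: "q \<in> topspace ?T" unfolding topspace_top_realization using quotientI by metis
  let ?MA = "mapping_space ?T A" and ?MB = "mapping_space ?T B"
  define F where "F = postcomp (topspace ?T) f"
  have bij: "bij_betw (pi0_map ?MB F) (path_components_of ?MA) (path_components_of ?MB)"
    using f C unfolding classical_weak_equivalence_def F_def by blast
  define k where "k = (\<lambda>_\<in>topspace ?T. y)"
  have "continuous_map ?T B k"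
    by (rule continuous_map_eq[of _ _ "\<lambda>_. y"]) (use y in \<open>simp_all add: k_def\<close>)
  then have k: "k \<in> topspace ?MB" by (simp add: topspace_mapping_space mapping_set_def k_def)
  then have "path_component_of_set ?MB k \<in> path_components_of ?MB"
    by (simp add: path_components_of_def)
  then obtain P where P: "P \<in> path_components_of ?MA" "pi0_map ?MB F P = path_component_of_set ?MB k"
    using bij unfolding bij_betw_def by (metis (no_types, lifting) imageE)
  \<comment> \<open>The representative at which \<open>pi0_map\<close> evaluates; it need not be e0,
    but it lies in the same component.\<close>
  define e where "e = (SOME x. x \<in> P)"
  obtain e0 where e0: "e0 \<in> topspace ?MA" "P = path_component_of_set ?MA e0"
    using P(1) by (auto simp: path_components_of_def)
  have "e0 \<in> P" using e0 by (simp add: path_component_of_refl)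
  then have "e \<in> P" unfolding e_def by (rule someI[of "\<lambda>x. x \<in> P"])
  then have e: "e \<in> mapping_set ?T A"
    using e0 path_component_of_equiv path_component_in_topspace topspace_mapping_space by (metis mem_Collect_eq)
  have "k \<in> path_component_of_set ?MB (F e)"
    using P(2) k by (simp add: pi0_map_def e_def path_component_of_refl)
  then obtain \<gamma> where \<gamma>: "pathin ?MB \<gamma>" "\<gamma> 0 = F e" "\<gamma> 1 = k" by (auto simp: path_component_of_def)
  have "pathin B ((\<lambda>f. f q) \<circ> \<gamma>)" by (rule pathin_compose[OF \<gamma>(1) continuous_map_eval[OF q]])
  moreover have "((\<lambda>f. f q) \<circ> \<gamma>) 0 = f (e q)" using \<gamma>(2) q by (simp add: F_def postcomp_def)
  moreover have "((\<lambda>f. f q) \<circ> \<gamma>) 1 = y" using \<gamma>(3) q by (simp add: k_def)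
  ultimately have "path_component_of B (f (e q)) y" unfolding path_component_of_def by blast
  moreover have "e q \<in> topspace A" using e q by (auto simp: mapping_set_def continuous_map_def)
  ultimately show ?thesis by blast
qed

section \<open>Lifting along fibrations that are weak equivalences\<close>

text \<open>The test spaces \<open>Z\<close> in the definition of fibrations have points of type \<open>'u\<close>, so \<open>R\<close> has to
  be replaced by an isomorphic space.\<close>

lemma hurewicz_fibration_lift:
  fixes R :: "'a uspace" and Z E Y :: "'u uspace"
  assumes p: "uniform_hurewicz_fibration TYPE('u) E Y p"
    and R: "U_object TYPE('u) R" and Z: "U_object TYPE('u) Z"
    and i: "uniform_map R Z i" and j: "uniform_map Z R j" and ji: "\<And>x. x \<in> upts R \<Longrightarrow> j (i x) = x"
    and e: "e \<in> U_hom R E"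
    and path: "path_component_of (U_space TYPE('u) R Y) (postcomp (upts R) p e) g"
  shows "\<exists>l\<in>U_hom R E. \<forall>x\<in>upts R. p (l x) = g x"
proof -
  note uR = U_object_uniform[OF R] and uZ = U_object_uniform[OF Z]
  have iP: "i \<in> upts R \<rightarrow> upts Z" and jP: "j \<in> upts Z \<rightarrow> upts R"
    using i j by (simp_all add: uniform_map_def)
  obtain \<gamma> where \<gamma>: "pathin (U_space TYPE('u) R Y) \<gamma>" "\<gamma> 0 = postcomp (upts R) p e" "\<gamma> 1 = g"
    using path by (auto simp: path_component_of_def)
  define \<gamma>' where "\<gamma>' = (\<lambda>k. \<lambda>z\<in>upts Z. k (j z)) \<circ> \<gamma>"
  define e' where "e' = (\<lambda>z\<in>upts Z. e (j z))"
  have "pathin (U_space TYPE('u) Z Y) \<gamma>'"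
    unfolding \<gamma>'_def by (rule pathin_compose[OF \<gamma>(1) U_space_precomp[OF Z R j]])
  moreover have "e' \<in> topspace (U_space TYPE('u) Z E)"
    unfolding topspace_U_space[OF Z] e'_def by (rule U_hom_precomp[OF uZ j e])
  moreover have "postcomp (upts Z) p e' = \<gamma>' 0"
    using jP by (auto simp: \<gamma>'_def \<gamma>(2) postcomp_def e'_def fun_eq_iff)
  ultimately obtain \<eta> where \<eta>: "pathin (U_space TYPE('u) Z E) \<eta>"
    "\<forall>t\<in>{0..1}. postcomp (upts Z) p (\<eta> t) = \<gamma>' t"
    using p Z unfolding uniform_hurewicz_fibration_def by blast
  \<comment> \<open>The lifted path ends over g o j, since \<gamma> ends at g; precomposition with i
    then gives a lift of g.\<close>
  have "\<eta> 1 \<in> U_hom Z E"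
    using \<eta>(1) unfolding pathin_def continuous_map_def topspace_U_space[OF Z] by auto
  then have "(\<lambda>x\<in>upts R. \<eta> 1 (i x)) \<in> U_hom R E" by (rule U_hom_precomp[OF uR i])
  moreover have "p (\<eta> 1 (i x)) = g x" if "x \<in> upts R" for x
  proof -
    have "i x \<in> upts Z" using iP that by blast
    moreover have "postcomp (upts Z) p (\<eta> 1) (i x) = \<gamma>' 1 (i x)" using \<eta>(2) by simp
    ultimately show ?thesis using ji[OF that] by (simp add: postcomp_def \<gamma>'_def \<gamma>(3))
  qed
  ultimately show ?thesis by (intro bexI[of _ "\<lambda>x\<in>upts R. \<eta> 1 (i x)"]) auto
qed

lemma U_object_coreflection_metric:
  "emetric_on M d \<Longrightarrow> U_object TYPE('u) (coreflection TYPE('u) (metric_uspace M d))"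
  by (rule U_object_coreflection[OF metric_uspace_uniform metric_uspace_separated])

lemma uniform_realization_lift:
  fixes C :: "'u cubical" and E Y :: "'u uspace"
  assumes C: "cubical_set C"
    and em: "emetric_on (metric_realization_pts C) (metric_realization_dist C)"
    and i: "inj_on (i :: _ \<Rightarrow> 'u) (metric_realization_pts C)"
    and w: "uniform_weak_equivalence TYPE('u) E Y p" and p: "uniform_hurewicz_fibration TYPE('u) E Y p"
    and g: "uniform_map (uniform_realization TYPE('u) C) Y g"
  shows "\<exists>l. uniform_map (uniform_realization TYPE('u) C) E l \<and>
    (\<forall>x\<in>upts (uniform_realization TYPE('u) C). p (l x) = g x)"
proof -
  let ?M = "metric_realization_pts C" and ?d = "metric_realization_dist C"
  let ?R = "uniform_realization TYPE('u) C"
  define j where "j = inv_into ?M i"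
  have ji: "j (i x) = x" if "x \<in> ?M" for x using i that by (simp add: j_def)
  let ?d' = "\<lambda>x y. ?d (j x) (j y)"
  \<comment> \<open>A copy of the realization with points of type \<open>'u\<close>, isometric
    before coreflection, on which the fibration property can be tested.\<close>
  define Z where "Z = coreflection TYPE('u) (metric_uspace (i ` ?M) ?d')"
  have em': "emetric_on (i ` ?M) ?d'"
    using em ji unfolding emetric_on_def by (auto simp: inj_on_eq_iff[OF i])
  have R: "U_object TYPE('u) ?R" unfolding uniform_realization_def by (rule U_object_coreflection_metric[OF em])
  have Z: "U_object TYPE('u) Z" unfolding Z_def by (rule U_object_coreflection_metric[OF em'])
  have uR: "uniform_space ?R" by (rule U_object_uniform[OF R])
  have upR: "upts ?R = ?M" by (simp add: uniform_realization_def coreflection_def metric_uspace_def)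
  have "uniform_map ?R Z i"
    unfolding uniform_realization_def Z_def
    by (intro coreflection_map uniform_map_metricI[of _ _ _ 1]) (simp_all add: ji)
  moreover have "uniform_map Z ?R j"
    unfolding uniform_realization_def Z_def
    by (intro coreflection_map uniform_map_metricI[of _ _ _ 1]) (auto simp: ji)
  moreover have g': "restrict g (upts ?R) \<in> topspace (U_space TYPE('u) ?R Y)"
    using uniform_map_cong[OF uR, of g "restrict g (upts ?R)" Y] g
    by (simp add: topspace_U_space[OF R] U_hom_def)
  moreover have "classical_weak_equivalence TYPE('u) (U_space TYPE('u) ?R E) (U_space TYPE('u) ?R Y)
      (postcomp (upts ?R) p)"
    using w C unfolding uniform_weak_equivalence_def by blast
  from classical_weak_equivalence_path[OF this g'] obtain e where "e \<in> U_hom ?R E"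
    "path_component_of (U_space TYPE('u) ?R Y) (postcomp (upts ?R) p e) (restrict g (upts ?R))"
    unfolding topspace_U_space[OF R] by blast
  ultimately obtain l where "l \<in> U_hom ?R E" "\<forall>x\<in>upts ?R. p (l x) = restrict g (upts ?R) x"
    using hurewicz_fibration_lift[OF p R Z] ji upR by metis
  then show ?thesis by (intro exI[of _ l]) (auto simp: U_hom_def)
qed


section \<open>Linear extensions of maps of cubes\<close>

text \<open>Thresholds turn \<open>linear_ext\<close> into composition.\<close>

definition thr :: "real \<Rightarrow> real list \<Rightarrow> bool list" where
  "thr \<theta> t = map (\<lambda>x. \<theta> \<le> x) t"

lemma thr_in_cube_verts: "t \<in> cube_pts n \<Longrightarrow> thr \<theta> t \<in> cube_verts n"
  by (simp add: thr_def cube_pts_def cube_verts_def)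

text \<open>A nonzero coordinate is itself an admissible level, and it is the largest one at which
  its entry is true.\<close>

lemma thr_inject:
  assumes "t \<in> cube_pts n" "u \<in> cube_pts n" "\<And>\<theta>. 0 < \<theta> \<Longrightarrow> \<theta> \<le> 1 \<Longrightarrow> thr \<theta> t = thr \<theta> u"
  shows "t = u"
proof (rule nth_equalityI)
  show len: "length t = length u" using assms by (simp add: cube_pts_def)
  fix i assume i: "i < length t"
  have iff: "\<theta> \<le> t ! i \<longleftrightarrow> \<theta> \<le> u ! i" if "0 < \<theta>" "\<theta> \<le> 1" for \<theta>
    using arg_cong[OF assms(3)[OF that], of "\<lambda>v. v ! i"] i len by (simp add: thr_def)
  have "t ! i \<in> {0..1}" "u ! i \<in> {0..1}"
    using assms(1,2) i len by (auto simp: cube_pts_def subset_iff all_set_conv_all_nth)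
  then show "t ! i = u ! i"
    using iff[of "t ! i"] iff[of "u ! i"] by (cases "t ! i = 0"; cases "u ! i = 0") auto
qed

definition mono_vertex_map :: "nat \<Rightarrow> (bool list \<Rightarrow> bool list) \<Rightarrow> bool" where
  "mono_vertex_map m \<phi> \<longleftrightarrow>
     (\<forall>v\<in>cube_verts m. \<forall>w\<in>cube_verts m. list_all2 (\<le>) v w \<longrightarrow> list_all2 (\<le>) (\<phi> v) (\<phi> w))"

lemma cube_mor_cube_verts: "cube_mor m n \<phi> \<Longrightarrow> v \<in> cube_verts m \<Longrightarrow> \<phi> v \<in> cube_verts n"
proof (induction arbitrary: v rule: cube_mor.induct)
  case (tensor m n \<phi> m' n' \<psi>)
  have "\<phi> (take m v) \<in> cube_verts n" "\<psi> (drop m v) \<in> cube_verts n'"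
    using tensor by (auto simp: cube_verts_def)
  then show ?case using tensor.prems by (simp add: cube_verts_def)
qed (auto simp: cube_verts_def compose_def)

lemma cube_mor_mono: "cube_mor m n \<phi> \<Longrightarrow> mono_vertex_map m \<phi>"
proof (induction rule: cube_mor.induct)
  case join
  show ?case
    unfolding mono_vertex_map_def cube_verts_def
    by (auto simp: list_all2_conv_all_nth)
next
  case (comp l m \<phi> n \<psi>)
  then show ?case
    using cube_mor_cube_verts[of l m \<phi>] by (simp add: mono_vertex_map_def compose_def)
next
  case (tensor m n \<phi> m' n' \<psi>)
  show ?case
    unfolding mono_vertex_map_def
  proof (intro ballI impI)
    fix v w assume vw: "v \<in> cube_verts (m + m')" "w \<in> cube_verts (m + m')" "list_all2 (\<le>) v w"
    then have "list_all2 (\<le>) (\<phi> (take m v)) (\<phi> (take m w))"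
      "list_all2 (\<le>) (\<psi> (drop m v)) (\<psi> (drop m w))"
      using tensor.IH by (auto simp: mono_vertex_map_def cube_verts_def intro: list_all2_takeI list_all2_dropI)
    then show "list_all2 (\<le>) ((\<lambda>v\<in>cube_verts (m + m'). \<phi> (take m v) @ \<psi> (drop m v)) v)
        ((\<lambda>v\<in>cube_verts (m + m'). \<phi> (take m v) @ \<psi> (drop m v)) w)"
      using vw by (simp add: list_all2_appendI)
  qed
qed (auto simp: mono_vertex_map_def list_all2_conv_all_nth cube_verts_def)

text \<open>Peel off the support of \<open>t\<close>, weighted by the smallest nonzero coordinate.\<close>

lemma vertex_comb_exists:
  assumes "length t = m" "\<forall>x\<in>set t. 0 \<le> x \<and> x \<le> c" "0 \<le> c"
  shows "\<exists>S a. vertex_chain m S \<and> (\<forall>v\<in>S. 0 \<le> a v) \<and> sum a S = c \<and> t = vertex_comb m S a (\<lambda>v. v) \<and>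
    (\<forall>v\<in>S. list_all2 (\<le>) v (map (\<lambda>x. 0 < x) t))"
  using assms
proof (induction "card {i. i < m \<and> 0 < t ! i}" arbitrary: t c rule: less_induct)
  case less
  let ?I = "\<lambda>t. {i. i < m \<and> 0 < t ! i}"
  have nn: "0 \<le> t ! i" "t ! i \<le> c" if "i < m" for i using that less.prems by auto
  show ?case
  proof (cases "?I t = {}")
    case True
    \<comment> \<open>The origin takes all the remaining weight: it counts in the sum but adds
      nothing to the coordinates.\<close>
    let ?z = "replicate m False"
    have t: "t = replicate m 0"
      by (rule nth_equalityI) (use less.prems(1) nn(1) True in \<open>force+\<close>)
    show ?thesis
      by (intro exI[of _ "{?z}"] exI[of _ "\<lambda>_. c"])
        (use less.prems in \<open>auto simp: t vertex_chain_def cube_verts_def vertex_comb_def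
           list_all2_conv_all_nth intro!: nth_equalityI\<close>)
  next
    case False
    define x where "x = Min ((!) t ` ?I t)"
    define w where "w = map (\<lambda>x. 0 < x) t"
    define t' where "t' = map (\<lambda>y. if 0 < y then y - x else 0) t"
    have fin: "finite (?I t)" by simp
    have "x \<in> (!) t ` ?I t" unfolding x_def using False by (intro Min_in) auto
    then obtain j where j: "j < m" "0 < t ! j" "x = t ! j" by blast
    have xle: "x \<le> t ! i" if "i \<in> ?I t" for i unfolding x_def using that by (intro Min_le) auto
    have lt: "length t' = m" by (simp add: t'_def less.prems)
    have t'nth: "t' ! i = (if 0 < t ! i then t ! i - x else 0)" if "i < m" for i
      using that less.prems by (simp add: t'_def)
    have sub: "?I t' \<subseteq> ?I t" using t'nth j by (auto split: if_splits)
    have "t' ! j = 0" using t'nth[OF j(1)] j(3) by simp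
    then have "j \<in> ?I t" "j \<notin> ?I t'" using j by simp_all
    then have "?I t' \<noteq> ?I t" by (metis (no_types, lifting))
    then have "card (?I t') < card (?I t)" using sub by (intro psubset_card_mono) auto
    moreover have "\<forall>y\<in>set t'. 0 \<le> y \<and> y \<le> c - x"
      unfolding all_set_conv_all_nth lt using t'nth xle nn j by auto
    moreover have "0 \<le> c - x" using nn j by simp
    ultimately obtain S a where Sa: "vertex_chain m S" "\<forall>v\<in>S. 0 \<le> a v" "sum a S = c - x"
      "t' = vertex_comb m S a (\<lambda>v. v)" "\<forall>v\<in>S. list_all2 (\<le>) v (map (\<lambda>x. 0 < x) t')"
      using less.hyps[of t' "c - x"] lt by blast
    \<comment> \<open>The vertices used for t' lie below the support w of t and vanish at j, where w
      does not; so w is new and sits on top of the chain.\<close>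
    have le: "list_all2 (\<le>) v w \<and> \<not> v ! j" if "v \<in> S" for v
    proof -
      have l: "list_all2 (\<le>) v (map (\<lambda>x. 0 < x) t')" using Sa(5) that by blast
      then have "length v = m" using lt by (auto dest: list_all2_lengthD)
      then have v: "0 < t' ! i" if "i < m" "v ! i" for i
        using l that lt by (auto simp: list_all2_conv_all_nth)
      have "0 < t ! i" if "i < m" "v ! i" for i
        using v[OF that] t'nth[OF that(1)] by (simp split: if_splits)
      then show ?thesis using \<open>length v = m\<close> less.prems(1) v[OF j(1)] \<open>t' ! j = 0\<close>
        by (auto simp: list_all2_conv_all_nth w_def)
    qed
    have wj: "w ! j" using j less.prems(1) by (simp add: w_def)
    have wS: "w \<notin> S" using le wj by blast
    have "S \<subseteq> cube_verts m" using Sa(1) by (simp add: vertex_chain_def)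
    moreover have "finite (cube_verts m)"
      unfolding cube_verts_def using finite_lists_length_eq[of "UNIV :: bool set" m] by simp
    ultimately have finS: "finite S" by (rule finite_subset)
    define a' where "a' = a(w := x)"
    have sumS: "(\<Sum>v\<in>insert w S. a' v * f v) = x * f w + (\<Sum>v\<in>S. a v * f v)" for f :: "bool list \<Rightarrow> real"
      using finS wS by (auto simp: a'_def intro!: sum.cong)
    have "w \<in> cube_verts m" "list_all2 (\<le>) w w"
      by (simp_all add: w_def cube_verts_def less.prems list_all2_refl)
    then have "vertex_chain m (insert w S)"
      using Sa(1) le unfolding vertex_chain_def by blast
    moreover have "\<forall>v\<in>insert w S. 0 \<le> a' v" using Sa(2) j by (auto simp: a'_def)
    moreover have "sum a' (insert w S) = c" using sumS[of "\<lambda>_. 1"] Sa(3) by simp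
    moreover have "t = vertex_comb m (insert w S) a' (\<lambda>v. v)"
    proof (rule nth_equalityI)
      fix i assume "i < length t"
      then have i: "i < m" using less.prems by simp
      have "(\<Sum>v\<in>S. a v * of_bool (v ! i)) = t' ! i" using i by (subst Sa(4)) (simp add: vertex_comb_def)
      moreover have "w ! i \<longleftrightarrow> 0 < t ! i" using i less.prems(1) by (simp add: w_def)
      ultimately show "t ! i = vertex_comb m (insert w S) a' (\<lambda>v. v) ! i"
        using i t'nth[OF i] nn(1)[OF i] by (auto simp: vertex_comb_def sumS)
    qed (simp add: vertex_comb_def less.prems)
    moreover have "list_all2 (\<le>) v w" if "v \<in> insert w S" for v
      using that le by (auto simp: list_all2_conv_all_nth)
    ultimately show ?thesis unfolding w_def[symmetric] by blast
  qed
qed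

text \<open>The vertex w is chosen before \<phi>, which later allows \<phi> to be compared with the
  identity. A coordinate of the combination is the mass of the vertices v with \<phi> v true there,
  an upper segment of the chain as \<phi> is monotone. Such a segment has mass at least \<theta>
  exactly if it contains w, the largest vertex with mass at least \<theta> above it.\<close>

lemma thr_vertex_comb:
  assumes S: "vertex_chain m S" "\<forall>v\<in>S. 0 \<le> a v" "sum a S = 1" and \<theta>: "0 < \<theta>" "\<theta> \<le> 1"
  shows "\<exists>w\<in>S. \<forall>n \<phi>. (\<forall>v\<in>cube_verts m. \<phi> v \<in> cube_verts n) \<and> mono_vertex_map m \<phi> \<longrightarrow>
    thr \<theta> (vertex_comb n S a \<phi>) = \<phi> w"
proof -
  define le where "le = (\<lambda>v w :: bool list. list_all2 (\<le>) v w)"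
  have Sm: "S \<subseteq> cube_verts m" using S(1) by (simp add: vertex_chain_def)
  have tot: "le v w \<or> le w v" if "v \<in> S" "w \<in> S" for v w
    using S(1) that unfolding vertex_chain_def le_def by blast
  have fin: "finite S"
    using finite_lists_length_eq[of "UNIV :: bool set" m] Sm
    by (auto simp: cube_verts_def intro: finite_subset)
  define up where "up = (\<lambda>v. {w \<in> S. le v w})"
  have trans: "le u w" if "le u v" "le v w" for u v w
    using that unfolding le_def by (rule list_all2_trans[rotated]) auto
  have refl: "le v v" for v by (simp add: le_def list_all2_refl)
  have up_sub: "up w \<subseteq> up v" if "le v w" for v w using that trans by (auto simp: up_def)
  have min: "\<exists>v\<in>T. T \<subseteq> up v" if "T \<subseteq> S" "T \<noteq> {}" for T
    using finite_subset[OF that(1) fin] that(2,1)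
  proof (induction rule: finite_ne_induct)
    case (singleton x) then show ?case using refl by (auto simp: up_def)
  next
    case (insert x F)
    then obtain v where v: "v \<in> F" "F \<subseteq> up v" by blast
    show ?case
    proof (cases "le v x")
      case True then show ?thesis using v insert.prems by (auto simp: up_def)
    next
      case False
      then have "le x v" using tot insert.prems v by blast
      then show ?thesis using v insert.prems up_sub refl by (auto simp: up_def)
    qed
  qed
  have max: "\<exists>w\<in>T. \<forall>v\<in>T. le v w" if "T \<subseteq> S" "T \<noteq> {}" for T
    using finite_subset[OF that(1) fin] that(2,1)
  proof (induction rule: finite_ne_induct)
    case (singleton x) then show ?case using refl by blast
  next
    case (insert x F)
    then obtain v where v: "v \<in> F" "\<forall>u\<in>F. le u v" by blast
    then have "le v x \<or> le x v" using tot insert.prems by blast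
    then show ?case using v refl trans by blast
  qed
  \<comment> \<open>The mass above v decreases along the chain, so T is a lower segment; it is
    nonempty because all the mass lies above the least vertex.\<close>
  define T where "T = {v \<in> S. \<theta> \<le> sum a (up v)}"
  have "S \<noteq> {}" using S(3) by auto
  then obtain v where v: "v \<in> S" "S \<subseteq> up v" using min[of S] by blast
  then have "up v = S" by (auto simp: up_def)
  then have "T \<noteq> {}" using v S(3) \<theta> by (auto simp: T_def)
  then obtain w where w: "w \<in> T" "\<forall>v\<in>T. le v w" using max[of T] by (auto simp: T_def)
  have "thr \<theta> (vertex_comb n S a \<phi>) = \<phi> w"
    if \<phi>: "\<forall>v\<in>cube_verts m. \<phi> v \<in> cube_verts n" "mono_vertex_map m \<phi>" for n \<phi>
  proof (rule nth_equalityI)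
    have wS: "w \<in> S" using w by (simp add: T_def)
    then have lw: "length (\<phi> w) = n" using \<phi>(1) Sm by (auto simp: cube_verts_def)
    then show "length (thr \<theta> (vertex_comb n S a \<phi>)) = length (\<phi> w)" by (simp add: thr_def vertex_comb_def)
    fix i assume "i < length (thr \<theta> (vertex_comb n S a \<phi>))"
    then have i: "i < n" by (simp add: thr_def vertex_comb_def)
    define U where "U = {v \<in> S. \<phi> v ! i}"
    have upU: "v' \<in> U" if "v \<in> U" "v' \<in> S" "le v v'" for v v'
    proof -
      have "le (\<phi> v) (\<phi> v')" using \<phi>(2) that Sm unfolding mono_vertex_map_def U_def le_def by blast
      moreover have "length (\<phi> v) = n" using that \<phi>(1) Sm by (auto simp: cube_verts_def U_def)
      ultimately show ?thesis using that i by (auto simp: list_all2_conv_all_nth U_def le_def)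
    qed
    have "(\<Sum>v\<in>S. a v * of_bool (\<phi> v ! i)) = sum a U"
      unfolding U_def by (simp only: sum.inter_filter[OF fin]) (auto intro!: sum.cong)
    then have "thr \<theta> (vertex_comb n S a \<phi>) ! i \<longleftrightarrow> \<theta> \<le> sum a U"
      using i by (simp add: thr_def vertex_comb_def)
    also have "\<dots> \<longleftrightarrow> w \<in> U"
    proof
      assume "w \<in> U"
      then have "up w \<subseteq> U" using upU by (auto simp: up_def)
      then have "sum a (up w) \<le> sum a U"
        using fin S(2) by (intro sum_mono2) (auto simp: U_def intro: finite_subset)
      then show "\<theta> \<le> sum a U" using w by (simp add: T_def)
    next
      assume \<theta>U: "\<theta> \<le> sum a U"
      then have "U \<noteq> {}" using \<theta> by auto
      moreover have US: "U \<subseteq> S" by (auto simp: U_def)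
      ultimately obtain v where v: "v \<in> U" "U \<subseteq> up v" using min[of U] by blast
      then have "U = up v" using upU by (auto simp: up_def)
      then have "v \<in> T" using \<theta>U v US by (auto simp: T_def)
      then show "w \<in> U" using upU[OF v(1) wS] w(2) by blast
    qed
    finally show "thr \<theta> (vertex_comb n S a \<phi>) ! i = \<phi> w ! i" using wS by (simp add: U_def)
  qed
  then show ?thesis using w by (auto simp: T_def)
qed

lemma vertex_comb_in_cube_pts:
  assumes "vertex_chain m S" "\<forall>v\<in>S. 0 \<le> a v" "sum a S = 1"
  shows "vertex_comb n S a \<phi> \<in> cube_pts n"
proof -
  have "0 \<le> (\<Sum>v\<in>S. a v * of_bool (\<phi> v ! i)) \<and> (\<Sum>v\<in>S. a v * of_bool (\<phi> v ! i)) \<le> 1" for i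
    using assms(2) sum_mono[of S "\<lambda>v. a v * of_bool (\<phi> v ! i)" a] unfolding assms(3)[symmetric]
    by (auto intro!: sum_nonneg)
  then show ?thesis by (auto simp: cube_pts_def vertex_comb_def)
qed

text \<open>The same w from \<open>thr_vertex_comb\<close> serves \<phi> and the identity, so the
  thresholds of the combination depend only on t. By \<open>thr_inject\<close> all representations
  of t give the same image, which makes the definite description in \<open>linear_ext\<close>
  meaningful.\<close>

lemma linear_ext_thr:
  assumes \<phi>: "cube_mor m n \<phi>" and t: "t \<in> cube_pts m"
  shows "linear_ext m n \<phi> t \<in> cube_pts n"
    and "0 < \<theta> \<Longrightarrow> \<theta> \<le> 1 \<Longrightarrow> thr \<theta> (linear_ext m n \<phi> t) = \<phi> (thr \<theta> t)"
proof -
  let ?P = "\<lambda>S a. vertex_chain m S \<and> (\<forall>v\<in>S. 0 \<le> a v) \<and> sum a S = 1 \<and> t = vertex_comb m S a (\<lambda>v. v)"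
  have \<phi>': "\<forall>v\<in>cube_verts m. \<phi> v \<in> cube_verts n" "mono_vertex_map m \<phi>"
    using cube_mor_cube_verts[OF \<phi>] cube_mor_mono[OF \<phi>] by blast+
  have id': "\<forall>v\<in>cube_verts m. v \<in> cube_verts m" "mono_vertex_map m (\<lambda>v. v)"
    by (simp_all add: mono_vertex_map_def)
  have thr: "thr \<theta> (vertex_comb n S a \<phi>) = \<phi> (thr \<theta> t)" if P: "?P S a" and \<theta>: "0 < \<theta>" "\<theta> \<le> 1" for S a \<theta>
  proof -
    obtain w where w: "\<And>n \<phi>. \<forall>v\<in>cube_verts m. \<phi> v \<in> cube_verts n \<Longrightarrow> mono_vertex_map m \<phi> \<Longrightarrow>
        thr \<theta> (vertex_comb n S a \<phi>) = \<phi> w"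
      using thr_vertex_comb[OF _ _ _ \<theta>, of m S a] P by metis
    show ?thesis using w[OF \<phi>'] w[OF id'] P by simp
  qed
  have cube: "vertex_comb n S a \<phi> \<in> cube_pts n" if "?P S a" for S a
    using that vertex_comb_in_cube_pts by blast
  obtain S a where P: "?P S a"
    using vertex_comb_exists[of t m 1] t by (auto simp: cube_pts_def subset_iff)
  have eq: "linear_ext m n \<phi> t = vertex_comb n S a \<phi>"
    unfolding linear_ext_def
  proof (rule the_equality)
    fix u assume "\<exists>S a. vertex_chain m S \<and> (\<forall>v\<in>S. 0 \<le> a v) \<and> sum a S = 1 \<and>
      t = vertex_comb m S a (\<lambda>v. v) \<and> u = vertex_comb n S a \<phi>"
    then obtain S' a' where P': "?P S' a'" and u: "u = vertex_comb n S' a' \<phi>" by blast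
    show "u = vertex_comb n S a \<phi>"
      unfolding u by (rule thr_inject[OF cube[OF P'] cube[OF P]]) (simp add: thr[OF P'] thr[OF P])
  qed (use P in blast)
  show "linear_ext m n \<phi> t \<in> cube_pts n" using eq cube[OF P] by simp
  show "thr \<theta> (linear_ext m n \<phi> t) = \<phi> (thr \<theta> t)" if "0 < \<theta>" "\<theta> \<le> 1"
    using eq thr[OF P that] by simp
qed

lemma linear_ext_eqI:
  assumes "cube_mor m n \<phi>" "t \<in> cube_pts m" "u \<in> cube_pts n"
    and "\<And>\<theta>. 0 < \<theta> \<Longrightarrow> \<theta> \<le> 1 \<Longrightarrow> thr \<theta> u = \<phi> (thr \<theta> t)"
  shows "linear_ext m n \<phi> t = u"
  by (rule thr_inject[OF linear_ext_thr(1)[OF assms(1,2)] assms(3)])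
     (simp add: linear_ext_thr(2)[OF assms(1,2)] assms(4))


section \<open>The metric realization\<close>

lemma inj_pairs_infinite:
  assumes "infinite (UNIV :: 'a set)"
  shows "\<exists>f :: 'a \<times> 'a \<Rightarrow> 'a. inj f"
proof -
  obtain f where "bij_betw f ((UNIV :: 'a set) \<times> (UNIV :: 'a set)) (UNIV :: 'a set)"
    using card_of_Times_same_infinite[OF assms] card_of_ordIso by blast
  then show ?thesis unfolding UNIV_Times_UNIV bij_betw_def by blast
qed

lemma inj_lists_infinite:
  assumes "infinite (UNIV :: 'a set)"
  shows "\<exists>f :: 'a list \<Rightarrow> 'a. inj f"
proof -
  obtain p :: "'a \<times> 'a \<Rightarrow> 'a" where p: "inj p" using inj_pairs_infinite[OF assms] by blast
  obtain i :: "nat \<Rightarrow> 'a" where i: "inj i" using infinite_countable_subset[OF assms] by blast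
  \<comment> \<open>The end marker i 0 may itself be a value of p, so e separates only lists of
    equal length; the length is therefore coded as well.\<close>
  define e where "e = (\<lambda>xs. foldr (\<lambda>x y. p (x, y)) xs (i 0))"
  have e: "xs = ys" if "length xs = length ys" "e xs = e ys" for xs ys
    using that by (induction rule: list_induct2) (use injD[OF p] in \<open>auto simp: e_def\<close>)
  have "inj (\<lambda>xs. p (i (length xs), e xs))"
    by (intro injI e) (use injD[OF p] injD[OF i] in blast)+
  then show ?thesis by blast
qed

text \<open>Listing every finite set along one well-order of the type makes the list of a subset a
  sublist. This fixes the order of the axes of cubes so that faces inherit it.\<close>

lemma enumerate_finite_sets:
  "\<exists>enum :: 'a set \<Rightarrow> 'a list. \<forall>B. finite B \<longrightarrow> distinct (enum B) \<and> set (enum B) = B \<and>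
     (\<forall>B'\<subseteq>B. enum B' = filter (\<lambda>b. b \<in> B') (enum B))"
proof -
  obtain r :: "'a rel" where r: "well_order_on UNIV r" using well_order_on by blast
  then have lin: "refl r" "trans r" "antisym r" "total_on UNIV r"
    by (auto simp: well_order_on_def linear_order_on_def partial_order_on_def preorder_on_def)
  interpret linorder "\<lambda>x y. (x, y) \<in> r" "\<lambda>x y. (x, y) \<in> r \<and> x \<noteq> y"
  proof
    show "(x, y) \<in> r \<or> (y, x) \<in> r" for x y
      using lin unfolding total_on_def refl_on_def by (cases "x = y") auto
  qed (use lin in \<open>auto dest: refl_onD transD antisymD\<close>)
  have "distinct (sorted_list_of_set B) \<and> set (sorted_list_of_set B) = B" if "finite B" for B
    using that by simp
  moreover have "sorted_list_of_set B' = filter (\<lambda>b. b \<in> B') (sorted_list_of_set B)"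
    if "finite B" "B' \<subseteq> B" for B B'
    using that finite_subset[OF that(2,1)]
    by (intro sorted_distinct_set_unique) (auto intro: sorted_wrt_filter)
  ultimately have "\<forall>B. finite B \<longrightarrow> distinct (sorted_list_of_set B) \<and> set (sorted_list_of_set B) = B \<and>
     (\<forall>B'\<subseteq>B. sorted_list_of_set B' = filter (\<lambda>b. b \<in> B') (sorted_list_of_set B))"
    by blast
  then show ?thesis by (rule exI[where x = sorted_list_of_set])
qed

section \<open>The quotient by the gluing pseudometric\<close>

definition glue_class :: "'c cubical \<Rightarrow> (nat \<times> 'c \<times> real list) \<Rightarrow> (nat \<times> 'c \<times> real list) set" where
  "glue_class C p = {(p, q). p \<in> cell_pts C \<and> q \<in> cell_pts C \<and> glue_dist C p q = 0} `` {p}"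

lemma sym_glue_equiv: "(p, q) \<in> glue_equiv C \<Longrightarrow> (q, p) \<in> glue_equiv C"
  using sym_rtrancl[OF sym_Un_converse[of "glue C"]] by (auto simp: glue_equiv_def dest: symD)

lemma trans_glue_equiv:
  "(p, q) \<in> glue_equiv C \<Longrightarrow> (q, r) \<in> glue_equiv C \<Longrightarrow> (p, r) \<in> glue_equiv C"
  by (auto simp: glue_equiv_def)

lemma max_dist_commute: "length s = length t \<Longrightarrow> max_dist s t = max_dist t s"
  by (simp add: max_dist_def abs_minus_commute)

lemma glue_step_commute:
  assumes "p \<in> cell_pts C" "q \<in> cell_pts C"
  shows "glue_step C p q = glue_step C q p"
  using assms sym_glue_equiv[of p q C] sym_glue_equiv[of q p C]
  by (auto simp: glue_step_def cell_pts_def cube_pts_def split: prod.splits intro: max_dist_commute)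

lemma glue_dist_refl: "p \<in> cell_pts C \<Longrightarrow> glue_dist C p p = 0"
  unfolding glue_dist_def by (rule chain_dist_refl)

lemma glue_dist_commute: "glue_dist C p q = glue_dist C q p"
  unfolding glue_dist_def by (rule chain_dist_commute) (rule glue_step_commute)

lemma glue_dist_triangle: "glue_dist C p r \<le> glue_dist C p q + glue_dist C q r"
  unfolding glue_dist_def by (rule chain_dist_triangle)

lemma glue_dist_glue_equiv: "(p, q) \<in> glue_equiv C \<Longrightarrow> glue_dist C p q = 0"
  using chain_dist_le_step[of p "cell_pts C" q "glue_step C"]
  by (simp add: glue_dist_def glue_step_def glue_equiv_def)

lemma equiv_glue_dist:
  "equiv (cell_pts C) {(p, q). p \<in> cell_pts C \<and> q \<in> cell_pts C \<and> glue_dist C p q = 0}"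
proof (rule equivI)
  show "trans {(p, q). p \<in> cell_pts C \<and> q \<in> cell_pts C \<and> glue_dist C p q = 0}"
  proof (rule transI, clarify)
    fix p q r assume "glue_dist C p q = 0" "glue_dist C q r = 0"
    then show "glue_dist C p r = 0" using glue_dist_triangle[of C p r q] by simp
  qed
qed (auto simp: refl_on_def sym_def glue_dist_refl glue_dist_commute)

text \<open>Moving a representative within its class costs nothing, so every pair of representatives
  attains the infimum.\<close>

lemma metric_realization_dist_class:
  assumes "p \<in> cell_pts C" "q \<in> cell_pts C"
  shows "metric_realization_dist C (glue_class C p) (glue_class C q) = glue_dist C p q"
proof (rule antisym)
  show "metric_realization_dist C (glue_class C p) (glue_class C q) \<le> glue_dist C p q"
    unfolding metric_realization_dist_def
    by (rule INF_lower2[of p], use assms in \<open>simp add: glue_class_def glue_dist_refl\<close>,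
        rule INF_lower, use assms in \<open>simp add: glue_class_def glue_dist_refl\<close>)
  show "glue_dist C p q \<le> metric_realization_dist C (glue_class C p) (glue_class C q)"
    unfolding metric_realization_dist_def
  proof (intro INF_greatest)
    fix p' q' assume "p' \<in> glue_class C p" "q' \<in> glue_class C q"
    then have z: "glue_dist C p p' = 0" "glue_dist C q' q = 0"
      by (simp_all add: glue_class_def glue_dist_commute)
    show "glue_dist C p q \<le> glue_dist C p' q'"
      using glue_dist_triangle[of C p q p'] glue_dist_triangle[of C p' q q'] z
      by (simp add: order_trans)
  qed
qed

lemma glue_class_eq_iff:
  assumes "p \<in> cell_pts C" "q \<in> cell_pts C"
  shows "glue_class C p = glue_class C q \<longleftrightarrow> glue_dist C p q = 0"
  using eq_equiv_class_iff[OF equiv_glue_dist assms] assms by (simp add: glue_class_def)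

lemma metric_realization_pts_eq: "metric_realization_pts C = glue_class C ` cell_pts C"
  by (auto simp: metric_realization_pts_def glue_class_def quotient_def)

lemma emetric_on_metric_realization:
  "emetric_on (metric_realization_pts C) (metric_realization_dist C)"
  unfolding emetric_on_def metric_realization_pts_eq ball_simps
  by (auto simp: metric_realization_dist_class glue_class_eq_iff glue_dist_triangle glue_dist_commute)

lemma some_in_glue_class:
  assumes "P \<in> metric_realization_pts C"
  shows "(SOME p. p \<in> P) \<in> cell_pts C \<and> glue_class C (SOME p. p \<in> P) = P"
proof -
  obtain p where p: "p \<in> cell_pts C" "P = glue_class C p"
    using assms by (auto simp: metric_realization_pts_eq)
  then have "p \<in> P" by (simp add: glue_class_def glue_dist_refl)
  then have "(SOME p. p \<in> P) \<in> P" by (rule someI[of "\<lambda>p. p \<in> P"])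
  then have "(SOME p. p \<in> P) \<in> cell_pts C" "glue_dist C p (SOME p. p \<in> P) = 0"
    using p by (auto simp: glue_class_def)
  then show ?thesis using p glue_class_eq_iff by blast
qed

text \<open>A class is coded by a chosen representative (n, c, t), written as a list over
  \<open>'u\<close> with its numbers embedded by i.\<close>

lemma inj_metric_realization_pts:
  assumes "inj (i :: real \<Rightarrow> 'u)"
  shows "\<exists>f :: _ \<Rightarrow> 'u. inj_on f (metric_realization_pts (C :: 'u cubical))"
proof -
  have "infinite (UNIV :: 'u set)"
    using assms infinite_UNIV_char_0[where 'a = real] finite_subset[of "range i"] finite_imageD by blast
  then obtain f :: "'u list \<Rightarrow> 'u" where f: "inj f" using inj_lists_infinite by blast
  define g where "g = (\<lambda>(n :: nat, c, t). f (i (real n) # c # map i t))"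
  have g: "inj g"
    by (auto intro!: injI simp: g_def dest!: injD[OF f] injD[OF assms] map_injective[OF _ assms])
  have "inj_on (\<lambda>P. g (SOME p. p \<in> P)) (metric_realization_pts C)"
    by (rule inj_onI) (metis injD[OF g] some_in_glue_class)
  then show ?thesis by blast
qed


section \<open>The cubical nerve of the face poset\<close>

text \<open>The n-cubes of the nerve: functors from [1]^n to the face poset. Extensionality makes
  equal cubes equal functions.\<close>

definition face_cells :: "'u set set \<Rightarrow> nat \<Rightarrow> (bool list \<Rightarrow> 'u set) set" where
  "face_cells K n = {c \<in> extensional (cube_verts n). (\<forall>v\<in>cube_verts n. c v \<in> K) \<and>
     (\<forall>v\<in>cube_verts n. \<forall>w\<in>cube_verts n. list_all2 (\<le>) v w \<longrightarrow> c v \<subseteq> c w)}"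

lemma face_cells_compose:
  assumes "cube_mor m n \<phi>" "c \<in> face_cells K n"
  shows "compose (cube_verts m) c \<phi> \<in> face_cells K m"
  using assms cube_mor_cube_verts[OF assms(1)] cube_mor_mono[OF assms(1)]
  by (auto simp: face_cells_def compose_def mono_vertex_map_def)

text \<open>The coordinate at \<open>b\<close> of the piecewise linear extension of \<open>c\<close> is the largest \<open>\<theta>\<close> such that
  \<open>b\<close> lies in the face assigned to the vertex \<open>thr \<theta> t\<close>; it is attained at a coordinate of \<open>t\<close>
  or at \<open>1\<close>.\<close>

definition height :: "(bool list \<Rightarrow> 'u set) \<Rightarrow> real list \<Rightarrow> 'u \<Rightarrow> real" where
  "height c t b = Max (insert 0 {\<theta> \<in> insert 1 (set t). 0 < \<theta> \<and> b \<in> c (thr \<theta> t)})"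

lemma thr_antimono:
  assumes "length s = length t" "\<And>i. i < length s \<Longrightarrow> \<theta> \<le> s ! i \<Longrightarrow> \<theta>' \<le> t ! i"
  shows "list_all2 (\<le>) (thr \<theta> s) (thr \<theta>' t)"
  using assms by (auto simp: thr_def list_all2_conv_all_nth)

lemma height_bounds: "t \<in> cube_pts n \<Longrightarrow> 0 \<le> height c t b \<and> height c t b \<le> 1"
  by (auto simp: height_def cube_pts_def)

lemma le_height_iff:
  assumes c: "c \<in> face_cells K n" and t: "t \<in> cube_pts n" and \<theta>: "0 < \<theta>" "\<theta> \<le> 1"
  shows "\<theta> \<le> height c t b \<longleftrightarrow> b \<in> c (thr \<theta> t)"
proof
  let ?A = "{\<theta> \<in> insert 1 (set t). 0 < \<theta> \<and> b \<in> c (thr \<theta> t)}"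
  assume le: "\<theta> \<le> height c t b"
  have "height c t b \<in> insert 0 ?A" unfolding height_def by (rule Max_in) auto
  then have "b \<in> c (thr (height c t b) t)" using le \<theta> by auto
  moreover have "list_all2 (\<le>) (thr (height c t b) t) (thr \<theta> t)"
    using le by (intro thr_antimono) auto
  ultimately show "b \<in> c (thr \<theta> t)"
    using c thr_in_cube_verts[OF t] unfolding face_cells_def by blast
next
  let ?A = "{\<theta> \<in> insert 1 (set t). 0 < \<theta> \<and> b \<in> c (thr \<theta> t)}"
  assume b: "b \<in> c (thr \<theta> t)"
  let ?X = "{x \<in> insert 1 (set t). \<theta> \<le> x}"
  \<comment> \<open>Moving \<theta> up to the next coordinate of t, or to 1, leaves the threshold
    vertex unchanged and reaches a candidate in the definition of \<open>height\<close>.\<close>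
  define x where "x = Min ?X"
  have x: "x \<in> ?X" unfolding x_def using \<theta> by (intro Min_in) auto
  have "thr x t = thr \<theta> t"
    unfolding thr_def
  proof (rule map_cong[OF refl])
    fix y assume "y \<in> set t"
    then have "\<theta> \<le> y \<Longrightarrow> x \<le> y" unfolding x_def by (intro Min_le) auto
    then show "(x \<le> y) = (\<theta> \<le> y)" using x by auto
  qed
  then have "x \<in> insert 0 ?A" using x b \<theta> by auto
  then have "x \<le> height c t b" unfolding height_def by (intro Max_ge) auto
  then show "\<theta> \<le> height c t b" using x by auto
qed

lemma eq_if_thresholds_eq:
  fixes x y :: real
  assumes "0 \<le> x" "x \<le> 1" "0 \<le> y" "y \<le> 1" "\<And>\<theta>. 0 < \<theta> \<Longrightarrow> \<theta> \<le> 1 \<Longrightarrow> \<theta> \<le> x \<longleftrightarrow> \<theta> \<le> y"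
  shows "x = y"
  using assms(5)[of x] assms(5)[of y] assms(1-4) by (cases "x = 0"; cases "y = 0") auto

text \<open>Both sides have the same superlevel sets because thresholding turns
  \<open>linear_ext\<close> into composition. This is what makes the retraction respect the
  gluing.\<close>

lemma height_compose:
  assumes c: "c \<in> face_cells K n" and \<phi>: "cube_mor m n \<phi>" and t: "t \<in> cube_pts m"
  shows "height (compose (cube_verts m) c \<phi>) t = height c (linear_ext m n \<phi> t)"
proof
  fix b
  note c' = face_cells_compose[OF \<phi> c] and l = linear_ext_thr[OF \<phi> t]
  show "height (compose (cube_verts m) c \<phi>) t b = height c (linear_ext m n \<phi> t) b"
    using height_bounds[OF t, of "compose (cube_verts m) c \<phi>" b] height_bounds[OF l(1), of c b]
    by (intro eq_if_thresholds_eq)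
      (auto simp: le_height_iff[OF c' t] le_height_iff[OF c l(1)] l(2) thr_in_cube_verts[OF t] compose_eq)
qed

text \<open>A coordinate that is at least h in s is at least h - \<delta> in t, and monotonicity of
  c carries b along. The constant is 1 in every dimension n, as needed for a nerve with cells of
  unbounded dimension.\<close>

lemma height_lipschitz:
  assumes c: "c \<in> face_cells K n" and s: "s \<in> cube_pts n" and t: "t \<in> cube_pts n"
    and \<delta>: "\<And>i. i < n \<Longrightarrow> \<bar>s ! i - t ! i\<bar> \<le> \<delta>" "0 \<le> \<delta>"
  shows "\<bar>height c s b - height c t b\<bar> \<le> \<delta>"
proof -
  have "height c s b - \<delta> \<le> height c t b"
    if s: "s \<in> cube_pts n" and t: "t \<in> cube_pts n" and d: "\<And>i. i < n \<Longrightarrow> \<bar>s ! i - t ! i\<bar> \<le> \<delta>" for s t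
  proof (cases "height c s b \<le> \<delta>")
    case True
    then show ?thesis using height_bounds[OF t, of c b] by simp
  next
    case False
    let ?h = "height c s b"
    have h: "0 < ?h" "?h \<le> 1" "0 < ?h - \<delta>" "?h - \<delta> \<le> 1"
      using False \<delta>(2) height_bounds[OF s, of c b] by auto
    have "b \<in> c (thr ?h s)" using le_height_iff[OF c s h(1,2)] by blast
    moreover have "list_all2 (\<le>) (thr ?h s) (thr (?h - \<delta>) t)"
      using s t d by (intro thr_antimono) (auto simp: cube_pts_def abs_le_iff, smt (verit))
    ultimately have "b \<in> c (thr (?h - \<delta>) t)"
      using c thr_in_cube_verts[OF s] thr_in_cube_verts[OF t] unfolding face_cells_def by blast
    then show ?thesis using le_height_iff[OF c t h(3,4)] by blast
  qed
  from this[OF s t \<delta>(1)] this[OF t s] show ?thesis using \<delta>(1) by (simp add: abs_le_iff abs_minus_commute)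
qed

text \<open>A simplex is the union of the faces \<open>{u. u a = 1}\<close> of a cube, by radial projection between
  the unit spheres of the \<open>\<ell>\<^sub>1\<close>-norm and the maximum norm.\<close>

definition cubic_pts :: "'u set set \<Rightarrow> ('u \<Rightarrow> real) set" where
  "cubic_pts K = {u. (\<forall>b. 0 \<le> u b \<and> u b \<le> 1) \<and> carrier_of u \<in> K \<and> (\<exists>b. u b = 1)}"

definition to_simplex :: "('u \<Rightarrow> real) \<Rightarrow> 'u \<Rightarrow> real" where
  "to_simplex u b = u b / sum u (carrier_of u)"

definition to_cube :: "('u \<Rightarrow> real) \<Rightarrow> 'u \<Rightarrow> real" where
  "to_cube x b = x b / Max (x ` carrier_of x)"

text \<open>The value 1 is attained on the face c (thr 1 t), which is nonempty because it is a
  simplex.\<close>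

lemma height_cubic:
  assumes K: "abstract_complex K" and c: "c \<in> face_cells K n" and t: "t \<in> cube_pts n"
  shows "height c t \<in> cubic_pts K" "carrier_of (height c t) \<subseteq> c (replicate n True)"
    "c (replicate n True) \<in> K"
proof -
  have top: "replicate n True \<in> cube_verts n" by (simp add: cube_verts_def)
  then show cK: "c (replicate n True) \<in> K" using c by (simp add: face_cells_def)
  show sub: "carrier_of (height c t) \<subseteq> c (replicate n True)"
  proof
    fix b assume "b \<in> carrier_of (height c t)"
    then have h: "0 < height c t b" "height c t b \<le> 1"
      using height_bounds[OF t, of c b] by (auto simp: carrier_of_def)
    then have "b \<in> c (thr (height c t b) t)" using le_height_iff[OF c t] by blast
    moreover have "list_all2 (\<le>) (thr (height c t b) t) (replicate n True)"
      using t by (simp add: thr_def list_all2_conv_all_nth cube_pts_def)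
    ultimately show "b \<in> c (replicate n True)"
      using c top thr_in_cube_verts[OF t] unfolding face_cells_def by blast
  qed
  have "c (thr 1 t) \<in> K" using c thr_in_cube_verts[OF t] by (simp add: face_cells_def)
  then obtain b where "b \<in> c (thr 1 t)" using K unfolding abstract_complex_def by blast
  then have b: "height c t b = 1"
    using le_height_iff[OF c t, of 1 b] height_bounds[OF t, of c b] by auto
  then have "b \<in> carrier_of (height c t)" by (simp add: carrier_of_def)
  then have "carrier_of (height c t) \<in> K" using K cK sub unfolding abstract_complex_def by blast
  then show "height c t \<in> cubic_pts K" using b height_bounds[OF t, of c] by (auto simp: cubic_pts_def)
qed

lemma sum_carrier_of:
  "finite \<tau> \<Longrightarrow> carrier_of u \<subseteq> \<tau> \<Longrightarrow> sum u (carrier_of u) = sum u \<tau>"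
  by (rule sum.mono_neutral_left) (auto simp: carrier_of_def)

lemma cubic_sum_ge_1:
  assumes "u \<in> cubic_pts K" "finite \<tau>" "carrier_of u \<subseteq> \<tau>"
  shows "1 \<le> sum u \<tau>"
proof -
  obtain b where b: "u b = 1" using assms(1) by (auto simp: cubic_pts_def)
  then have "b \<in> \<tau>" using assms(3) by (auto simp: carrier_of_def)
  then show ?thesis using member_le_sum[of b \<tau> u] assms b by (auto simp: cubic_pts_def)
qed

lemma to_simplex_pts:
  assumes K: "abstract_complex K" and u: "u \<in> cubic_pts K"
  shows "to_simplex u \<in> complex_pts K" "carrier_of (to_simplex u) = carrier_of u"
proof -
  have fin: "finite (carrier_of u)" using assms by (auto simp: cubic_pts_def abstract_complex_def)
  have S: "1 \<le> sum u (carrier_of u)" by (rule cubic_sum_ge_1[OF u fin order_refl])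
  show c: "carrier_of (to_simplex u) = carrier_of u"
    using S by (auto simp: carrier_of_def to_simplex_def)
  have "sum (to_simplex u) (carrier_of u) = 1"
    using S by (simp add: to_simplex_def flip: sum_divide_distrib)
  then show "to_simplex u \<in> complex_pts K"
    using u S unfolding complex_pts_def by (auto simp: c cubic_pts_def) (simp add: to_simplex_def)
qed

text \<open>The coordinate sums S and S' are at least 1 and differ by at most k \<delta>. Splitting
  u/S - w/S' into (u - w)/S + w (S' - S)/(S S') bounds each coordinate by (k + 1) \<delta>, and the
  l2 norm is at most the sum over the at most k vertices of \<tau>.\<close>

lemma l2_step_to_simplex:
  assumes K: "abstract_complex K" and \<tau>: "\<tau> \<in> K" "card \<tau> \<le> k"
    and u: "u \<in> cubic_pts K" "carrier_of u \<subseteq> \<tau>" and w: "w \<in> cubic_pts K" "carrier_of w \<subseteq> \<tau>"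
    and \<delta>: "\<And>b. \<bar>u b - w b\<bar> \<le> \<delta>"
  shows "l2_step K (to_simplex u) (to_simplex w) \<le> ennreal (real k * (real k + 1) * \<delta>)"
proof -
  have fin: "finite \<tau>" using K \<tau> by (auto simp: abstract_complex_def)
  note car = to_simplex_pts(2)[OF K u(1)] to_simplex_pts(2)[OF K w(1)]
  define S where "S = sum u \<tau>" define S' where "S' = sum w \<tau>"
  have S: "1 \<le> S" "1 \<le> S'"
    unfolding S_def S'_def using cubic_sum_ge_1[OF u(1) fin u(2)] cubic_sum_ge_1[OF w(1) fin w(2)] .
  have d0: "0 \<le> \<delta>" using \<delta>[of undefined] by linarith
  have "\<bar>S' - S\<bar> \<le> (\<Sum>b\<in>\<tau>. \<bar>w b - u b\<bar>)" unfolding S_def S'_def sum_subtractf[symmetric] by (rule sum_abs)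
  also have "\<dots> \<le> (\<Sum>b\<in>\<tau>. \<delta>)" by (intro sum_mono) (metis \<delta> abs_minus_commute)
  also have "\<dots> \<le> real k * \<delta>" using \<tau>(2) d0 by (simp add: mult_right_mono)
  finally have SS: "\<bar>S' - S\<bar> \<le> real k * \<delta>" .
  have pt: "\<bar>to_simplex u b - to_simplex w b\<bar> \<le> (real k + 1) * \<delta>" for b
  proof -
    have wb: "0 \<le> w b" "w b \<le> 1" using w by (auto simp: cubic_pts_def)
    have "to_simplex u b - to_simplex w b = u b / S - w b / S'"
      using sum_carrier_of[OF fin u(2)] sum_carrier_of[OF fin w(2)] by (simp add: to_simplex_def S_def S'_def)
    also have "\<dots> = (u b - w b) / S + w b * (S' - S) / (S * S')" using S by (simp add: field_simps)
    also have "\<bar>\<dots>\<bar> \<le> \<bar>u b - w b\<bar> / S + w b * \<bar>S' - S\<bar> / (S * S')"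
      using abs_triangle_ineq[of "(u b - w b) / S" "w b * (S' - S) / (S * S')"] S wb
      by (simp add: abs_mult)
    also have "\<bar>u b - w b\<bar> / S \<le> \<delta> / 1" using \<delta>[of b] S d0 by (intro frac_le) auto
    also have "w b * \<bar>S' - S\<bar> / (S * S') \<le> 1 * (real k * \<delta>) / 1"
    proof (rule frac_le)
      show "w b * \<bar>S' - S\<bar> \<le> 1 * (real k * \<delta>)" using wb SS d0 by (intro mult_mono) auto
      show "1 \<le> S * S'" using mult_mono[of 1 S 1 S'] S by simp
    qed (use d0 in auto)
    finally show ?thesis by (simp add: algebra_simps)
  qed
  have "L2_set (\<lambda>b. to_simplex u b - to_simplex w b) (carrier_of u \<union> carrier_of w)
      \<le> (\<Sum>b\<in>carrier_of u \<union> carrier_of w. \<bar>to_simplex u b - to_simplex w b\<bar>)"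
    by (rule L2_set_le_sum_abs)
  also have "\<dots> \<le> (\<Sum>b\<in>carrier_of u \<union> carrier_of w. (real k + 1) * \<delta>)" by (intro sum_mono pt)
  also have "\<dots> \<le> (\<Sum>b\<in>\<tau>. (real k + 1) * \<delta>)" using fin u w d0 by (intro sum_mono2) auto
  also have "\<dots> \<le> real k * ((real k + 1) * \<delta>)" using \<tau>(2) d0 by (simp add: mult_right_mono)
  finally show ?thesis
    using \<tau>(1) u(2) w(2) unfolding l2_step_def car by (auto intro!: ennreal_leI simp: mult.assoc)
qed

lemma abs_diff_le_L2_set:
  assumes K: "abstract_complex K" and x: "x \<in> complex_pts K" and y: "y \<in> complex_pts K"
  shows "\<bar>x b - y b\<bar> \<le> L2_set (\<lambda>v. x v - y v) (carrier_of x \<union> carrier_of y)"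
proof (cases "b \<in> carrier_of x \<union> carrier_of y")
  case True
  have "finite (carrier_of x \<union> carrier_of y)"
    using K x y by (auto simp: complex_pts_def abstract_complex_def)
  then have "(x b - y b)\<^sup>2 \<le> (\<Sum>v\<in>carrier_of x \<union> carrier_of y. (x v - y v)\<^sup>2)"
    using True by (intro member_le_sum) auto
  then show ?thesis unfolding L2_set_def by (intro real_le_rsqrt) simp
qed (auto simp: carrier_of_def)

text \<open>At most k coordinates add up to 1, so the largest is at least 1/k. This bounds the
  rescaling factor.\<close>

lemma to_cube_aux:
  assumes K: "abstract_complex K" and x: "x \<in> complex_pts K" and k: "\<And>\<sigma>. \<sigma> \<in> K \<Longrightarrow> card \<sigma> \<le> k"
  defines "m \<equiv> Max (x ` carrier_of x)"
  shows "1 \<le> real k * m" "0 < m" "\<And>b. x b \<le> m" "\<exists>b. x b = m"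
proof -
  have c: "finite (carrier_of x)" "carrier_of x \<noteq> {}" "carrier_of x \<in> K"
    using K x by (auto simp: complex_pts_def abstract_complex_def)
  have nn: "0 \<le> x b" for b using x by (simp add: complex_pts_def)
  have le: "x b \<le> m" if "b \<in> carrier_of x" for b
    unfolding m_def using c that by (intro Max_ge) auto
  have "m \<in> x ` carrier_of x" unfolding m_def using c by (intro Max_in) auto
  then obtain b where b: "b \<in> carrier_of x" "x b = m" by blast
  then show "0 < m" using nn[of b] by (auto simp: carrier_of_def)
  then show "x b \<le> m" for b using le by (cases "b \<in> carrier_of x") (auto simp: carrier_of_def)
  show "\<exists>b. x b = m" using b by blast
  have "1 = sum x (carrier_of x)" using x by (simp add: complex_pts_def)
  also have "\<dots> \<le> real (card (carrier_of x)) * m" using sum_bounded_above[of "carrier_of x" x m] le by simp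
  also have "\<dots> \<le> real k * m" using k[OF c(3)] \<open>0 < m\<close> by simp
  finally show "1 \<le> real k * m" .
qed

lemma to_cube_pts:
  assumes K: "abstract_complex K" and x: "x \<in> complex_pts K" and k: "\<And>\<sigma>. \<sigma> \<in> K \<Longrightarrow> card \<sigma> \<le> k"
  shows "to_cube x \<in> cubic_pts K" "carrier_of (to_cube x) = carrier_of x" "to_simplex (to_cube x) = x"
proof -
  note a = to_cube_aux[OF K x k]
  show c: "carrier_of (to_cube x) = carrier_of x"
    using a(2) by (auto simp: carrier_of_def to_cube_def)
  show "to_cube x \<in> cubic_pts K"
  proof -
    obtain b where "x b = Max (x ` carrier_of x)" using a(4) by blast
    then have "to_cube x b = 1" using a(2) by (simp add: to_cube_def)
    moreover have "0 \<le> to_cube x b \<and> to_cube x b \<le> 1" for b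
      using a(2) a(3)[of b] x by (simp add: to_cube_def complex_pts_def)
    ultimately show ?thesis using x by (auto simp: cubic_pts_def c complex_pts_def)
  qed
  have "sum (to_cube x) (carrier_of x) = 1 / Max (x ` carrier_of x)"
    using x by (simp add: to_cube_def complex_pts_def flip: sum_divide_distrib)
  then show "to_simplex (to_cube x) = x"
    using a(2) by (auto simp: to_simplex_def c fun_eq_iff to_cube_def)
qed

text \<open>The splitting of \<open>l2_step_to_simplex\<close> with maxima m, m' for sums: they
  differ by at most \<delta>, y b / m' is at most 1 and 1 / m at most k, so the changes of numerator
  and denominator contribute k \<delta> each.\<close>

lemma to_cube_lipschitz:
  assumes K: "abstract_complex K" and k: "\<And>\<sigma>. \<sigma> \<in> K \<Longrightarrow> card \<sigma> \<le> k"
    and x: "x \<in> complex_pts K" and y: "y \<in> complex_pts K" and \<delta>: "\<And>b. \<bar>x b - y b\<bar> \<le> \<delta>"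
  shows "\<bar>to_cube x b - to_cube y b\<bar> \<le> 2 * real k * \<delta>"
proof -
  define m where "m = Max (x ` carrier_of x)" define m' where "m' = Max (y ` carrier_of y)"
  note a = to_cube_aux[OF K x k, folded m_def] and a' = to_cube_aux[OF K y k, folded m'_def]
  obtain b1 b2 where b12: "x b1 = m" "y b2 = m'" using a(4) a'(4) by blast
  have mm: "\<bar>m' - m\<bar> \<le> \<delta>"
    using \<delta>[of b1] \<delta>[of b2] a(3)[of b2] a'(3)[of b1] b12 by linarith
  have d0: "0 \<le> \<delta>" using \<delta>[of b] by linarith
  have inv: "1 / m \<le> real k" using a by (simp add: field_simps)
  have yb: "0 \<le> y b" "y b \<le> m'" using y a'(3) by (auto simp: complex_pts_def)
  have "to_cube x b - to_cube y b = (x b - y b) * (1 / m) + (y b / m') * (m' - m) * (1 / m)"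
    using a(2) a'(2) by (simp add: to_cube_def flip: m_def m'_def) (simp add: field_simps)
  also have "\<bar>\<dots>\<bar> \<le> \<bar>x b - y b\<bar> * (1 / m) + (y b / m') * \<bar>m' - m\<bar> * (1 / m)"
    using abs_triangle_ineq[of "(x b - y b) * (1 / m)" "(y b / m') * (m' - m) * (1 / m)"] a a' yb
    by (simp add: abs_mult)
  also have "\<bar>x b - y b\<bar> * (1 / m) \<le> \<delta> * real k" using \<delta>[of b] inv a(2) d0 by (intro mult_mono) auto
  also have "(y b / m') * \<bar>m' - m\<bar> * (1 / m) \<le> 1 * \<delta> * real k"
    using mm inv a(2) a'(2) yb d0 by (intro mult_mono) (auto simp: divide_le_eq_1)
  finally show ?thesis by (simp add: algebra_simps)
qed

section \<open>Cells given by intervals of the face poset\<close>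

definition insert_vertex :: "nat \<Rightarrow> bool \<Rightarrow> nat \<Rightarrow> bool list \<Rightarrow> bool list" where
  "insert_vertex i \<epsilon> m = (\<lambda>v\<in>cube_verts m. take i v @ \<epsilon> # drop i v)"

text \<open>The coface fixing axis i at \<epsilon> is a face of [1] tensored with identities on both
  sides.\<close>

lemma cube_mor_insert_vertex: "cube_mor (i + j) (Suc (i + j)) (insert_vertex i \<epsilon> (i + j))"
proof -
  have "cube_mor (i + (0 + j)) (i + (1 + j))
      (\<lambda>v\<in>cube_verts (i + (0 + j)). (\<lambda>v\<in>cube_verts i. v) (take i v) @
        (\<lambda>v\<in>cube_verts (0 + j). (\<lambda>v\<in>cube_verts 0. [\<epsilon>]) (take 0 v) @ (\<lambda>v\<in>cube_verts j. v) (drop 0 v)) (drop i v))"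
    by (intro cube_mor.tensor cube_mor.ident cube_mor.face)
  also have "(\<lambda>v\<in>cube_verts (i + (0 + j)). (\<lambda>v\<in>cube_verts i. v) (take i v) @
        (\<lambda>v\<in>cube_verts (0 + j). (\<lambda>v\<in>cube_verts 0. [\<epsilon>]) (take 0 v) @ (\<lambda>v\<in>cube_verts j. v) (drop 0 v)) (drop i v))
      = insert_vertex i \<epsilon> (i + j)"
    by (auto simp: insert_vertex_def cube_verts_def fun_eq_iff)
  finally show ?thesis by simp
qed

text \<open>The face \<open>[A, A \<union> set vs]\<close> of the face poset as a cell, with the order of axes given by \<open>vs\<close>.\<close>

definition interval_cell :: "'u set \<Rightarrow> 'u list \<Rightarrow> bool list \<Rightarrow> 'u set" where
  "interval_cell A vs = (\<lambda>v\<in>cube_verts (length vs). A \<union> {b. (b, True) \<in> set (zip vs v)})"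

lemma interval_cell_in_face_cells:
  assumes K: "abstract_complex K" and A: "A \<noteq> {}" "A \<union> set vs \<in> K"
  shows "interval_cell A vs \<in> face_cells K (length vs)"
proof -
  have "A \<union> {b. (b, True) \<in> set (zip vs v)} \<in> K" for v
  proof -
    have "A \<union> {b. (b, True) \<in> set (zip vs v)} \<subseteq> A \<union> set vs" by (auto dest: set_zip_leftD)
    then show ?thesis using K A unfolding abstract_complex_def by blast
  qed
  moreover have "(b, True) \<in> set (zip vs w)"
    if "list_all2 (\<le>) v w" "(b, True) \<in> set (zip vs v)" for v w b
    using that by (auto simp: in_set_zip list_all2_conv_all_nth)
  ultimately show ?thesis by (auto simp: face_cells_def interval_cell_def)
qed

text \<open>Fixing the axis of b at 1 moves b into the lower end of the interval; fixing it at 0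
  deletes b from the upper end.\<close>

lemma interval_cell_insert_vertex:
  "compose (cube_verts (length (xs @ ys))) (interval_cell A (xs @ b # ys))
      (insert_vertex (length xs) \<epsilon> (length (xs @ ys))) =
    interval_cell (if \<epsilon> then insert b A else A) (xs @ ys)"
proof
  fix v
  show "compose (cube_verts (length (xs @ ys))) (interval_cell A (xs @ b # ys))
      (insert_vertex (length xs) \<epsilon> (length (xs @ ys))) v =
    interval_cell (if \<epsilon> then insert b A else A) (xs @ ys) v"
    by (auto simp: compose_def interval_cell_def insert_vertex_def cube_verts_def zip_append1 zip_append2)
qed

text \<open>At level \<theta> the cell selects A and the axes with value at least \<theta>, which is
  the superlevel set of u. Hence the retraction will invert the section.\<close>

lemma height_interval_cell:
  assumes K: "abstract_complex K" and A: "A \<noteq> {}" "A \<union> set vs \<in> K"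
    and u: "\<And>b. 0 \<le> u b \<and> u b \<le> 1" "\<And>b. b \<in> A \<Longrightarrow> u b = 1" "carrier_of u \<subseteq> A \<union> set vs"
  shows "height (interval_cell A vs) (map u vs) = u"
proof
  fix b
  have t: "map u vs \<in> cube_pts (length vs)" using u by (auto simp: cube_pts_def)
  have zip: "(b, True) \<in> set (zip vs (thr \<theta> (map u vs))) \<longleftrightarrow> b \<in> set vs \<and> \<theta> \<le> u b" for \<theta>
    by (auto simp: thr_def zip_map2 zip_same_conv_map)
  have "\<theta> \<le> height (interval_cell A vs) (map u vs) b \<longleftrightarrow> \<theta> \<le> u b" if \<theta>: "0 < \<theta>" "\<theta> \<le> 1" for \<theta>
  proof -
    have "b \<in> A \<or> b \<in> set vs \<or> u b = 0" using u(3) by (auto simp: carrier_of_def)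
    moreover have "thr \<theta> (map u vs) \<in> cube_verts (length vs)" by (rule thr_in_cube_verts[OF t])
    ultimately show ?thesis
      unfolding le_height_iff[OF interval_cell_in_face_cells[OF K A] t \<theta>]
      using u(2)[of b] \<theta> by (auto simp: interval_cell_def zip)
  qed
  then show "height (interval_cell A vs) (map u vs) b = u b"
    using height_bounds[OF t, of "interval_cell A vs" b] u(1)[of b] by (intro eq_if_thresholds_eq) simp_all
qed

text \<open>The cubes of the nerve are functions with sets as values; \<open>code\<close> makes them
  cells of type \<open>'u\<close>. Taking k positive keeps the Lipschitz constants nonzero even for
  empty K.\<close>

locale coded_complex =
  fixes K :: "'u set set" and k :: nat
    and enum :: "'u set \<Rightarrow> 'u list" and code :: "nat \<Rightarrow> (bool list \<Rightarrow> 'u set) \<Rightarrow> 'u"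
  assumes K: "abstract_complex K" and card_le: "\<And>\<sigma>. \<sigma> \<in> K \<Longrightarrow> card \<sigma> \<le> k" and k_pos: "0 < k"
    and enum: "\<And>B. finite B \<Longrightarrow> set (enum B) = B"
    and enum_filter: "\<And>B B'. finite B \<Longrightarrow> B' \<subseteq> B \<Longrightarrow> enum B' = filter (\<lambda>b. b \<in> B') (enum B)"
    and code: "\<And>n. inj_on (code n) (face_cells K n)"
begin

definition decode :: "nat \<Rightarrow> 'u \<Rightarrow> bool list \<Rightarrow> 'u set" where
  "decode n = inv_into (face_cells K n) (code n)"

definition C :: "'u cubical" where
  "C = \<lparr>cells = \<lambda>n. code n ` face_cells K n,
        act = \<lambda>m n \<phi> x. code m (compose (cube_verts m) (decode n x) \<phi>)\<rparr>"

lemma decode_code: "c \<in> face_cells K n \<Longrightarrow> decode n (code n c) = c"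
  unfolding decode_def using code by (rule inv_into_f_f)

lemma cells_C: "x \<in> cells C n \<longleftrightarrow> (\<exists>c\<in>face_cells K n. x = code n c)"
  by (auto simp: C_def)

lemma act_C: "c \<in> face_cells K n \<Longrightarrow> act C m n \<phi> (code n c) = code m (compose (cube_verts m) c \<phi>)"
  by (simp add: C_def decode_code)

lemma cubical_set_C: "cubical_set C"
  unfolding cubical_set_def
proof (intro conjI allI impI ballI)
  fix m n \<phi> assume "cube_mor m n \<phi>"
  then show "act C m n \<phi> \<in> cells C n \<rightarrow> cells C m"
    using face_cells_compose[of m n \<phi> _ K] by (auto simp: cells_C act_C intro!: bexI)
next
  fix n x assume "x \<in> cells C n"
  then obtain c where c: "c \<in> face_cells K n" "x = code n c" by (auto simp: cells_C)
  then have "compose (cube_verts n) c (\<lambda>v\<in>cube_verts n. v) = c"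
    by (auto simp: face_cells_def compose_def extensional_def fun_eq_iff)
  then show "act C n n (\<lambda>v\<in>cube_verts n. v) x = x" using c by (simp add: act_C)
next
  fix l m n \<phi> \<psi> x assume \<phi>: "cube_mor l m \<phi>" and \<psi>: "cube_mor m n \<psi>" and "x \<in> cells C n"
  then obtain c where c: "c \<in> face_cells K n" "x = code n c" by (auto simp: cells_C)
  have "compose (cube_verts l) c (compose (cube_verts l) \<psi> \<phi>) =
      compose (cube_verts l) (compose (cube_verts m) c \<psi>) \<phi>"
    using cube_mor_cube_verts[OF \<phi>] by (auto simp: compose_def fun_eq_iff)
  then show "act C l n (compose (cube_verts l) \<psi> \<phi>) x = act C l m \<phi> (act C m n \<psi> x)"
    using c face_cells_compose[OF \<psi> c(1)] by (simp add: act_C)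
qed

text \<open>Points at distance 0 agree because each barycentric coordinate is 1-Lipschitz on steps,
  hence for the chain distance.\<close>

lemma emetric_on_l2: "emetric_on (complex_pts K) (l2_dist K)"
proof -
  have comm: "l2_dist K x y = l2_dist K y x" for x y
    unfolding l2_dist_def
    by (rule chain_dist_commute) (auto simp: l2_step_def L2_set_def Un_commute power2_commute conj_commute)
  have "x = y" if xy: "x \<in> complex_pts K" "y \<in> complex_pts K" "l2_dist K x y = 0" for x y
  proof
    fix b
    have "ennreal \<bar>x b - y b\<bar> \<le> 1 * chain_dist (complex_pts K) (l2_step K) x y"
    proof (rule chain_dist_greatest[where \<rho> = "\<lambda>x y. ennreal \<bar>x b - y b\<bar>"])
      fix x y assume x: "x \<in> complex_pts K" and y: "y \<in> complex_pts K"
      show "ennreal \<bar>x b - y b\<bar> \<le> 1 * l2_step K x y"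
        using abs_diff_le_L2_set[OF K x y, of b] by (auto simp: l2_step_def intro!: ennreal_leI)
    qed (auto simp flip: ennreal_plus intro!: ennreal_leI)
    then show "x b = y b" using xy by (simp add: l2_dist_def)
  qed
  moreover have "l2_dist K x x = 0" if "x \<in> complex_pts K" for x
    unfolding l2_dist_def using that by (rule chain_dist_refl)
  moreover have "l2_dist K x z \<le> l2_dist K x y + l2_dist K y z" for x y z
    unfolding l2_dist_def by (rule chain_dist_triangle)
  ultimately show ?thesis unfolding emetric_on_def using comm by blast
qed

section \<open>The retraction onto the complex, on representatives\<close>

definition realize :: "nat \<times> 'u \<times> real list \<Rightarrow> 'u \<Rightarrow> real" where
  "realize = (\<lambda>(n, x, t). to_simplex (height (decode n x) t))"

lemma realize_pts: "p \<in> cell_pts C \<Longrightarrow> realize p \<in> complex_pts K"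
  using height_cubic(1)[OF K] to_simplex_pts(1)[OF K]
  by (auto simp: cell_pts_def cells_C realize_def decode_code)

lemma realize_glue: "(p, q) \<in> glue C \<Longrightarrow> realize p = realize q"
  by (auto simp: glue_def cells_C realize_def act_C decode_code face_cells_compose height_compose)

lemma realize_glue_equiv:
  assumes "(p, q) \<in> glue_equiv C" shows "realize p = realize q"
proof -
  have "(p, q) \<in> (glue C \<union> (glue C)\<inverse>)\<^sup>*" using assms by (simp add: glue_equiv_def)
  then show ?thesis by (induction rule: rtrancl_induct) (use realize_glue in fastforce)+
qed

text \<open>Only single steps matter: jumps between glued points do not change
  \<open>realize\<close>, a move within a cube is bounded by \<open>height_lipschitz\<close> and
  \<open>l2_step_to_simplex\<close>, and any other step costs infinity.\<close>

lemma realize_lipschitz: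
  "l2_dist K (realize p) (realize q) \<le> ennreal (real k * (real k + 1)) * glue_dist C p q"
  unfolding glue_dist_def
proof (rule chain_dist_greatest[where \<rho> = "\<lambda>p q. l2_dist K (realize p) (realize q)"])
  let ?L = "real k * (real k + 1)"
  \<comment> \<open>A positive constant keeps the forbidden steps infinite.\<close>
  have L: "ennreal ?L * \<infinity> = \<infinity>" using k_pos by (simp add: ennreal_mult_top)
  fix p q assume p: "p \<in> cell_pts C" and q: "q \<in> cell_pts C"
  obtain m x s where pe: "p = (m, x, s)" by (cases p) auto
  obtain n y t where qe: "q = (n, y, t)" by (cases q) auto
  consider "(p, q) \<in> glue_equiv C" | "(p, q) \<notin> glue_equiv C" "m = n" "x = y"
    | "(p, q) \<notin> glue_equiv C" "\<not> (m = n \<and> x = y)" by blast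
  then show "l2_dist K (realize p) (realize q) \<le> ennreal ?L * glue_step C p q"
  proof cases
    case 1
    then have "realize p = realize q" by (rule realize_glue_equiv)
    then have "l2_dist K (realize p) (realize q) = 0"
      unfolding l2_dist_def using realize_pts[OF q] by (simp add: chain_dist_refl)
    then show ?thesis by simp
  next
    case 2
    obtain c where c: "c \<in> face_cells K n" "x = code n c" using q 2 by (auto simp: qe cell_pts_def cells_C)
    have s: "s \<in> cube_pts n" and t: "t \<in> cube_pts n" using p q 2 by (auto simp: pe qe cell_pts_def)
    define \<delta> where "\<delta> = Max (insert 0 ((\<lambda>i. \<bar>s ! i - t ! i\<bar>) ` {..<length s}))"
    have ls: "length s = n" using s by (simp add: cube_pts_def)
    have d: "\<bar>s ! i - t ! i\<bar> \<le> \<delta>" if "i < n" for i unfolding \<delta>_def ls using that by (intro Max_ge) auto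
    have d0: "0 \<le> \<delta>" unfolding \<delta>_def by (intro Max_ge) auto
    note h = height_cubic[OF K c(1)]
    have "l2_dist K (realize p) (realize q) \<le> l2_step K (realize p) (realize q)"
      unfolding l2_dist_def by (intro chain_dist_le_step realize_pts p q)
    also have "\<dots> = l2_step K (to_simplex (height c s)) (to_simplex (height c t))"
      using decode_code[OF c(1)] by (simp add: realize_def pe qe 2(2) 2(3)[symmetric] c(2))
    also have "\<dots> \<le> ennreal (?L * \<delta>)"
      by (rule l2_step_to_simplex[OF K h(3)[OF t] card_le[OF h(3)[OF t]] h(1,2)[OF s] h(1,2)[OF t]
            height_lipschitz[OF c(1) s t d d0]])
    also have "\<dots> = ennreal ?L * ennreal \<delta>" using d0 by (simp add: ennreal_mult)
    also have "\<dots> = ennreal ?L * glue_step C p q"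
      using 2 by (simp add: glue_step_def pe qe max_dist_def \<delta>_def)
    finally show ?thesis .
  next
    case 3
    then have "glue_step C p q = \<infinity>" by (auto simp: glue_step_def pe qe)
    then show ?thesis using L by simp
  qed
next
  show "l2_dist K (realize p) (realize p) = 0" if "p \<in> cell_pts C" for p
    using realize_pts[OF that] by (simp add: l2_dist_def chain_dist_refl)
qed (use k_pos in \<open>auto simp: l2_dist_def chain_dist_triangle ennreal_eq_0_iff mult_le_0_iff\<close>)

section \<open>The section into the realization, on representatives\<close>

definition cell_point :: "'u set \<Rightarrow> 'u list \<Rightarrow> ('u \<Rightarrow> real) \<Rightarrow> nat \<times> 'u \<times> real list" where
  "cell_point A vs u = (length vs, code (length vs) (interval_cell A vs), map u vs)"

lemma cell_point_in_cell_pts: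
  assumes "A \<noteq> {}" "A \<union> set vs \<in> K" "\<And>b. 0 \<le> u b \<and> u b \<le> 1"
  shows "cell_point A vs u \<in> cell_pts C"
  using interval_cell_in_face_cells[OF K assms(1,2)] assms(3)
  by (auto simp: cell_point_def cell_pts_def cells_C cube_pts_def)

text \<open>A coordinate 0 or 1 puts the point on the face of the cube that fixes this axis, so
  gluing removes the axis.\<close>

lemma cell_point_step:
  assumes A: "A \<noteq> {}" "A \<union> set (xs @ b # ys) \<in> K" and u: "\<And>b. 0 \<le> u b \<and> u b \<le> 1"
    and b: "u b = (if \<epsilon> then 1 else 0)"
  shows "(cell_point A (xs @ b # ys) u, cell_point (if \<epsilon> then insert b A else A) (xs @ ys) u) \<in> glue_equiv C"
proof -
  let ?A = "if \<epsilon> then insert b A else A"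
  let ?i = "length xs" and ?m = "length (xs @ ys)"
  define \<phi> where "\<phi> = insert_vertex ?i \<epsilon> ?m"
  have \<phi>: "cube_mor ?m (Suc ?m) \<phi>" using cube_mor_insert_vertex[of ?i "length ys" \<epsilon>] by (simp add: \<phi>_def)
  have "?A \<noteq> {}" "?A \<union> set (xs @ ys) \<subseteq> A \<union> set (xs @ b # ys)" using A by auto
  moreover from this have "?A \<union> set (xs @ ys) \<in> K" using K A unfolding abstract_complex_def by blast
  ultimately have p: "cell_point ?A (xs @ ys) u \<in> cell_pts C" using u by (intro cell_point_in_cell_pts)
  have q: "cell_point A (xs @ b # ys) u \<in> cell_pts C" by (rule cell_point_in_cell_pts[OF A u])
  note c = interval_cell_in_face_cells[OF K A]
  have t: "map u (xs @ ys) \<in> cube_pts ?m" "map u (xs @ b # ys) \<in> cube_pts (Suc ?m)"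
    using u by (auto simp: cube_pts_def)
  have "thr \<theta> (map u (xs @ b # ys)) = \<phi> (thr \<theta> (map u (xs @ ys)))" if "0 < \<theta>" "\<theta> \<le> 1" for \<theta>
    using that b by (simp add: \<phi>_def insert_vertex_def thr_def cube_verts_def)
  then have "linear_ext ?m (Suc ?m) \<phi> (map u (xs @ ys)) = map u (xs @ b # ys)"
    by (rule linear_ext_eqI[OF \<phi> t])
  moreover have "act C ?m (Suc ?m) \<phi> (code (Suc ?m) (interval_cell A (xs @ b # ys))) =
      code ?m (interval_cell ?A (xs @ ys))"
    using act_C[of "interval_cell A (xs @ b # ys)" "Suc ?m"] c interval_cell_insert_vertex[of xs ys A b \<epsilon>]
    by (simp add: \<phi>_def)
  moreover have "code (Suc ?m) (interval_cell A (xs @ b # ys)) \<in> cells C (Suc ?m)"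
    using c by (auto simp: cells_C)
  ultimately have "(cell_point ?A (xs @ ys) u, cell_point A (xs @ b # ys) u) \<in> glue C"
    using \<phi> t(1) unfolding glue_def cell_point_def mem_Collect_eq by (intro exI[of _ ?m] exI[of _ "Suc ?m"] exI) auto
  then show ?thesis using p q by (auto simp: glue_equiv_def)
qed

text \<open>The axes at which u is 0 or 1 are removed one by one; xs holds the axes already passed
  and kept, and so varies in the induction.\<close>

lemma cell_point_reduce:
  assumes "A \<noteq> {}" "A \<union> set (xs @ vs) \<in> K" and u: "\<And>b. 0 \<le> u b \<and> u b \<le> 1"
  shows "(cell_point A (xs @ vs) u,
     cell_point (A \<union> {b \<in> set vs. u b = 1}) (xs @ filter (\<lambda>b. 0 < u b \<and> u b < 1) vs) u) \<in> glue_equiv C"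
  using assms(1,2)
proof (induction vs arbitrary: A xs)
  case Nil
  then show ?case using cell_point_in_cell_pts[of A xs u] u by (simp add: glue_equiv_def)
next
  case (Cons b vs)
  have step: "(cell_point A (xs @ b # vs) u, cell_point (if \<epsilon> then insert b A else A) (xs @ vs) u) \<in> glue_equiv C"
    if "u b = (if \<epsilon> then 1 else 0)" for \<epsilon>
    by (rule cell_point_step[where u = u, OF Cons.prems u that])
  consider "u b = 0" | "u b = 1" | "0 < u b" "u b < 1" using u[of b] by fastforce
  then show ?case
  proof cases
    case 1
    have "A \<union> set (xs @ vs) \<subseteq> A \<union> set (xs @ b # vs)" by auto
    then have AK: "A \<union> set (xs @ vs) \<in> K" using Cons.prems K unfolding abstract_complex_def by blast
    have eq: "{c \<in> set (b # vs). u c = 1} = {c \<in> set vs. u c = 1}" using 1 by auto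
    show ?thesis
      unfolding eq using trans_glue_equiv[OF _ Cons.IH[OF Cons.prems(1) AK]] step[of False] 1 by simp
  next
    case 2
    have AK: "insert b A \<union> set (xs @ vs) \<in> K" using Cons.prems(2) by simp
    have eq: "A \<union> {c \<in> set (b # vs). u c = 1} = insert b A \<union> {c \<in> set vs. u c = 1}" using 2 by auto
    show ?thesis
      unfolding eq using trans_glue_equiv[OF _ Cons.IH[OF insert_not_empty AK]] step[of True] 2 by simp
  next
    case 3
    then have eq: "{c \<in> set (b # vs). u c = 1} = {c \<in> set vs. u c = 1}" by auto
    show ?thesis
      unfolding eq using Cons.IH[of A "xs @ [b]"] Cons.prems 3 by simp
  qed
qed

text \<open>Only coordinates strictly between 0 and 1 get an axis. This smallest cell involves no
  choice of a simplex or of a vertex with coordinate 1.\<close>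

definition cubic_rep :: "('u \<Rightarrow> real) \<Rightarrow> nat \<times> 'u \<times> real list" where
  "cubic_rep u = cell_point {b. u b = 1} (enum {b. 0 < u b \<and> u b < 1}) u"

text \<open>Moves the representative into the larger cube of the interval from {a} to \<tau>. Points
  of \<tau> with a common coordinate 1 at a thus meet in one cube, where their distance can be read
  off; \<open>enum_filter\<close> makes the axes of the small cell a sublist of those of the large
  one.\<close>

lemma cubic_rep_equiv:
  assumes u: "u \<in> cubic_pts K" "carrier_of u \<subseteq> \<tau>" "u a = 1" and \<tau>: "\<tau> \<in> K"
  shows "(cell_point {a} (enum (\<tau> - {a})) u, cubic_rep u) \<in> glue_equiv C"
proof -
  have fin: "finite (\<tau> - {a})" using K \<tau> by (auto simp: abstract_complex_def)
  have ub: "0 \<le> u b \<and> u b \<le> 1" for b using u by (auto simp: cubic_pts_def)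
  have a: "a \<in> \<tau>" using u by (auto simp: carrier_of_def)
  have sub: "{b. 0 < u b \<and> u b < 1} \<subseteq> \<tau> - {a}" using u by (auto simp: carrier_of_def)
  have "enum {b. 0 < u b \<and> u b < 1} = filter (\<lambda>b. 0 < u b \<and> u b < 1) (enum (\<tau> - {a}))"
    using enum_filter[OF fin sub] by simp
  moreover have "{b. u b = 1} = {a} \<union> {b \<in> set (enum (\<tau> - {a})). u b = 1}"
    using u by (auto simp: enum[OF fin] carrier_of_def)
  moreover have "{a} \<union> set ([] @ enum (\<tau> - {a})) \<in> K" using enum[OF fin] a \<tau> by (simp add: insert_absorb)
  ultimately show ?thesis using cell_point_reduce[of "{a}" "[]" "enum (\<tau> - {a})" u] ub by (simp add: cubic_rep_def)
qed

lemma cubic_rep_pts: "u \<in> cubic_pts K \<Longrightarrow> cubic_rep u \<in> cell_pts C"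
  using cubic_rep_equiv[of u "carrier_of u"] by (auto simp: glue_equiv_def cubic_pts_def)

lemma realize_cubic_rep:
  assumes u: "u \<in> cubic_pts K" shows "realize (cubic_rep u) = to_simplex u"
proof -
  obtain a where a: "u a = 1" using u by (auto simp: cubic_pts_def)
  let ?\<tau> = "carrier_of u"
  have \<tau>: "?\<tau> \<in> K" "a \<in> ?\<tau>" using u a by (auto simp: cubic_pts_def carrier_of_def)
  have fin: "finite (?\<tau> - {a})" using K \<tau> by (auto simp: abstract_complex_def)
  have A: "{a} \<noteq> {}" "{a} \<union> set (enum (?\<tau> - {a})) \<in> K" "?\<tau> \<subseteq> {a} \<union> set (enum (?\<tau> - {a}))"
    using enum[OF fin] \<tau> by (auto simp: insert_absorb)
  have "realize (cubic_rep u) = realize (cell_point {a} (enum (?\<tau> - {a})) u)"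
    using realize_glue_equiv[OF cubic_rep_equiv[OF u order_refl a \<tau>(1)]] by simp
  also have "\<dots> = to_simplex (height (interval_cell {a} (enum (?\<tau> - {a}))) (map u (enum (?\<tau> - {a}))))"
    using interval_cell_in_face_cells[OF K A(1,2)] by (simp add: realize_def cell_point_def decode_code)
  also have "\<dots> = to_simplex u"
    using height_interval_cell[OF K A(1,2) _ _ A(3)] u a by (simp add: cubic_pts_def)
  finally show ?thesis .
qed

lemma glue_dist_cubic_rep_face:
  assumes u: "u \<in> cubic_pts K" "carrier_of u \<subseteq> \<tau>" "u a = 1"
    and w: "w \<in> cubic_pts K" "carrier_of w \<subseteq> \<tau>" "w a = 1" and \<tau>: "\<tau> \<in> K"
    and \<delta>: "\<And>b. \<bar>u b - w b\<bar> \<le> \<delta>"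
  shows "glue_dist C (cubic_rep u) (cubic_rep w) \<le> ennreal \<delta>"
proof -
  let ?vs = "enum (\<tau> - {a})"
  let ?p = "cell_point {a} ?vs u" and ?q = "cell_point {a} ?vs w"
  have eq: "(?p, cubic_rep u) \<in> glue_equiv C" "(?q, cubic_rep w) \<in> glue_equiv C"
    using cubic_rep_equiv u w \<tau> by blast+
  then have pq: "?p \<in> cell_pts C" "?q \<in> cell_pts C" by (auto simp: glue_equiv_def)
  have "0 \<le> \<delta>" using \<delta>[of a] u w by simp
  then have "max_dist (map u ?vs) (map w ?vs) \<le> ennreal \<delta>"
    unfolding max_dist_def using \<delta> by (intro ennreal_leI Max.boundedI) auto
  then have "glue_step C ?p ?q \<le> ennreal \<delta>" by (simp add: glue_step_def cell_point_def)
  then have d: "glue_dist C ?p ?q \<le> ennreal \<delta>"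
    unfolding glue_dist_def using chain_dist_le_step[OF pq] by (rule order_trans[rotated])
  have z: "glue_dist C (cubic_rep u) ?p = 0" "glue_dist C ?q (cubic_rep w) = 0"
    using glue_dist_glue_equiv[OF sym_glue_equiv[OF eq(1)]] glue_dist_glue_equiv[OF eq(2)] by auto
  have "glue_dist C (cubic_rep u) (cubic_rep w) \<le> glue_dist C (cubic_rep u) ?p + glue_dist C ?p (cubic_rep w)"
    by (rule glue_dist_triangle)
  also have "\<dots> \<le> glue_dist C (cubic_rep u) ?p + (glue_dist C ?p ?q + glue_dist C ?q (cubic_rep w))"
    by (intro add_left_mono glue_dist_triangle)
  finally show ?thesis using d z by simp
qed

text \<open>Raising the coordinate of \<open>u\<close> at which \<open>w\<close> is \<open>1\<close> gives a point in a common face with each.\<close>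

lemma glue_dist_cubic_rep:
  assumes u: "u \<in> cubic_pts K" "carrier_of u \<subseteq> \<tau>"
    and w: "w \<in> cubic_pts K" "carrier_of w \<subseteq> \<tau>" and \<tau>: "\<tau> \<in> K"
    and \<delta>: "\<And>b. \<bar>u b - w b\<bar> \<le> \<delta>"
  shows "glue_dist C (cubic_rep u) (cubic_rep w) \<le> ennreal (2 * \<delta>)"
proof -
  obtain a b where ab: "u a = 1" "w b = 1" using u w by (auto simp: cubic_pts_def)
  define z where "z = u(b := 1)"
  have z1: "z a = 1" "z b = 1" using ab by (auto simp: z_def)
  have "w b \<noteq> 0" using ab by simp
  then have "b \<in> \<tau>" using w(2) unfolding carrier_of_def by blast
  then have cz: "carrier_of z \<subseteq> \<tau>" using u(2) by (auto simp: z_def carrier_of_def)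
  have "b \<in> carrier_of z" using z1 by (simp add: carrier_of_def)
  then have "carrier_of z \<in> K" using K \<tau> cz unfolding abstract_complex_def by blast
  then have z: "z \<in> cubic_pts K" using u z1 by (auto simp: cubic_pts_def z_def)
  have d0: "0 \<le> \<delta>" using \<delta>[of a] by linarith
  have "\<bar>u c - z c\<bar> \<le> \<delta>" for c using \<delta>[of b] d0 ab by (auto simp: z_def)
  then have 1: "glue_dist C (cubic_rep u) (cubic_rep z) \<le> ennreal \<delta>"
    by (rule glue_dist_cubic_rep_face[OF u ab(1) z cz z1(1) \<tau>])
  have "\<bar>z c - w c\<bar> \<le> \<delta>" for c using \<delta> d0 ab by (auto simp: z_def)
  then have 2: "glue_dist C (cubic_rep z) (cubic_rep w) \<le> ennreal \<delta>"
    by (rule glue_dist_cubic_rep_face[OF z cz z1(2) w ab(2) \<tau>])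
  have "glue_dist C (cubic_rep u) (cubic_rep w) \<le> ennreal \<delta> + ennreal \<delta>"
    using glue_dist_triangle[of C "cubic_rep u" "cubic_rep w" "cubic_rep z"] add_mono[OF 1 2] by (rule order_trans)
  then show ?thesis using d0 by (simp flip: ennreal_plus)
qed

lemma cubic_rep_lipschitz:
  "glue_dist C (cubic_rep (to_cube x)) (cubic_rep (to_cube y)) \<le> ennreal (4 * real k) * l2_dist K x y"
  if "x \<in> complex_pts K" "y \<in> complex_pts K" for x y
  unfolding l2_dist_def
proof (rule chain_dist_greatest[where \<rho> = "\<lambda>x y. glue_dist C (cubic_rep (to_cube x)) (cubic_rep (to_cube y))"])
  fix x y assume x: "x \<in> complex_pts K" and y: "y \<in> complex_pts K"
  show "glue_dist C (cubic_rep (to_cube x)) (cubic_rep (to_cube y)) \<le> ennreal (4 * real k) * l2_step K x y"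
  proof (cases "\<exists>\<tau>\<in>K. carrier_of x \<subseteq> \<tau> \<and> carrier_of y \<subseteq> \<tau>")
    case True
    then obtain \<tau> where \<tau>: "\<tau> \<in> K" "carrier_of x \<subseteq> \<tau>" "carrier_of y \<subseteq> \<tau>" by blast
    define D where "D = L2_set (\<lambda>v. x v - y v) (carrier_of x \<union> carrier_of y)"
    have D: "l2_step K x y = ennreal D" using True by (simp add: l2_step_def D_def)
    have d: "\<bar>x b - y b\<bar> \<le> D" for b
      unfolding D_def by (rule abs_diff_le_L2_set[OF K x y])
    note cx = to_cube_pts[OF K x card_le] and cy = to_cube_pts[OF K y card_le]
    \<comment> \<open>The factor 2 k is that of \<open>to_cube_lipschitz\<close>; the outer 2 comes
      from the detour in \<open>glue_dist_cubic_rep\<close>.\<close>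
    have "glue_dist C (cubic_rep (to_cube x)) (cubic_rep (to_cube y)) \<le> ennreal (2 * (2 * real k * D))"
      by (rule glue_dist_cubic_rep[where \<tau> = \<tau>])
        (use cx cy \<tau> to_cube_lipschitz[OF K card_le x y d] in simp_all)
    also have "\<dots> = ennreal (4 * real k) * ennreal D" by (simp add: D_def flip: ennreal_mult)
    finally show ?thesis by (simp add: D)
  next
    case False
    then have "l2_step K x y = \<infinity>" by (auto simp: l2_step_def)
    then show ?thesis using k_pos by (simp add: ennreal_mult_top)
  qed
next
  show "glue_dist C (cubic_rep (to_cube x)) (cubic_rep (to_cube x)) = 0" if "x \<in> complex_pts K" for x
    by (intro glue_dist_refl cubic_rep_pts to_cube_pts(1)[OF K that card_le])
qed (use k_pos in \<open>simp_all add: glue_dist_triangle\<close>)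

lemma l2_complex_retract:
  "\<exists>s r. uniform_map (l2_complex TYPE('u) K) (uniform_realization TYPE('u) C) s \<and>
     uniform_map (uniform_realization TYPE('u) C) (l2_complex TYPE('u) K) r \<and>
     (\<forall>x\<in>upts (l2_complex TYPE('u) K). r (s x) = x)"
proof -
  define s where "s = (\<lambda>x. glue_class C (cubic_rep (to_cube x)))"
  define r where "r = (\<lambda>P. realize (SOME p. p \<in> P))"
  have up: "upts (l2_complex TYPE('u) K) = complex_pts K" by (simp add: l2_complex_def coreflection_def)
  have rep: "cubic_rep (to_cube x) \<in> cell_pts C" if "x \<in> complex_pts K" for x
    by (intro cubic_rep_pts to_cube_pts(1)[OF K that card_le])
  \<comment> \<open>Coreflection is functorial, so it suffices that s and r are Lipschitz for the
    metrics.\<close>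
  have "uniform_map (l2_complex TYPE('u) K) (uniform_realization TYPE('u) C) s"
    unfolding l2_complex_def uniform_realization_def
  proof (intro coreflection_map uniform_map_metricI)
    show "s \<in> complex_pts K \<rightarrow> metric_realization_pts C" using rep by (auto simp: s_def metric_realization_pts_eq)
    show "metric_realization_dist C (s x) (s y) \<le> ennreal (4 * real k) * l2_dist K x y"
      if "x \<in> complex_pts K" "y \<in> complex_pts K" for x y
      using cubic_rep_lipschitz[OF that] rep that by (simp add: s_def metric_realization_dist_class)
  qed (use k_pos in simp)
  moreover have "uniform_map (uniform_realization TYPE('u) C) (l2_complex TYPE('u) K) r"
    unfolding l2_complex_def uniform_realization_def
  proof (intro coreflection_map uniform_map_metricI)
    show "r \<in> metric_realization_pts C \<rightarrow> complex_pts K"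
      using some_in_glue_class[of _ C] by (auto simp: r_def intro: realize_pts)
    show "l2_dist K (r P) (r Q) \<le> ennreal (real k * (real k + 1)) * metric_realization_dist C P Q"
      if "P \<in> metric_realization_pts C" "Q \<in> metric_realization_pts C" for P Q
      using realize_lipschitz[of "SOME p. p \<in> P" "SOME p. p \<in> Q"] some_in_glue_class[OF that(1)]
        some_in_glue_class[OF that(2)] metric_realization_dist_class[of "SOME p. p \<in> P" C "SOME p. p \<in> Q"]
      by (simp add: r_def)
  qed (use k_pos in simp)
  moreover have "r (s x) = x" if x: "x \<in> complex_pts K" for x
  proof -
    define p where "p = (SOME p. p \<in> s x)"
    have "s x \<in> metric_realization_pts C" using rep[OF x] by (simp add: s_def metric_realization_pts_eq)
    then have p: "p \<in> cell_pts C" "glue_class C p = s x"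
      using some_in_glue_class[of "s x" C] by (simp_all add: p_def)
    \<comment> \<open>The representative that r picks may differ from the one given by s, but only
      by pseudodistance 0; the Lipschitz bound and the separation of \<open>l2_dist\<close> make
      their images equal.\<close>
    have "glue_dist C p (cubic_rep (to_cube x)) = 0"
      using glue_class_eq_iff[OF p(1) rep[OF x]] p(2) by (simp add: s_def)
    then have "l2_dist K (realize p) (realize (cubic_rep (to_cube x))) = 0"
      using realize_lipschitz[of p "cubic_rep (to_cube x)"] by simp
    then have "realize p = realize (cubic_rep (to_cube x))"
      using emetric_on_l2 realize_pts[OF p(1)] realize_pts[OF rep[OF x]] unfolding emetric_on_def by blast
    also have "\<dots> = x"
      using realize_cubic_rep to_cube_pts[OF K x card_le] by simp
    finally show ?thesis by (simp add: r_def p_def)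
  qed
  ultimately show ?thesis unfolding up by blast
qed

end

text \<open>A cube of the nerve is a finite table of finite sets, so two rounds of coding lists
  suffice: one for each face, one for the table.\<close>

lemma code_face_cells:
  fixes enum :: "'u set \<Rightarrow> 'u list"
  assumes inf: "infinite (UNIV :: 'u set)" and K: "abstract_complex (K :: 'u set set)"
    and enum: "\<And>B. finite B \<Longrightarrow> set (enum B) = B"
  shows "\<exists>code :: (bool list \<Rightarrow> 'u set) \<Rightarrow> 'u. inj_on code (face_cells K n)"
proof -
  obtain f :: "'u list \<Rightarrow> 'u" where f: "inj f" using inj_lists_infinite[OF inf] by blast
  have "finite (cube_verts n)"
    unfolding cube_verts_def using finite_lists_length_eq[of "UNIV :: bool set" n] by simp
  then obtain vs where vs: "set vs = cube_verts n" using finite_list by blast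
  have "inj_on (\<lambda>c. f (map (\<lambda>v. f (enum (c v))) vs)) (face_cells K n)"
  proof (rule inj_onI)
    fix c c' assume c: "c \<in> face_cells K n" "c' \<in> face_cells K n"
      and "f (map (\<lambda>v. f (enum (c v))) vs) = f (map (\<lambda>v. f (enum (c' v))) vs)"
    then have "map (\<lambda>v. f (enum (c v))) vs = map (\<lambda>v. f (enum (c' v))) vs" by (simp add: inj_eq[OF f])
    then have e: "enum (c v) = enum (c' v)" if "v \<in> cube_verts n" for v
      using that vs by (simp add: inj_eq[OF f])
    have "c v = c' v" if "v \<in> cube_verts n" for v
    proof -
      have "finite (c v)" "finite (c' v)" using c that K by (auto simp: face_cells_def abstract_complex_def)
      then show ?thesis using e[OF that] enum by metis
    qed
    then show "c = c'" using c by (intro extensionalityI[of _ "cube_verts n"]) (auto simp: face_cells_def)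
  qed
  then show ?thesis by blast
qed

theorem corollary3p19:
  fixes K :: "'u set set"
  assumes "\<exists>i :: real \<Rightarrow> 'u. inj i"
    and "abstract_complex K" and "finite_dimensional K"
  shows "uniformly_cofibrant TYPE('u) (l2_complex TYPE('u) K)"
proof -
  obtain i :: "real \<Rightarrow> 'u" where i: "inj i" using assms(1) by blast
  have inf: "infinite (UNIV :: 'u set)"
    using i infinite_UNIV_char_0[where 'a = real] finite_subset[of "range i"] finite_imageD by blast
  obtain k where k: "\<And>\<sigma>. \<sigma> \<in> K \<Longrightarrow> card \<sigma> \<le> k + 1" using assms(3) unfolding finite_dimensional_def by blast
  obtain enum :: "'u set \<Rightarrow> 'u list" where enum: "\<And>B. finite B \<Longrightarrow> set (enum B) = B"
    "\<And>B B'. finite B \<Longrightarrow> B' \<subseteq> B \<Longrightarrow> enum B' = filter (\<lambda>b. b \<in> B') (enum B)"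
    using enumerate_finite_sets[where 'a = 'u] by metis
  obtain code :: "nat \<Rightarrow> (bool list \<Rightarrow> 'u set) \<Rightarrow> 'u" where code: "\<And>n. inj_on (code n) (face_cells K n)"
    using code_face_cells[OF inf assms(2) enum(1)] by metis
  interpret coded_complex K "k + 1" enum code
  proof
    show "card \<sigma> \<le> k + 1" if "\<sigma> \<in> K" for \<sigma> by (rule k[OF that])
  qed (fact assms(2), simp, fact enum(1), fact enum(2), fact code)
  let ?X = "l2_complex TYPE('u) K" and ?R = "uniform_realization TYPE('u) C"
  obtain s r where s: "uniform_map ?X ?R s" and r: "uniform_map ?R ?X r"
    and rs: "\<And>x. x \<in> upts ?X \<Longrightarrow> r (s x) = x"
    using l2_complex_retract by blast
  obtain j :: "_ \<Rightarrow> 'u" where j: "inj_on j (metric_realization_pts C)"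
    using inj_metric_realization_pts[OF i] by blast
  show ?thesis
    unfolding uniformly_cofibrant_def
  proof (intro conjI allI impI)
    show "U_object TYPE('u) ?X"
      unfolding l2_complex_def by (rule U_object_coreflection_metric[OF emetric_on_l2])
  next
    fix E Y :: "'u uspace" and p g
    assume "U_object TYPE('u) E \<and> U_object TYPE('u) Y \<and> uniform_weak_equivalence TYPE('u) E Y p \<and>
      uniform_hurewicz_fibration TYPE('u) E Y p \<and> uniform_map ?X Y g"
    then have w: "uniform_weak_equivalence TYPE('u) E Y p" and f: "uniform_hurewicz_fibration TYPE('u) E Y p"
      and g: "uniform_map ?X Y g" by blast+
    \<comment> \<open>The lift is taken for g o r; its restriction along s lies over g o r o s =
      g.\<close>
    obtain l where l: "uniform_map ?R E l" "\<forall>y\<in>upts ?R. p (l y) = g (r y)"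
      using uniform_realization_lift[OF cubical_set_C emetric_on_metric_realization j w f uniform_map_comp[OF r g]]
      by blast
    have "s x \<in> upts ?R" if "x \<in> upts ?X" for x using s that by (auto simp: uniform_map_def)
    then show "\<exists>l. uniform_map ?X E l \<and> (\<forall>x\<in>upts ?X. p (l x) = g x)"
      using uniform_map_comp[OF s l(1)] l(2) rs by (intro exI[of _ "\<lambda>x. l (s x)"]) simp
  qed
qed

end
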